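(* Let $N\ge5$, let $\Omega$ be a nonempty bounded open subset of $\mathbb{R}^N$, and let $\Omega_s$ be any nonempty open subset of $\Omega$. Then there exists an (explicit) function $F\in L^2(\Omega)$ such that the singular set $\operatorname{Sing}u$ of the associated weak solution $u\in H_0^1(\Omega)$ of $-\Delta u=F(x)$ in $\Omega$ is dense in $\Omega_s$ (that is, $\overline{\operatorname{Sing}u}=\overline{\Omega_s}$), while $u\in C^{2,\alpha}_{loc}(\Omega\setminus\overline{\Omega_s})$ for any $\alpha\in(0,1)$. Moreover, $F$ can be chosen so that, in addition, $u$ is maximally singular, i.e. $\dim_H(\operatorname{Sing}u)=N-4$.
   Context: For a Lebesgue measurable function $u:\Omega\to\overline{\mathbb{R}}$ on an open set $\Omega\subseteq\mathbb{R}^N$, the singular set $\operatorname{Sing}u$ is the set of points $a\in\Omega$ for which there exist positive constants $C=C(a)$, $\gamma=\gamma(a)$, $r=r(a)$ such that $u(x)\ge C|x-a|^{-\gamma}$ for a.e. $x\in B_r(a)$, where $B_r(a)$ is the open ball of radius $r$ centred at $a$. $\dim_H$ denotes the Hausdorff dimension. *)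

theory Defs
  imports "HOL-Analysis.Analysis"
begin

section \<open>Differentiability classes\<close>

definition partial :: "'a::euclidean_space \<Rightarrow> ('a \<Rightarrow> real) \<Rightarrow> 'a \<Rightarrow> real" where
  "partial b f x = frechet_derivative f (at x) b"

definition grad :: "('a::euclidean_space \<Rightarrow> real) \<Rightarrow> 'a \<Rightarrow> 'a" where
  "grad f x = (\<Sum>b\<in>Basis. partial b f x *\<^sub>R b)"

text \<open>Only meaningful for open \<open>S\<close>, since derivatives are taken in the ambient space.\<close>

primrec Ck_on :: "nat \<Rightarrow> 'a::euclidean_space set \<Rightarrow> ('a \<Rightarrow> real) \<Rightarrow> bool" where
  "Ck_on 0 S f \<longleftrightarrow> continuous_on S f"
| "Ck_on (Suc k) S f \<longleftrightarrow>
     (\<forall>x\<in>S. f differentiable (at x)) \<and> (\<forall>b\<in>Basis. Ck_on k S (partial b f))"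

definition test_functions :: "'a::euclidean_space set \<Rightarrow> ('a \<Rightarrow> real) set" where
  "test_functions \<Omega> =
     {\<phi>. (\<forall>k. Ck_on k UNIV \<phi>) \<and> compact (closure {x. \<phi> x \<noteq> 0}) \<and> closure {x. \<phi> x \<noteq> 0} \<subseteq> \<Omega>}"

text \<open>The space $C^{2,\alpha}_{loc}(S)$ for open \<open>S\<close>: second derivatives are Hoelder continuous
  on compact subsets. Boundedness of the derivatives on compact sets is automatic.\<close>

definition C2_Holder_loc :: "real \<Rightarrow> 'a::euclidean_space set \<Rightarrow> ('a \<Rightarrow> real) set" where
  "C2_Holder_loc \<alpha> S =
     {f. Ck_on 2 S f \<and>
         (\<forall>K. compact K \<and> K \<subseteq> S \<longrightarrow>
            (\<forall>b\<in>Basis. \<forall>c\<in>Basis. \<exists>L. \<forall>x\<in>K. \<forall>y\<in>K.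
               \<bar>partial b (partial c f) x - partial b (partial c f) y\<bar> \<le> L * dist x y powr \<alpha>))}"

section \<open>Lebesgue and Sobolev spaces\<close>

text \<open>Elements are functions, not classes modulo null sets; values outside \<open>\<Omega>\<close> are irrelevant.\<close>

definition L2 :: "'a::euclidean_space set \<Rightarrow> ('a \<Rightarrow> 'b::euclidean_space) set" where
  "L2 \<Omega> = {f \<in> borel_measurable (lebesgue_on \<Omega>). integrable (lebesgue_on \<Omega>) (\<lambda>x. (norm (f x))\<^sup>2)}"

text \<open>\<open>u\<close> belongs to $H^1(\Omega)$ and \<open>g\<close> is its weak gradient.\<close>

definition H1_gradient :: "'a::euclidean_space set \<Rightarrow> ('a \<Rightarrow> real) \<Rightarrow> ('a \<Rightarrow> 'a) \<Rightarrow> bool" where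
  "H1_gradient \<Omega> u g \<longleftrightarrow>
     u \<in> L2 \<Omega> \<and> g \<in> L2 \<Omega> \<and>
     (\<forall>\<phi>\<in>test_functions \<Omega>. \<forall>b\<in>Basis.
        (LINT x|lebesgue_on \<Omega>. u x * partial b \<phi> x) = - (LINT x|lebesgue_on \<Omega>. (g x \<bullet> b) * \<phi> x))"

text \<open>The closure of the test functions in the norm of $H^1(\Omega)$.\<close>

definition H10 :: "'a::euclidean_space set \<Rightarrow> ('a \<Rightarrow> real) set" where
  "H10 \<Omega> =
     {u. \<exists>g. H1_gradient \<Omega> u g \<and>
        (\<exists>\<phi>. (\<forall>n. \<phi> n \<in> test_functions \<Omega>) \<and>
           (\<lambda>n. (LINT x|lebesgue_on \<Omega>. (u x - \<phi> n x)\<^sup>2) +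
                (LINT x|lebesgue_on \<Omega>. (norm (g x - grad (\<phi> n) x))\<^sup>2)) \<longlonglongrightarrow> 0)}"

text \<open>Weak formulation of $-\Delta u = F$ in \<open>\<Omega>\<close> with $u \in H^1_0(\Omega)$.\<close>

definition weak_solution ::
  "'a::euclidean_space set \<Rightarrow> ('a \<Rightarrow> real) \<Rightarrow> ('a \<Rightarrow> real) \<Rightarrow> bool" where
  "weak_solution \<Omega> F u \<longleftrightarrow>
     u \<in> H10 \<Omega> \<and>
     (\<exists>g. H1_gradient \<Omega> u g \<and>
        (\<forall>v\<in>H10 \<Omega>. \<forall>h. H1_gradient \<Omega> v h \<longrightarrow>
           (LINT x|lebesgue_on \<Omega>. g x \<bullet> h x) = (LINT x|lebesgue_on \<Omega>. F x * v x)))"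

section \<open>Singular set\<close>

text \<open>The balls are required to lie in \<open>\<Omega>\<close>, where \<open>u\<close> is defined; as \<open>\<Omega>\<close> is open and the radius
  may be decreased, this is no restriction. The value of the right-hand side at \<open>x = a\<close> is
  irrelevant.\<close>

definition Sing :: "'a::euclidean_space set \<Rightarrow> ('a \<Rightarrow> ereal) \<Rightarrow> 'a set" where
  "Sing \<Omega> u =
     {a\<in>\<Omega>. \<exists>C>0. \<exists>\<gamma>>0. \<exists>r>0. ball a r \<subseteq> \<Omega> \<and>
        (AE x in lebesgue_on (ball a r). ereal (C * norm (x - a) powr (- \<gamma>)) \<le> u x)}"

section \<open>Hausdorff dimension\<close>

text \<open>The covering sets are bounded because \<^const>\<open>diameter\<close> is unspecified on unbounded sets.
  Since \<open>0 powr 0 = 0\<close>, this is the usual (unnormalised) Hausdorff measure only for \<open>s > 0\<close>,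
  which suffices for the dimension.\<close>

definition hausdorff_premeasure :: "real \<Rightarrow> real \<Rightarrow> 'a::metric_space set \<Rightarrow> ennreal" where
  "hausdorff_premeasure s \<delta> S =
     (INF U\<in>{U :: nat \<Rightarrow> 'a set. S \<subseteq> (\<Union>i. U i) \<and> (\<forall>i. bounded (U i) \<and> diameter (U i) \<le> \<delta>)}.
        \<Sum>i. ennreal (diameter (U i) powr s))"

definition hausdorff_measure :: "real \<Rightarrow> 'a::metric_space set \<Rightarrow> ennreal" where
  "hausdorff_measure s S = (SUP \<delta>\<in>{0<..}. hausdorff_premeasure s \<delta> S)"

definition hausdorff_dim :: "'a::metric_space set \<Rightarrow> ennreal" where
  "hausdorff_dim S = (INF s\<in>{s. 0 < s \<and> hausdorff_measure s S = 0}. ennreal s)"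

end

theory Submission
  imports Defs
begin

text \<open>The solution \<open>u\<close> is built first, as an absolutely convergent series of nonnegative test
  functions supported in \<open>\<Omega>\<^sub>s\<close>; then \<open>F = - \<Delta>u\<close> is defined termwise, so that
  \<open>u\<close> vanishes outside \<open>\<Omega>\<^sub>s\<close> and no equation has to be solved.

  Given \<open>d < N - 4\<close>, take a self-similar Cantor set of dimension \<open>d\<close> whose \<open>j\<close>-th generation
  consists of \<open>B\<^bsup>jN\<^esup>\<close> well separated pieces of size \<open>r\<^sub>j\<close>, and put a bump of radius
  comparable to \<open>r\<^sub>j\<close> and height \<open>r\<^sub>j powr (-\<gamma>)\<close> on each piece. The sum over all generations
  blows up like \<open>dist powr (-\<gamma>)\<close> at the Cantor set. The Laplacians of the generations have
  square norms of order \<open>B\<^bsup>jN\<^esup> r\<^sub>j powr (N - 4 - 2\<gamma>)\<close>, which is summable for small \<open>\<gamma>\<close>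
  because \<open>d < N - 4\<close>. Such families, with dimensions tending to \<open>N - 4\<close> and located at a dense
  sequence of points of \<open>\<Omega>\<^sub>s\<close>, are added with rapidly decreasing weights.

  A point that avoids some neighbourhood \<open>E\<^sub>k\<close> of the \<open>k\<close>-th Cantor set sees bounded averages of
  the \<open>k\<close>-th family over all balls around it. If the weights are small enough, a point lying in only
  finitely many of the \<open>E\<^sub>k\<close> and in none of the Cantor sets therefore sees bounded averages of \<open>u\<close> and
  is not singular. Thus the singular set is contained in the union of the Cantor sets and of
  \<open>limsup E\<^sub>k\<close>, which is a null set for the Hausdorff measure of dimension \<open>N - 4\<close> when the
  \<open>E\<^sub>k\<close> shrink fast enough.\<close>

section \<open>Smooth functions\<close>

text \<open>The value N - 4 is the borderline at which r^(-d) bumps of radius r and height 1 have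
  Laplacians of square norm of order 1, since each contributes r^(N-4). The height exponent \<gamma>
  must be positive, so a single family stays strictly below the borderline and N - 4 is reached only
  as a supremum. The difficulty is the upper bound for the dimension. \<open>Sing\<close> admits
  arbitrarily small \<gamma>, while a dense superposition is unbounded near every point of the
  region, so pointwise bounds of \<open>u\<close> are hopeless. Averages over balls help because a
  singular point forces them to infinity as the radius shrinks, and because their bounds add up over
  the families. The order of choices matters: the bound for a family worsens as the neighbourhood
  shrinks, so each neighbourhood is fixed before the weight of its family. The finitely many
  exceptional families of a point enter with worse but finite bounds. The null set is obtained as in
  the Borel-Cantelli lemma, with Hausdorff premeasures in place of probabilities. The statement
  speaks of the associated solution, so uniqueness is proved too, by testing with the difference of
  two solutions.\<close>

lemma partial_eq:
  assumes "(f has_derivative f') (at x)"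
  shows "partial b f x = f' b"
  using frechet_derivative_at[OF assms] by (simp add: partial_def)

lemma Ck_on_SucD: "Ck_on (Suc k) UNIV f \<Longrightarrow> Ck_on k UNIV f"
proof (induction k arbitrary: f)
  case 0
  then show ?case
    by (simp add: continuous_at_imp_continuous_on differentiable_imp_continuous_within)
next
  case (Suc k)
  then show ?case by (metis Ck_on.simps(2))
qed

lemma partial_add:
  assumes "f differentiable (at x)" "g differentiable (at x)"
  shows "partial b (\<lambda>x. f x + g x) x = partial b f x + partial b g x"
proof -
  have "((\<lambda>x. f x + g x) has_derivative
      (\<lambda>h. frechet_derivative f (at x) h + frechet_derivative g (at x) h)) (at x)"
    using assms unfolding frechet_derivative_works by (rule has_derivative_add)
  then show ?thesis by (simp add: partial_eq) (simp add: partial_def)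
qed

lemma partial_mult:
  assumes "f differentiable (at x)" "g differentiable (at x)"
  shows "partial b (\<lambda>x. f x * g x) x = f x * partial b g x + partial b f x * g x"
proof -
  have "((\<lambda>x. f x * g x) has_derivative
      (\<lambda>h. f x * frechet_derivative g (at x) h + frechet_derivative f (at x) h * g x)) (at x)"
    using assms unfolding frechet_derivative_works by (rule has_derivative_mult)
  then show ?thesis by (simp add: partial_eq) (simp add: partial_def)
qed

lemma partial_const [simp]: "partial b (\<lambda>x. c) = (\<lambda>x. 0)"
  by (rule ext) (rule partial_eq[OF has_derivative_const])

lemma partial_affine:
  assumes "f differentiable (at ((1/r) *\<^sub>R (x - y)))"
  shows "partial b (\<lambda>x. f ((1/r) *\<^sub>R (x - y))) x = (1/r) * partial b f ((1/r) *\<^sub>R (x - y))"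
proof -
  define f' where "f' = frechet_derivative f (at ((1/r) *\<^sub>R (x - y)))"
  have f: "(f has_derivative f') (at ((1/r) *\<^sub>R (x - y)))"
    using assms by (simp add: f'_def frechet_derivative_works)
  have "((\<lambda>x. (1/r) *\<^sub>R (x - y)) has_derivative (\<lambda>h. (1/r) *\<^sub>R h)) (at x)"
    by (auto intro!: derivative_eq_intros)
  from has_derivative_compose[OF this f]
  have "partial b (\<lambda>x. f ((1/r) *\<^sub>R (x - y))) x = f' ((1/r) *\<^sub>R b)"
    by (rule partial_eq)
  also have "\<dots> = (1/r) * f' b"
    using f by (simp add: has_derivative_bounded_linear linear_simps(5))
  finally show ?thesis by (simp add: f'_def partial_def)
qed

definition smooth :: "('a::euclidean_space \<Rightarrow> real) \<Rightarrow> bool" where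
  "smooth f \<longleftrightarrow> (\<forall>k. Ck_on k UNIV f)"

lemma smooth_differentiable: "smooth f \<Longrightarrow> f differentiable (at x)"
  unfolding smooth_def by (metis Ck_on.simps(2) UNIV_I)

lemma smooth_partial: "smooth f \<Longrightarrow> b \<in> Basis \<Longrightarrow> smooth (partial b f)"
  unfolding smooth_def by (metis Ck_on.simps(2))

lemma smooth_continuous: "smooth f \<Longrightarrow> continuous_on UNIV f"
  unfolding smooth_def by (metis Ck_on.simps(1))

lemma smooth_const: "smooth (\<lambda>x::'a::euclidean_space. c)"
proof -
  have "Ck_on k UNIV (\<lambda>x::'a. c)" for k c
    by (induction k arbitrary: c) auto
  then show ?thesis by (simp add: smooth_def)
qed

lemma Ck_on_add:
  "Ck_on k UNIV f \<Longrightarrow> Ck_on k UNIV g \<Longrightarrow> Ck_on k UNIV (\<lambda>x. f x + g x)"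
proof (induction k arbitrary: f g)
  case 0
  then show ?case by (simp add: continuous_on_add)
next
  case (Suc k)
  then have "partial b (\<lambda>x. f x + g x) = (\<lambda>x. partial b f x + partial b g x)" for b
    by (auto simp: partial_add)
  then show ?case using Suc by simp
qed

lemma Ck_on_mult:
  "Ck_on k UNIV f \<Longrightarrow> Ck_on k UNIV g \<Longrightarrow> Ck_on k UNIV (\<lambda>x. f x * g x)"
proof (induction k arbitrary: f g)
  case 0
  then show ?case by (simp add: continuous_on_mult)
next
  case (Suc k)
  have "partial b (\<lambda>x. f x * g x) = (\<lambda>x. f x * partial b g x + partial b f x * g x)" for b
    using Suc.prems by (auto simp: partial_mult)
  moreover have "Ck_on k UNIV (\<lambda>x. f x * partial b g x + partial b f x * g x)" if "b \<in> Basis" for b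
    using Suc.prems that
    by (intro Ck_on_add Suc.IH Ck_on_SucD[OF Suc.prems(1)] Ck_on_SucD[OF Suc.prems(2)]) simp_all
  ultimately show ?case using Suc.prems by simp
qed

lemma smooth_add: "smooth f \<Longrightarrow> smooth g \<Longrightarrow> smooth (\<lambda>x. f x + g x)"
  by (simp add: smooth_def Ck_on_add)

lemma smooth_mult: "smooth f \<Longrightarrow> smooth g \<Longrightarrow> smooth (\<lambda>x. f x * g x)"
  by (simp add: smooth_def Ck_on_mult)

lemma smooth_sum:
  assumes "\<And>i. i \<in> I \<Longrightarrow> smooth (f i)"
  shows "smooth (\<lambda>x. \<Sum>i\<in>I. f i x)"
  using assms by (induction I rule: infinite_finite_induct) (auto intro: smooth_const smooth_add)

lemma partial_sum:
  assumes "\<And>i. i \<in> I \<Longrightarrow> smooth (f i)"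
  shows "partial b (\<lambda>x. \<Sum>i\<in>I. f i x) = (\<lambda>x. \<Sum>i\<in>I. partial b (f i) x)"
  using assms
proof (induction I rule: infinite_finite_induct)
  case (insert i I)
  then show ?case
    by (auto simp: partial_add smooth_differentiable smooth_sum)
qed auto

lemma partial_cmult:
  assumes "smooth f"
  shows "partial b (\<lambda>x. c * f x) = (\<lambda>x. c * partial b f x)"
  using partial_mult[OF smooth_differentiable[OF smooth_const] smooth_differentiable[OF assms]]
  by auto

lemma smooth_affine:
  assumes "smooth f"
  shows "smooth (\<lambda>x. f ((1/r) *\<^sub>R (x - y)))"
proof -
  \<comment> \<open>The factor \<open>c\<close> is carried through the induction because every
    derivative contributes another \<open>1/r\<close>.\<close>
  have "Ck_on k UNIV (\<lambda>x. c * f ((1/r) *\<^sub>R (x - y)))" if "smooth f" for k c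
    using that
  proof (induction k arbitrary: f c)
    case 0
    have "continuous_on UNIV (f \<circ> (\<lambda>x. (1/r) *\<^sub>R (x - y)))"
      using smooth_continuous[OF 0]
      by (intro continuous_on_compose) (auto intro!: continuous_intros intro: continuous_on_subset)
    then show ?case by (auto simp: o_def intro!: continuous_intros)
  next
    case (Suc k)
    have d: "(\<lambda>x. f ((1/r) *\<^sub>R (x - y))) differentiable (at x)" for x
    proof -
      have "(f \<circ> (\<lambda>x. (1/r) *\<^sub>R (x - y))) differentiable (at x)"
        by (rule differentiable_chain_at)
          (auto intro!: smooth_differentiable[OF Suc.prems] derivative_intros)
      then show ?thesis by (simp add: o_def)
    qed
    have "partial b (\<lambda>x. c * f ((1/r) *\<^sub>R (x - y)))
        = (\<lambda>x. (c * (1/r)) * partial b f ((1/r) *\<^sub>R (x - y)))" for b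
    proof
      fix x
      have "partial b (\<lambda>x. c * f ((1/r) *\<^sub>R (x - y))) x
          = c * partial b (\<lambda>x. f ((1/r) *\<^sub>R (x - y))) x"
        using partial_mult[OF differentiable_const d, of b c] by simp
      then show "partial b (\<lambda>x. c * f ((1/r) *\<^sub>R (x - y))) x
         = (c * (1/r)) * partial b f ((1/r) *\<^sub>R (x - y))"
        by (simp add: partial_affine smooth_differentiable[OF Suc.prems])
    qed
    then have "Ck_on k UNIV (partial b (\<lambda>x. c * f ((1/r) *\<^sub>R (x - y))))" if "b \<in> Basis" for b
      using Suc.IH[OF smooth_partial[OF Suc.prems that], of "c * (1/r)"] by metis
    moreover have "(\<lambda>x. c * f ((1/r) *\<^sub>R (x - y))) differentiable (at x)" for x
      by (intro differentiable_mult d differentiable_const)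
    ultimately show ?case by simp
  qed
  from this[of _ 1] show ?thesis using assms by (simp add: smooth_def)
qed

text \<open>Supplying the whole sequence \<open>h\<close> of derivatives makes the induction close:
  a partial derivative of a smooth multiple of \<open>h m (q x)\<close> is a sum of smooth multiples
  of \<open>h m (q x)\<close> and \<open>h (Suc m) (q x)\<close>.\<close>

lemma smooth_compose_real:
  fixes q :: "'a::euclidean_space \<Rightarrow> real"
  assumes h: "\<And>m t. (h m has_real_derivative h (Suc m) t) (at t)" and q: "smooth q"
  shows "smooth (\<lambda>x. h m (q x))"
proof -
  have d: "((\<lambda>x. h m (q x)) has_derivative (\<lambda>v. frechet_derivative q (at x) v * h (Suc m) (q x))) (at x)"
    for m x
    using smooth_differentiable[OF q, of x] unfolding frechet_derivative_works
    by (rule DERIV_compose_FDERIV[OF h])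
  have p: "partial b (\<lambda>x. h m (q x)) = (\<lambda>x. partial b q x * h (Suc m) (q x))" for b m
    by (rule ext, subst partial_eq[OF d]) (simp add: partial_def)
  have "Ck_on k UNIV (\<lambda>x. g x * h m (q x))" if "smooth g" for k g m
    using that
  proof (induction k arbitrary: g m)
    case 0
    have "continuous_on UNIV (\<lambda>x. h m (q x))"
      using d by (auto intro!: has_derivative_continuous_on)
    then show ?case using smooth_continuous[OF 0] by (auto intro!: continuous_intros)
  next
    case (Suc k)
    have dd: "(\<lambda>x. h m (q x)) differentiable (at x)" for x
      using d by (auto simp: differentiable_def)
    have eq: "partial b (\<lambda>x. g x * h m (q x))
        = (\<lambda>x. (g x * partial b q x) * h (Suc m) (q x) + partial b g x * h m (q x))" for b
      by (rule ext, subst partial_mult)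
        (auto simp: p dd intro: smooth_differentiable[OF Suc.prems])
    have 1: "smooth (\<lambda>x. g x * partial b q x)" "smooth (partial b g)" if "b \<in> Basis" for b
      using Suc.prems q that by (auto intro!: smooth_mult intro: smooth_partial)
    have "Ck_on k UNIV (partial b (\<lambda>x. g x * h m (q x)))" if "b \<in> Basis" for b
      unfolding eq by (intro Ck_on_add Suc.IH 1 that)
    moreover have "(\<lambda>x. g x * h m (q x)) differentiable (at x)" for x
      by (intro differentiable_mult dd smooth_differentiable[OF Suc.prems])
    ultimately show ?case by simp
  qed
  from this[OF smooth_const[of 1]] show ?thesis by (simp add: smooth_def)
qed

section \<open>Bump functions\<close>

text \<open>The function is exp(-1/t) for positive t, extended by zero. Its m-th derivative is a
  polynomial in 1/t times exp(-1/t), and the exponential wins at 0.\<close>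

lemma exists_flat_real_function:
  "\<exists>h :: nat \<Rightarrow> real \<Rightarrow> real. (\<forall>m t. (h m has_real_derivative h (Suc m) t) (at t)) \<and>
     (\<forall>t>0. h 0 t > 0) \<and> (\<forall>t\<le>0. h 0 t = 0) \<and> mono (h 0)"
proof -
  \<comment> \<open>With s = 1/t, differentiation in t is -s^2 d/ds, which turns P(s) exp(-s) into
    s^2 (P - P')(s) exp(-s).\<close>
  define P :: "nat \<Rightarrow> real poly" where
    "P = rec_nat 1 (\<lambda>_ p. [:0, 0, 1:] * (p - pderiv p))"
  have P0: "P 0 = 1" and PS: "P (Suc m) = [:0, 0, 1:] * (P m - pderiv (P m))" for m
    by (simp_all add: P_def)
  define h where "h = (\<lambda>m t::real. if t \<le> 0 then 0 else poly (P m) (1/t) * exp (- (1/t)))"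
  have lim: "((\<lambda>s. poly p s * exp (-s)) \<longlongrightarrow> 0) at_top" for p :: "real poly"
  proof -
    have "((\<lambda>s. \<Sum>i\<le>degree p. coeff p i * (s ^ i / exp s)) \<longlongrightarrow> (\<Sum>i\<le>degree p. coeff p i * 0)) at_top"
      by (intro tendsto_sum tendsto_mult tendsto_const tendsto_power_div_exp_0)
    moreover have "(\<Sum>i\<le>degree p. coeff p i * (s ^ i / exp s)) = poly p s * exp (-s)" for s
      by (simp add: poly_altdef sum_distrib_right exp_minus divide_inverse mult.assoc)
    ultimately show ?thesis by simp
  qed
  have "(h m has_real_derivative h (Suc m) t) (at t)" for m t
  proof -
    consider "t < 0" | "t = 0" | "t > 0" by linarith
    then show ?thesis
    proof cases
      case 1
      then have "\<forall>\<^sub>F s in nhds t. s < 0"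
        using eventually_nhds_in_open[of "{..<0}" t] by simp
      then show ?thesis using 1
        by (subst DERIV_cong_ev[OF refl _ refl, where g="\<lambda>t. 0"])
          (auto simp: h_def elim: eventually_mono)
    next
      case 3
      have "((\<lambda>t. poly (P m) (1/t) * exp (- (1/t))) has_real_derivative
          (poly (pderiv (P m)) (1/t) * (- 1 / t^2)) * exp (- (1/t)) + (exp (- (1/t)) * (1/t^2)) * poly (P m) (1/t)) (at t)"
        using 3 by (auto intro!: derivative_eq_intros DERIV_chain2[OF poly_DERIV] simp: power2_eq_square)
      moreover have "(poly (pderiv (P m)) (1/t) * (- 1 / t^2)) * exp (- (1/t)) + (exp (- (1/t)) * (1/t^2)) * poly (P m) (1/t)
          = h (Suc m) t"
        using 3 by (simp add: h_def PS algebra_simps power2_eq_square)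
      moreover have "\<forall>\<^sub>F s in nhds t. s > 0"
        using eventually_nhds_in_open[of "{0<..}" t] 3 by simp
      ultimately show ?thesis
        by (subst DERIV_cong_ev[OF refl _ refl, where g="\<lambda>t. poly (P m) (1/t) * exp (- (1/t))"])
          (auto simp: h_def elim: eventually_mono)
    next
      case 2
      have "((\<lambda>s. (h m s - h m 0) / (s - 0)) \<longlongrightarrow> 0) (at 0)"
      proof (rule filterlim_split_at)
        show "((\<lambda>s. (h m s - h m 0) / (s - 0)) \<longlongrightarrow> 0) (at_left 0)"
          by (rule tendsto_eventually) (auto simp: h_def eventually_at_filter)
        \<comment> \<open>The difference quotient at 0 divides by the argument, that is, multiplies
          by its inverse; \<open>pCons 0\<close> absorbs this factor into the polynomial.\<close>
        have "((\<lambda>s. poly (pCons 0 (P m)) (inverse s) * exp (- inverse s)) \<longlongrightarrow> 0) (at_right 0)"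
          by (rule filterlim_compose[OF lim filterlim_inverse_at_top_right])
        then show "((\<lambda>s. (h m s - h m 0) / (s - 0)) \<longlongrightarrow> 0) (at_right 0)"
          by (rule Lim_transform_eventually)
            (auto simp: h_def eventually_at_filter divide_inverse mult_ac)
      qed
      then show ?thesis using 2 by (simp add: h_def has_field_derivative_iff)
    qed
  qed
  moreover have "mono (h 0)"
    by (auto simp: mono_def h_def P0 frac_le)
  ultimately show ?thesis
    by (intro exI[of _ h]) (auto simp: h_def P0)
qed

lemma smooth_inner: "smooth (\<lambda>x. x \<bullet> y)"
proof -
  have d: "((\<lambda>x. x \<bullet> y) has_derivative (\<lambda>h. h \<bullet> y)) (at x)" for x
    by (auto intro!: derivative_eq_intros)
  have "Ck_on k UNIV (\<lambda>x. x \<bullet> y)" for k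
  proof (cases k)
    case (Suc j)
    have "partial b (\<lambda>x. x \<bullet> y) = (\<lambda>x. b \<bullet> y)" for b
      using partial_eq[OF d] by auto
    then show ?thesis using Suc d smooth_const[of "_ \<bullet> y"]
      by (auto simp: differentiable_def smooth_def)
  qed (auto intro!: continuous_intros)
  then show ?thesis by (simp add: smooth_def)
qed

lemma smooth_norm_square: "smooth (\<lambda>x. (norm x)\<^sup>2)"
proof -
  have "smooth (\<lambda>x. \<Sum>b\<in>Basis. (x \<bullet> b) * (x \<bullet> b))"
    by (intro smooth_sum smooth_mult smooth_inner)
  then show ?thesis by (simp add: power2_norm_eq_inner flip: euclidean_inner)
qed

text \<open>The profile is the flat function of 9/64 - |x|^2, normalised by its value at 5/64 = 9/64
  - (1/4)^2. The radius 3/8 lies below 1/2, so bumps at centres one unit apart are disjoint; the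
  radius 1/4 = 1/8 + 1/8 covers points near the Cantor set, whose points are themselves only near a
  centre.\<close>

lemma exists_bump:
  "\<exists>\<psi> :: 'a::euclidean_space \<Rightarrow> real. smooth \<psi> \<and> (\<forall>x. \<psi> x \<ge> 0) \<and>
     (\<forall>x. norm x \<ge> 3/8 \<longrightarrow> \<psi> x = 0) \<and> (\<forall>x. norm x \<le> 1/4 \<longrightarrow> \<psi> x \<ge> 1)"
proof -
  obtain h :: "nat \<Rightarrow> real \<Rightarrow> real" where h: "\<And>m t. (h m has_real_derivative h (Suc m) t) (at t)"
    "\<And>t. t > 0 \<Longrightarrow> h 0 t > 0" "\<And>t. t \<le> 0 \<Longrightarrow> h 0 t = 0" "mono (h 0)"
    using exists_flat_real_function by auto
  have sm: "smooth (\<lambda>x::'a. h 0 (9/64 + (-1) * (norm x)\<^sup>2))"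
    by (rule smooth_compose_real[of h "\<lambda>x. 9/64 + (-1) * (norm x)\<^sup>2" 0, OF h(1)]) (intro smooth_add smooth_mult smooth_const smooth_norm_square)
  define c where "c = inverse (h 0 (5/64))"
  have c: "c > 0" using h(2)[of "5/64"] by (simp add: c_def)
  define \<psi> where "\<psi> = (\<lambda>x::'a. c * h 0 (9/64 + (-1) * (norm x)\<^sup>2))"
  have "smooth \<psi>" unfolding \<psi>_def by (intro smooth_mult smooth_const sm)
  moreover have "\<psi> x \<ge> 0" for x
    using c h(2)[of "9/64 + (-1) * (norm x)\<^sup>2"] h(3)[of "9/64 + (-1) * (norm x)\<^sup>2"]
    by (cases "9/64 + (-1) * (norm x)\<^sup>2 > 0") (auto simp: \<psi>_def)
  moreover have "\<psi> x = 0" if "norm x \<ge> 3/8" for x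
  proof -
    have "(norm x)\<^sup>2 \<ge> (3/8)\<^sup>2" using that by (intro power_mono) auto
    then show ?thesis by (simp add: \<psi>_def h(3) power2_eq_square)
  qed
  moreover have "\<psi> x \<ge> 1" if "norm x \<le> 1/4" for x
  proof -
    have "(norm x)\<^sup>2 \<le> (1/4)\<^sup>2" using that by (intro power_mono) auto
    then have "h 0 (5/64) \<le> h 0 (9/64 + (-1) * (norm x)\<^sup>2)"
      by (intro monoD[OF h(4)]) (simp add: power2_eq_square)
    then show ?thesis using h(2)[of "5/64"] by (simp add: \<psi>_def c_def field_simps)
  qed
  ultimately show ?thesis by blast
qed

section \<open>Test functions\<close>

lemma bounded_support_bound:
  fixes f :: "'a::euclidean_space \<Rightarrow> real"
  assumes "continuous_on UNIV f" and "\<And>x. norm x > R \<Longrightarrow> f x = 0"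
  obtains K where "K > 0" "\<And>x. \<bar>f x\<bar> \<le> K"
proof -
  have "compact (f ` cball 0 R)"
    by (intro compact_continuous_image continuous_on_subset[OF assms(1)]) auto
  then have "\<exists>K>0. \<forall>y\<in>f ` cball 0 R. norm y \<le> K"
    by (intro iffD1[OF bounded_pos] compact_imp_bounded)
  then obtain K where K: "K > 0" "\<And>y. y \<in> f ` cball 0 R \<Longrightarrow> norm y \<le> K"
    by blast
  have "\<bar>f x\<bar> \<le> K" for x
    using K assms(2)[of x] by (cases "norm x > R") auto
  with K that show thesis by blast
qed

lemma bounded_support_integrable:
  fixes f :: "'a::euclidean_space \<Rightarrow> real"
  assumes "continuous_on UNIV f" and "\<And>x. norm x > R \<Longrightarrow> f x = 0"
  shows "integrable lborel f"
proof -
  obtain K where K: "\<And>x. \<bar>f x\<bar> \<le> K" using bounded_support_bound[OF assms] by blast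
  show ?thesis
  proof (rule integrableI_bounded_set[where A = "cball 0 R" and B = K])
    show "f \<in> borel_measurable lborel"
      using assms(1) by (simp add: borel_measurable_continuous_onI)
    show "emeasure lborel (cball (0::'a) R) < \<infinity>" by (rule emeasure_lborel_cball_finite)
    show "AE x in lborel. x \<in> cball 0 R \<longrightarrow> norm (f x) \<le> K" using K by simp
    show "AE x in lborel. x \<notin> cball 0 R \<longrightarrow> f x = 0" using assms(2) by auto
  qed auto
qed

lemma lborel_integral_translate:
  fixes f :: "'a::euclidean_space \<Rightarrow> real"
  assumes [measurable]: "f \<in> borel_measurable borel"
  shows "(LINT x|lborel. f (c + x)) = (LINT x|lborel. f x)"
proof -
  have "(LINT x|lborel. f x) = (LINT x|distr lborel borel ((+) c). f x)"
    by (simp add: lborel_distr_plus)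
  also have "\<dots> = (LINT x|lborel. f (c + x))"
    by (rule integral_distr) auto
  finally show ?thesis by simp
qed

lemma partial_zero_outside:
  assumes "x \<notin> closure {x. \<phi> x \<noteq> 0}"
  shows "partial b \<phi> x = 0"
proof -
  have "((\<lambda>_. 0) has_derivative (\<lambda>_. 0)) (at x)" by simp
  then have "(\<phi> has_derivative (\<lambda>_. 0)) (at x)"
  proof (rule has_derivative_transform_within_open)
    show "open (- closure {x. \<phi> x \<noteq> 0})" by (rule open_Compl) (rule closed_closure)
    show "x \<in> - closure {x. \<phi> x \<noteq> 0}" using assms by simp
    show "0 = \<phi> y" if "y \<in> - closure {x. \<phi> x \<noteq> 0}" for y
      using that closure_subset[of "{x. \<phi> x \<noteq> 0}"] by auto
  qed
  then show ?thesis by (simp add: partial_eq)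
qed

text \<open>The difference quotients of \<open>f\<close> have integral zero by translation
  invariance, and dominated convergence passes this to the derivative.\<close>

lemma integral_partial_eq_0:
  assumes f: "smooth f" and supp: "\<And>x. norm x > R \<Longrightarrow> f x = 0" and b: "b \<in> Basis"
  shows "(LINT x|lborel. partial b f x) = 0"
proof -
  have psupp: "partial b f x = 0" if "norm x > R" for x
  proof (rule partial_zero_outside)
    have "closure {x. f x \<noteq> 0} \<subseteq> cball 0 R"
      by (rule closure_minimal) (use supp in \<open>force simp: not_less[symmetric]\<close>)+
    with that show "x \<notin> closure {x. f x \<noteq> 0}" by auto
  qed
  have pcont: "continuous_on UNIV (partial b f)"
    by (intro smooth_continuous smooth_partial f b)
  obtain K where K: "K > 0" "\<And>x. \<bar>partial b f x\<bar> \<le> K"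
    using bounded_support_bound[OF pcont psupp] by blast
  have deriv: "((\<lambda>s. f (x + s *\<^sub>R b)) has_real_derivative partial b f (x + s *\<^sub>R b)) (at s)" for x s
  proof -
    define f' where "f' = frechet_derivative f (at (x + s *\<^sub>R b))"
    have f': "(f has_derivative f') (at (x + s *\<^sub>R b))"
      using smooth_differentiable[OF f] by (simp add: f'_def frechet_derivative_works)
    have "((\<lambda>s. x + s *\<^sub>R b) has_derivative (\<lambda>h. h *\<^sub>R b)) (at s)"
      by (auto intro!: derivative_eq_intros)
    from has_derivative_compose[OF this f']
    have "((\<lambda>s. f (x + s *\<^sub>R b)) has_derivative (\<lambda>h. h * f' b)) (at s)"
      using f' by (simp add: has_derivative_bounded_linear linear_simps(5))
    moreover have "(\<lambda>h. h * f' b) = (*) (partial b f (x + s *\<^sub>R b))"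
      by (auto simp: f'_def partial_def)
    ultimately show ?thesis by (simp add: has_field_derivative_def)
  qed
  define t where "t = (\<lambda>n::nat. inverse (real (Suc n)))"
  have t: "t n > 0" "t n \<le> 1" for n by (auto simp: t_def field_simps)
  \<comment> \<open>By the mean value theorem each quotient is the partial derivative at an
    intermediate point, which gives both the pointwise limit and the dominating constant.\<close>
  have "\<exists>z. 0 < z \<and> z < t n \<and> f (x + t n *\<^sub>R b) - f (x + 0 *\<^sub>R b)
      = (t n - 0) * partial b f (x + z *\<^sub>R b)" for x n
    by (rule MVT2[OF t(1)]) (use deriv in blast)
  then obtain z where z: "\<And>n x. 0 < z n x" "\<And>n x. z n x < t n"
    "\<And>n x. f (x + t n *\<^sub>R b) - f x = t n * partial b f (x + z n x *\<^sub>R b)"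
    by simp metis
  define D where "D = (\<lambda>n x. (f (t n *\<^sub>R b + x) - f x) / t n)"
  have D: "D n x = partial b f (x + z n x *\<^sub>R b)" for n x
    using z(3)[of x n] t(1)[of n] by (simp add: D_def add.commute)
  have [measurable]: "f \<in> borel_measurable borel"
    using smooth_continuous[OF f] by (rule borel_measurable_continuous_onI)
  have fint: "integrable lborel f"
    by (rule bounded_support_integrable[OF smooth_continuous[OF f] supp])
  have fint': "integrable lborel (\<lambda>x. f (c + x))" for c
  proof (rule bounded_support_integrable[where R = "R + norm c"])
    show "continuous_on UNIV (\<lambda>x. f (c + x))"
      by (rule continuous_on_compose2[OF smooth_continuous[OF f]]) (auto intro!: continuous_intros)
    show "f (c + x) = 0" if "norm x > R + norm c" for x
      using that norm_triangle_ineq4[of "c + x" c] by (intro supp) simp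
  qed
  have "(\<lambda>n. LINT x|lborel. D n x) \<longlonglongrightarrow> (LINT x|lborel. partial b f x)"
  \<comment> \<open>The radius \<open>R + 1\<close> allows for the shift of at most
    \<open>t n \<le> 1\<close> along \<open>b\<close>.\<close>
  proof (rule integral_dominated_convergence[where w = "\<lambda>x. K * indicator (cball 0 (R + 1)) x"])
    show "partial b f \<in> borel_measurable lborel"
      using pcont by (simp add: borel_measurable_continuous_onI)
    show "D n \<in> borel_measurable lborel" for n by (simp add: D_def)
    show "integrable lborel (\<lambda>x. K * indicator (cball (0::'a) (R + 1)) x)"
      by (intro integrable_mult_right integrable_real_indicator emeasure_lborel_cball_finite) simp
    have "(\<lambda>n. D n x) \<longlonglongrightarrow> partial b f x" for x
    proof -
      have "t \<longlonglongrightarrow> 0" unfolding t_def by (rule LIMSEQ_inverse_real_of_nat)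
      then have "(\<lambda>n. z n x) \<longlonglongrightarrow> 0"
        using tendsto_sandwich[of "\<lambda>_. 0" "\<lambda>n. z n x" sequentially t 0] z(1,2)[of _ x]
        by (simp add: less_imp_le)
      then have "(\<lambda>n. x + z n x *\<^sub>R b) \<longlonglongrightarrow> x + 0 *\<^sub>R b"
        by (intro tendsto_intros)
      then show ?thesis unfolding D
        by (intro continuous_on_tendsto_compose[OF pcont]) auto
    qed
    then show "AE x in lborel. (\<lambda>n. D n x) \<longlonglongrightarrow> partial b f x" by simp
    have "norm (D n x) \<le> K * indicator (cball 0 (R + 1)) x" for n x
    proof (cases "norm x \<le> R + 1")
      case False
      have "norm x \<le> norm (x + z n x *\<^sub>R b) + norm (z n x *\<^sub>R b)"
        by (metis add_diff_cancel norm_triangle_ineq4)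
      moreover have "norm (z n x *\<^sub>R b) \<le> 1"
        using b z(1)[of n x] z(2)[of n x] t(2)[of n] by simp
      ultimately have "D n x = 0" using False unfolding D by (intro psupp) linarith
      then show ?thesis using K by simp
    qed (use K in \<open>simp add: D\<close>)
    then show "AE x in lborel. norm (D n x) \<le> K * indicator (cball 0 (R + 1)) x" for n
      by simp
  qed
  moreover have "(LINT x|lborel. D n x) = 0" for n
    using fint fint' by (simp add: D_def lborel_integral_translate)
  ultimately show ?thesis by (simp add: LIMSEQ_const_iff)
qed

lemma compact_closure_mono: "closure S \<subseteq> T \<Longrightarrow> compact T \<Longrightarrow> compact (closure S)"
  using compact_Int_closed[of T "closure S"] by (simp add: inf.absorb2)

lemma test_functionsD:
  assumes "\<phi> \<in> test_functions \<Omega>"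
  shows "smooth \<phi>" "x \<notin> \<Omega> \<Longrightarrow> \<phi> x = 0" "\<exists>R. \<forall>x. norm x > R \<longrightarrow> \<phi> x = 0"
proof -
  have c: "compact (closure {x. \<phi> x \<noteq> 0})" "closure {x. \<phi> x \<noteq> 0} \<subseteq> \<Omega>"
    using assms by (auto simp: test_functions_def)
  show "smooth \<phi>" using assms by (auto simp: test_functions_def smooth_def)
  show "x \<notin> \<Omega> \<Longrightarrow> \<phi> x = 0" using c(2) closure_subset[of "{x. \<phi> x \<noteq> 0}"] by auto
  obtain R where "\<And>x. x \<in> closure {x. \<phi> x \<noteq> 0} \<Longrightarrow> norm x \<le> R"
    using iffD1[OF bounded_iff compact_imp_bounded[OF c(1)]] by blast
  then show "\<exists>R. \<forall>x. norm x > R \<longrightarrow> \<phi> x = 0"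
    using closure_subset[of "{x. \<phi> x \<noteq> 0}"] by (intro exI[of _ R]) force
qed

lemma test_functions_partial:
  assumes "\<phi> \<in> test_functions \<Omega>" "b \<in> Basis"
  shows "partial b \<phi> \<in> test_functions \<Omega>"
proof -
  have c: "compact (closure {x. \<phi> x \<noteq> 0})" "closure {x. \<phi> x \<noteq> 0} \<subseteq> \<Omega>"
    using assms by (auto simp: test_functions_def)
  have "{x. partial b \<phi> x \<noteq> 0} \<subseteq> closure {x. \<phi> x \<noteq> 0}"
    using partial_zero_outside by blast
  then have sub: "closure {x. partial b \<phi> x \<noteq> 0} \<subseteq> closure {x. \<phi> x \<noteq> 0}"
    by (simp add: closure_minimal)
  moreover have "smooth (partial b \<phi>)" by (intro smooth_partial test_functionsD[OF assms(1)] assms)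
  ultimately show ?thesis using c compact_closure_mono[OF sub c(1)]
    by (auto simp: test_functions_def smooth_def)
qed

lemma test_functionsI:
  assumes "smooth \<phi>" "\<And>x. x \<notin> S \<Longrightarrow> \<phi> x = 0" "compact S" "S \<subseteq> \<Omega>"
  shows "\<phi> \<in> test_functions \<Omega>"
proof -
  have "closure {x. \<phi> x \<noteq> 0} \<subseteq> S"
    using assms by (intro closure_minimal compact_imp_closed) auto
  then show ?thesis using assms compact_closure_mono[OF _ assms(3)]
    by (auto simp: test_functions_def smooth_def)
qed

section \<open>Square integrable functions\<close>

definition square_integrable :: "'a measure \<Rightarrow> ('a \<Rightarrow> 'b::euclidean_space) \<Rightarrow> bool" where
  "square_integrable M f \<longleftrightarrow> f \<in> borel_measurable M \<and> integrable M (\<lambda>x. (norm (f x))\<^sup>2)"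

lemma L2_iff: "f \<in> L2 \<Omega> \<longleftrightarrow> square_integrable (lebesgue_on \<Omega>) f"
  by (simp add: L2_def square_integrable_def)

lemma norm_add_square_le: "(norm (x + y))\<^sup>2 \<le> 2 * (norm x)\<^sup>2 + 2 * (norm (y :: 'b::real_inner))\<^sup>2"
proof -
  have "0 \<le> (norm (x - y))\<^sup>2" by simp
  then show ?thesis
    by (simp add: power2_norm_eq_inner inner_add inner_diff inner_commute)
qed

lemma square_integrable_add:
  assumes "square_integrable M f" "square_integrable M g"
  shows "square_integrable M (\<lambda>x. f x + g x)"
proof -
  have [measurable]: "f \<in> borel_measurable M" "g \<in> borel_measurable M"
    using assms by (auto simp: square_integrable_def)
  have "integrable M (\<lambda>x. 2 * (norm (f x))\<^sup>2 + 2 * (norm (g x))\<^sup>2)"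
    using assms by (auto simp: square_integrable_def)
  then have "integrable M (\<lambda>x. (norm (f x + g x))\<^sup>2)"
    by (rule Bochner_Integration.integrable_bound)
      (measurable, auto intro!: AE_I2 order_trans[OF norm_add_square_le])
  then show ?thesis by (simp add: square_integrable_def)
qed

lemma square_integrable_scaleR:
  assumes "square_integrable M f"
  shows "square_integrable M (\<lambda>x. c *\<^sub>R f x)"
  using assms by (auto simp: square_integrable_def power_mult_distrib)

lemma square_integrable_diff:
  assumes "square_integrable M f" "square_integrable M g"
  shows "square_integrable M (\<lambda>x. f x - g x)"
  using square_integrable_add[OF assms(1) square_integrable_scaleR[OF assms(2), of "-1"]] by simp

lemma square_integrable_inner:
  assumes "square_integrable M f" "square_integrable M g"
  shows "integrable M (\<lambda>x. f x \<bullet> g x)"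
proof -
  have [measurable]: "f \<in> borel_measurable M" "g \<in> borel_measurable M"
    using assms by (auto simp: square_integrable_def)
  have "integrable M (\<lambda>x. (norm (f x))\<^sup>2 + (norm (g x))\<^sup>2)"
    using assms by (auto simp: square_integrable_def)
  moreover have "\<bar>u \<bullet> v\<bar> \<le> (norm u)\<^sup>2 + (norm v)\<^sup>2" for u v :: 'b
  proof -
    have "0 \<le> (norm u - norm v)\<^sup>2" by simp
    then have "2 * (norm u * norm v) \<le> (norm u)\<^sup>2 + (norm v)\<^sup>2" by (simp add: power2_diff)
    moreover have "0 \<le> norm u * norm v" by simp
    ultimately show ?thesis using Cauchy_Schwarz_ineq2[of u v] by linarith
  qed
  ultimately show ?thesis
    by (elim Bochner_Integration.integrable_bound) (simp_all add: AE_I2)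
qed

lemma square_integrable_Cauchy_Schwarz:
  assumes f: "square_integrable M f" and g: "square_integrable M g"
  shows "\<bar>LINT x|M. f x \<bullet> g x\<bar> \<le> sqrt (LINT x|M. (norm (f x))\<^sup>2) * sqrt (LINT x|M. (norm (g x))\<^sup>2)"
proof -
  define a where "a = (LINT x|M. (norm (f x))\<^sup>2)"
  define b where "b = (LINT x|M. (norm (g x))\<^sup>2)"
  define c where "c = (LINT x|M. f x \<bullet> g x)"
  have ab: "a \<ge> 0" "b \<ge> 0" by (auto simp: a_def b_def)
  have q: "0 \<le> a - 2 * t * c + t\<^sup>2 * b" for t
  proof -
    have "0 \<le> (LINT x|M. (norm (f x - t *\<^sub>R g x))\<^sup>2)" by simp
    also have "\<dots> = (LINT x|M. (norm (f x))\<^sup>2 - 2 * t * (f x \<bullet> g x) + t\<^sup>2 * (norm (g x))\<^sup>2)"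
      by (simp add: power2_norm_eq_inner inner_diff inner_commute)
        (simp add: power2_eq_square algebra_simps)
    also have "\<dots> = a - 2 * t * c + t\<^sup>2 * b"
      using f g square_integrable_inner[OF f g]
      by (simp add: a_def b_def c_def square_integrable_def)
    finally show ?thesis .
  qed
  have "c\<^sup>2 \<le> a * b"
  proof (cases "b = 0")
    case True
    have "c = 0"
    proof (rule ccontr)
      assume "c \<noteq> 0"
      \<comment> \<open>For \<open>b = 0\<close> the quadratic is affine in its argument, and this
        argument gives it the value -1.\<close>
      then show False using q[of "(a + 1) / (2 * c)"] True by simp
    qed
    then show ?thesis using True by simp
  next
    case False
    then show ?thesis using q[of "c / b"] ab
      by (simp add: field_simps power2_eq_square)
  qed
  then have "sqrt (c\<^sup>2) \<le> sqrt (a * b)" by (rule real_sqrt_le_mono)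
  then show ?thesis by (simp add: a_def b_def c_def real_sqrt_mult)
qed

text \<open>The tool by which weak identities pass from approximating test functions to their
  limits.\<close>

lemma square_integrable_tendsto_inner:
  assumes f: "\<And>n. square_integrable M (f n)" and l: "square_integrable M l" and h: "square_integrable M h"
    and lim: "(\<lambda>n. LINT x|M. (norm (l x - f n x))\<^sup>2) \<longlonglongrightarrow> 0"
  shows "(\<lambda>n. LINT x|M. f n x \<bullet> h x) \<longlonglongrightarrow> (LINT x|M. l x \<bullet> h x)"
proof -
  have "(\<lambda>n. sqrt (LINT x|M. (norm (l x - f n x))\<^sup>2) * sqrt (LINT x|M. (norm (h x))\<^sup>2)) \<longlonglongrightarrow>
      sqrt 0 * sqrt (LINT x|M. (norm (h x))\<^sup>2)"
    by (intro tendsto_mult tendsto_real_sqrt lim tendsto_const)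
  then have lim0: "(\<lambda>n. sqrt (LINT x|M. (norm (l x - f n x))\<^sup>2) * sqrt (LINT x|M. (norm (h x))\<^sup>2)) \<longlonglongrightarrow> 0"
    by simp
  have "norm (LINT x|M. (l x - f n x) \<bullet> h x)
      \<le> sqrt (LINT x|M. (norm (l x - f n x))\<^sup>2) * sqrt (LINT x|M. (norm (h x))\<^sup>2)" for n
    unfolding real_norm_def
    by (intro square_integrable_Cauchy_Schwarz square_integrable_diff f l h)
  then have "(\<lambda>n. LINT x|M. (l x - f n x) \<bullet> h x) \<longlonglongrightarrow> 0"
    by (intro Lim_null_comparison[OF always_eventually lim0] allI)
  then have "(\<lambda>n. (LINT x|M. l x \<bullet> h x) - (LINT x|M. (l x - f n x) \<bullet> h x))
      \<longlonglongrightarrow> (LINT x|M. l x \<bullet> h x) - 0"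
    by (intro tendsto_diff tendsto_const)
  moreover have "(LINT x|M. (l x - f n x) \<bullet> h x) = (LINT x|M. l x \<bullet> h x) - (LINT x|M. f n x \<bullet> h x)" for n
    by (simp add: inner_diff_left square_integrable_inner f l h)
  ultimately show ?thesis by simp
qed

lemma integral_norm_add_square_le:
  assumes f: "square_integrable M f" and g: "square_integrable M g"
  shows "(LINT x|M. (norm (f x + g x))\<^sup>2) \<le> 2 * (LINT x|M. (norm (f x))\<^sup>2) + 2 * (LINT x|M. (norm (g x))\<^sup>2)"
proof -
  have "(LINT x|M. (norm (f x + g x))\<^sup>2) \<le> (LINT x|M. 2 * (norm (f x))\<^sup>2 + 2 * (norm (g x))\<^sup>2)"
    using square_integrable_add[OF f g] f g
    by (intro integral_mono norm_add_square_le) (auto simp: square_integrable_def)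
  then show ?thesis using f g by (simp add: square_integrable_def)
qed

text \<open>With \<open>w\<^sub>n\<close> a bound of the L2 norm of \<open>f\<^sub>n\<close>, this pointwise inequality replaces
  Minkowski's inequality.\<close>

lemma weighted_sum_square_le:
  fixes a w :: "nat \<Rightarrow> real"
  assumes "\<And>n. w n > 0"
  shows "(\<Sum>n\<in>I. a n)\<^sup>2 \<le> (\<Sum>n\<in>I. w n) * (\<Sum>n\<in>I. (a n)\<^sup>2 / w n)"
proof -
  have s: "sqrt (w n) * sqrt (w n) = w n" "sqrt (w n) > 0" for n using assms[of n] by auto
  have "(\<Sum>n\<in>I. sqrt (w n) * (a n / sqrt (w n)))\<^sup>2
      \<le> (\<Sum>n\<in>I. (sqrt (w n))\<^sup>2) * (\<Sum>n\<in>I. (a n / sqrt (w n))\<^sup>2)"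
    by (rule Cauchy_Schwarz_ineq_sum)
  moreover have "sqrt (w n) * (a n / sqrt (w n)) = a n" for n using s(2)[of n] by simp
  moreover have "(sqrt (w n))\<^sup>2 = w n" "(a n / sqrt (w n))\<^sup>2 = (a n)\<^sup>2 / w n" for n
    using s(1)[of n] by (auto simp: power2_eq_square)
  ultimately show ?thesis by simp
qed

text \<open>The numbers \<open>w n\<close> act both as norm bounds and as Cauchy-Schwarz weights.
  The squared tail from \<open>m\<close> on is at most \<open>W m * H m x\<close> pointwise, and
  \<open>H m\<close> has integral at most \<open>W m\<close>, so the tail has square norm at most
  \<open>(W m)\<^sup>2\<close>. The sum has its proper meaning almost everywhere, where
  \<open>H 0\<close> is finite.\<close>

lemma square_integrable_series:
  fixes f :: "nat \<Rightarrow> 'a \<Rightarrow> 'b::euclidean_space"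
  assumes [measurable]: "\<And>n. f n \<in> borel_measurable M"
    and f: "\<And>n. (\<integral>\<^sup>+x. ennreal ((norm (f n x))\<^sup>2) \<partial>M) \<le> ennreal ((w n)\<^sup>2)"
    and w: "\<And>n. w n > 0" "summable w"
  shows "AE x in M. summable (\<lambda>n. norm (f n x))"
    and "square_integrable M (\<lambda>x. \<Sum>n. f n x)"
    and "(\<lambda>m. LINT x|M. (norm ((\<Sum>n. f n x) - (\<Sum>n<m. f n x)))\<^sup>2) \<longlonglongrightarrow> 0"
proof -
  define W where "W = (\<lambda>m. \<Sum>n. w (n + m))"
  have sw: "summable (\<lambda>n. w (n + m))" for m using w(2) by (simp add: summable_iff_shift)
  have W_ge: "(\<Sum>n<k. w (n + m)) \<le> W m" for k m
    unfolding W_def by (rule sum_le_suminf[OF sw]) (auto intro: less_imp_le w)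
  have W0: "W m \<ge> 0" for m using W_ge[of m 0] by simp
  \<comment> \<open>Dividing by \<open>w\<close> leaves a series whose integrated terms are at most
    \<open>w\<^sup>2 / w = w\<close>, hence summable.\<close>
  define H where "H = (\<lambda>m x. \<Sum>n. ennreal ((norm (f (n + m) x))\<^sup>2 / w (n + m)))"
  have [measurable]: "H m \<in> borel_measurable M" for m by (simp add: H_def)
  have intH: "(\<integral>\<^sup>+x. H m x \<partial>M) \<le> ennreal (W m)" for m
  proof -
    have "(\<integral>\<^sup>+x. H m x \<partial>M) = (\<Sum>n. \<integral>\<^sup>+x. ennreal ((norm (f (n + m) x))\<^sup>2 / w (n + m)) \<partial>M)"
      unfolding H_def by (rule nn_integral_suminf) simp
    also have "\<dots> \<le> (\<Sum>n. ennreal (w (n + m)))"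
    proof (rule suminf_le)
      fix n
      have "(\<integral>\<^sup>+x. ennreal ((norm (f (n + m) x))\<^sup>2 / w (n + m)) \<partial>M)
          = (\<integral>\<^sup>+x. ennreal (inverse (w (n + m))) * ennreal ((norm (f (n + m) x))\<^sup>2) \<partial>M)"
        using w(1)[of "n + m"]
        by (intro nn_integral_cong) (simp add: divide_inverse mult.commute flip: ennreal_mult)
      also have "\<dots> = ennreal (inverse (w (n + m))) * (\<integral>\<^sup>+x. ennreal ((norm (f (n + m) x))\<^sup>2) \<partial>M)"
        by (rule nn_integral_cmult) simp
      also have "\<dots> \<le> ennreal (inverse (w (n + m))) * ennreal ((w (n + m))\<^sup>2)"
        by (intro mult_left_mono f) simp
      also have "\<dots> = ennreal (w (n + m))"
        using w(1)[of "n + m"] by (simp add: power2_eq_square flip: ennreal_mult)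
      finally show "(\<integral>\<^sup>+x. ennreal ((norm (f (n + m) x))\<^sup>2 / w (n + m)) \<partial>M) \<le> ennreal (w (n + m))" .
    qed auto
    also have "\<dots> = ennreal (W m)"
      unfolding W_def by (rule suminf_ennreal2) (auto intro: less_imp_le w sw)
    finally show ?thesis .
  qed
  have key: "summable (\<lambda>n. norm (f n x)) \<and>
      (\<Sum>n. norm (f (n + m) x))\<^sup>2 \<le> W m * enn2real (H m x)" if "H 0 x < \<infinity>" "H m x < \<infinity>" for m x
  proof -
    have bd: "(\<Sum>n<k. norm (f (n + j) x))\<^sup>2 \<le> W j * enn2real (H j x)" if "H j x < \<infinity>" for j k
    proof -
      have "(\<Sum>n<k. norm (f (n + j) x))\<^sup>2
          \<le> (\<Sum>n<k. w (n + j)) * (\<Sum>n<k. (norm (f (n + j) x))\<^sup>2 / w (n + j))"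
        by (rule weighted_sum_square_le) (rule w)
      also have "\<dots> \<le> W j * enn2real (H j x)"
      proof (intro mult_mono W_ge W0 sum_nonneg)
        have "ennreal (\<Sum>n<k. (norm (f (n + j) x))\<^sup>2 / w (n + j))
            = (\<Sum>n<k. ennreal ((norm (f (n + j) x))\<^sup>2 / w (n + j)))"
          by (rule sum_ennreal[symmetric]) (simp add: less_imp_le w)
        also have "\<dots> \<le> H j x"
          unfolding H_def by (rule sum_le_suminf) auto
        finally have "ennreal (\<Sum>n<k. (norm (f (n + j) x))\<^sup>2 / w (n + j)) \<le> ennreal (enn2real (H j x))"
          using that by simp
        then show "(\<Sum>n<k. (norm (f (n + j) x))\<^sup>2 / w (n + j)) \<le> enn2real (H j x)"
          by (subst (asm) ennreal_le_iff) auto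
      qed (auto simp: less_imp_le w)
      finally show ?thesis .
    qed
    have sm: "summable (\<lambda>n. norm (f n x))"
    proof (rule bounded_imp_summable)
      show "(\<Sum>n\<le>k. norm (f n x)) \<le> sqrt (W 0 * enn2real (H 0 x))" for k
        using bd[OF that(1), of "Suc k"] by (simp add: lessThan_Suc_atMost real_le_rsqrt)
    qed simp
    then have "summable (\<lambda>n. norm (f (n + m) x))"
      by (rule summable_ignore_initial_segment)
    then have "(\<lambda>k. (\<Sum>n<k. norm (f (n + m) x))\<^sup>2) \<longlonglongrightarrow> (\<Sum>n. norm (f (n + m) x))\<^sup>2"
      by (intro tendsto_power summable_LIMSEQ)
    then have "(\<Sum>n. norm (f (n + m) x))\<^sup>2 \<le> W m * enn2real (H m x)"
      by (rule LIMSEQ_le_const2) (use bd[OF that(2)] in blast)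
    with sm show ?thesis by blast
  qed
  have fin: "AE x in M. H m x < \<infinity>" for m
  proof -
    have "(\<integral>\<^sup>+x. H m x \<partial>M) \<noteq> \<infinity>" using intH[of m] by (auto simp: top_unique)
    then have "AE x in M. H m x \<noteq> \<infinity>" by (rule nn_integral_noteq_infinite[rotated]) simp
    then show ?thesis by (simp add: less_top)
  qed
  show "AE x in M. summable (\<lambda>n. norm (f n x))"
    using fin[of 0] key by (auto elim!: eventually_mono)
  have [measurable]: "(\<lambda>x. \<Sum>n. f n x) \<in> borel_measurable M"
    by (rule borel_measurable_suminf) simp
  define D where "D = (\<lambda>m x. (norm ((\<Sum>n. f n x) - (\<Sum>n<m. f n x)))\<^sup>2)"
  have [measurable]: "D m \<in> borel_measurable M" for m by (simp add: D_def)
  have nnD: "(\<integral>\<^sup>+x. ennreal (D m x) \<partial>M) \<le> ennreal ((W m)\<^sup>2)" for m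
  proof -
    have "(\<integral>\<^sup>+x. ennreal (D m x) \<partial>M) \<le> (\<integral>\<^sup>+x. ennreal (W m) * H m x \<partial>M)"
    proof (rule nn_integral_mono_AE)
      show "AE x in M. ennreal (D m x) \<le> ennreal (W m) * H m x"
        using fin[of 0] fin[of m]
      proof eventually_elim
        fix x assume H: "H 0 x < \<infinity>" "H m x < \<infinity>"
        have s: "summable (\<lambda>n. norm (f n x))" using key[OF H] by blast
        then have s': "summable (\<lambda>n. norm (f (n + m) x))"
      by (rule summable_ignore_initial_segment)
        have "(\<Sum>n. f n x) - (\<Sum>n<m. f n x) = (\<Sum>n. f (n + m) x)"
          using suminf_minus_initial_segment[OF summable_norm_cancel[OF s], of m] by simp
        then have "D m x \<le> (\<Sum>n. norm (f (n + m) x))\<^sup>2"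
          unfolding D_def by (auto intro!: power_mono summable_norm s')
        also have "\<dots> \<le> W m * enn2real (H m x)" using key[OF H] by blast
        finally have "ennreal (D m x) \<le> ennreal (W m * enn2real (H m x))"
          by (rule ennreal_leI)
        also have "\<dots> = ennreal (W m) * H m x"
          using H W0 by (simp add: ennreal_mult)
        finally show "ennreal (D m x) \<le> ennreal (W m) * H m x" .
      qed
    qed
    also have "\<dots> = ennreal (W m) * (\<integral>\<^sup>+x. H m x \<partial>M)" by (rule nn_integral_cmult) simp
    also have "\<dots> \<le> ennreal (W m) * ennreal (W m)" by (intro mult_left_mono intH) simp
    also have "\<dots> = ennreal ((W m)\<^sup>2)" by (simp add: power2_eq_square ennreal_mult W0)
    finally show ?thesis .
  qed
  have intD: "integrable M (D m)" for m
  proof (rule integrableI_bounded)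
    have "(\<integral>\<^sup>+x. ennreal (norm (D m x)) \<partial>M) = (\<integral>\<^sup>+x. ennreal (D m x) \<partial>M)"
      by (simp add: D_def)
    also have "\<dots> < \<infinity>"
      by (rule order.strict_trans1[OF nnD]) simp
    finally show "(\<integral>\<^sup>+x. ennreal (norm (D m x)) \<partial>M) < \<infinity>" .
  qed simp
  show "square_integrable M (\<lambda>x. \<Sum>n. f n x)"
    using intD[of 0] by (simp add: square_integrable_def D_def)
  have "(LINT x|M. D m x) \<le> (W m)\<^sup>2" for m
  proof -
    have "ennreal (LINT x|M. D m x) = (\<integral>\<^sup>+x. ennreal (D m x) \<partial>M)"
      by (rule nn_integral_eq_integral[OF intD, symmetric]) (simp add: D_def)
    with nnD[of m] have "ennreal (LINT x|M. D m x) \<le> ennreal ((W m)\<^sup>2)" by simp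
    then show ?thesis by (subst (asm) ennreal_le_iff) auto
  qed
  moreover have "W \<longlonglongrightarrow> 0"
    unfolding W_def by (rule suminf_exist_split2[OF w(2)])
  then have "(\<lambda>m. (W m)\<^sup>2) \<longlonglongrightarrow> 0\<^sup>2" by (rule tendsto_power)
  ultimately have "(\<lambda>m. LINT x|M. D m x) \<longlonglongrightarrow> 0"
    using tendsto_sandwich[of "\<lambda>_. 0" "\<lambda>m. LINT x|M. D m x" sequentially "\<lambda>m. (W m)\<^sup>2" 0]
    by (simp add: D_def)
  then show "(\<lambda>m. LINT x|M. (norm ((\<Sum>n. f n x) - (\<Sum>n<m. f n x)))\<^sup>2) \<longlonglongrightarrow> 0"
    by (simp add: D_def)
qed

section \<open>Weak gradients and weak solutions\<close>

text \<open>The product of \<open>f\<close> and \<open>\<phi>\<close> has compact support, so its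
  derivative integrates to zero. In the Poincare inequality \<open>f\<close> will be a coordinate
  function.\<close>

lemma integration_by_parts:
  assumes f: "smooth f" and \<phi>: "\<phi> \<in> test_functions \<Omega>" and b: "b \<in> Basis"
  shows "(LINT x|lborel. f x * partial b \<phi> x) = - (LINT x|lborel. partial b f x * \<phi> x)"
    and "integrable lborel (\<lambda>x. f x * partial b \<phi> x)"
    and "integrable lborel (\<lambda>x. partial b f x * \<phi> x)"
proof -
  note sm = test_functionsD(1)[OF \<phi>]
  obtain R1 where R1: "\<And>x. norm x > R1 \<Longrightarrow> \<phi> x = 0"
    using test_functionsD(3)[OF \<phi>] by blast
  obtain R2 where R2: "\<And>x. norm x > R2 \<Longrightarrow> partial b \<phi> x = 0"
    using test_functionsD(3)[OF test_functions_partial[OF \<phi> b]] by blast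
  have smp: "smooth (partial b f)" "smooth (partial b \<phi>)"
    by (intro smooth_partial f sm b)+
  show i1: "integrable lborel (\<lambda>x. f x * partial b \<phi> x)"
    by (rule bounded_support_integrable[where R = R2])
      (auto intro!: smooth_continuous smooth_mult f smp R2)
  show i2: "integrable lborel (\<lambda>x. partial b f x * \<phi> x)"
    by (rule bounded_support_integrable[where R = R1])
      (auto intro!: smooth_continuous smooth_mult sm smp R1)
  have "(LINT x|lborel. partial b (\<lambda>x. f x * \<phi> x) x) = 0"
    by (rule integral_partial_eq_0[where R = R1]) (auto intro: smooth_mult f sm b R1)
  moreover have "partial b (\<lambda>x. f x * \<phi> x) x = f x * partial b \<phi> x + partial b f x * \<phi> x" for x
    by (intro partial_mult smooth_differentiable f sm)
  ultimately show "(LINT x|lborel. f x * partial b \<phi> x) = - (LINT x|lborel. partial b f x * \<phi> x)"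
    using i1 i2 by simp
qed

lemma borel_measurable_lebesgue_on:
  fixes f :: "'a::euclidean_space \<Rightarrow> 'b::topological_space"
  shows "f \<in> borel_measurable borel \<Longrightarrow> f \<in> borel_measurable (lebesgue_on \<Omega>)"
  by (simp add: borel_measurable_if_I measurable_completion measurable_restrict_space1)

lemma lebesgue_on_integral_eq:
  fixes f :: "'a::euclidean_space \<Rightarrow> real"
  assumes "open \<Omega>" "f \<in> borel_measurable borel" "\<And>x. x \<notin> \<Omega> \<Longrightarrow> f x = 0"
  shows "(LINT x|lebesgue_on \<Omega>. f x) = (LINT x|lborel. f x)"
    and "integrable (lebesgue_on \<Omega>) f \<longleftrightarrow> integrable lborel f"
proof -
  have eq: "(\<lambda>x. indicator \<Omega> x *\<^sub>R f x) = f"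
  proof
    show "indicator \<Omega> x *\<^sub>R f x = f x" for x
      using assms(3)[of x] by (cases "x \<in> \<Omega>") auto
  qed
  have s: "\<Omega> \<inter> space lebesgue \<in> sets lebesgue"
    using assms(1) by auto
  show "(LINT x|lebesgue_on \<Omega>. f x) = (LINT x|lborel. f x)"
    using integral_restrict_space[OF s, of f, unfolded eq] assms(2) by (simp add: integral_completion)
  show "integrable (lebesgue_on \<Omega>) f \<longleftrightarrow> integrable lborel f"
    using integrable_restrict_space[OF s, of f, unfolded eq] assms(2) by (simp add: integrable_completion)
qed

lemma inner_grad: "b \<in> Basis \<Longrightarrow> grad f x \<bullet> b = partial b f x"
  by (simp add: grad_def)

lemma norm_grad_square: "(norm (grad f x))\<^sup>2 = (\<Sum>b\<in>Basis. (partial b f x)\<^sup>2)"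
  unfolding power2_norm_eq_inner
  by (subst euclidean_inner) (simp add: inner_grad power2_eq_square)

lemma test_functions_borel: "\<phi> \<in> test_functions \<Omega> \<Longrightarrow> \<phi> \<in> borel_measurable borel"
  by (intro borel_measurable_continuous_onI smooth_continuous test_functionsD)

lemma grad_borel: "\<phi> \<in> test_functions \<Omega> \<Longrightarrow> grad \<phi> \<in> borel_measurable borel"
  unfolding grad_def[abs_def]
  by (intro borel_measurable_sum borel_measurable_scaleR borel_measurable_const)
    (rule test_functions_borel[OF test_functions_partial])

lemma test_functions_square_integrable_lborel:
  assumes \<phi>: "\<phi> \<in> test_functions \<Omega>"
  shows "integrable lborel (\<lambda>x. (\<phi> x)\<^sup>2)"
proof -
  obtain R where R: "\<And>x. norm x > R \<Longrightarrow> \<phi> x = 0"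
    using test_functionsD(3)[OF \<phi>] by blast
  show ?thesis
    by (rule bounded_support_integrable[where R = R])
      (simp_all add: continuous_on_power smooth_continuous test_functionsD(1)[OF \<phi>] R)
qed

lemma norm_grad_square_integrable:
  assumes \<phi>: "\<phi> \<in> test_functions \<Omega>"
  shows "integrable lborel (\<lambda>x. (norm (grad \<phi> x))\<^sup>2)"
  unfolding norm_grad_square
  by (intro Bochner_Integration.integrable_sum)
    (rule test_functions_square_integrable_lborel[OF test_functions_partial[OF \<phi>]])

lemma grad_zero_outside: "\<phi> \<in> test_functions \<Omega> \<Longrightarrow> x \<notin> \<Omega> \<Longrightarrow> grad \<phi> x = 0"
  unfolding grad_def by (rule sum.neutral) (simp add: test_functionsD(2)[OF test_functions_partial])

lemma H1_gradient_test_function: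
  assumes \<Omega>: "open \<Omega>" and \<phi>: "\<phi> \<in> test_functions \<Omega>"
  shows "H1_gradient \<Omega> \<phi> (grad \<phi>)"
  unfolding H1_gradient_def
proof (intro conjI ballI)
  show "\<phi> \<in> L2 \<Omega>"
    using test_functions_square_integrable_lborel[OF \<phi>] test_functions_borel[OF \<phi>]
      lebesgue_on_integral_eq(2)[OF \<Omega>, of "\<lambda>x. (\<phi> x)\<^sup>2"] test_functionsD(2)[OF \<phi>]
    by (simp add: L2_def borel_measurable_lebesgue_on)
  show "grad \<phi> \<in> L2 \<Omega>"
    using norm_grad_square_integrable[OF \<phi>] grad_borel[OF \<phi>]
      lebesgue_on_integral_eq(2)[OF \<Omega>, of "\<lambda>x. (norm (grad \<phi> x))\<^sup>2"] grad_zero_outside[OF \<phi>]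
    by (simp add: L2_def borel_measurable_lebesgue_on)
  fix \<psi> and b :: 'a assume \<psi>: "\<psi> \<in> test_functions \<Omega>" and b: "b \<in> Basis"
  note m = test_functions_borel[OF \<phi>] test_functions_borel[OF \<psi>]
    test_functions_borel[OF test_functions_partial[OF \<phi> b]]
    test_functions_borel[OF test_functions_partial[OF \<psi> b]]
  have "(LINT x|lebesgue_on \<Omega>. \<phi> x * partial b \<psi> x) = (LINT x|lborel. \<phi> x * partial b \<psi> x)"
    using m test_functionsD(2)[OF \<phi>] by (intro lebesgue_on_integral_eq(1) \<Omega>) auto
  also have "\<dots> = - (LINT x|lborel. partial b \<phi> x * \<psi> x)"
    by (rule integration_by_parts[OF test_functionsD(1)[OF \<phi>] \<psi> b])
  also have "(LINT x|lborel. partial b \<phi> x * \<psi> x) = (LINT x|lebesgue_on \<Omega>. partial b \<phi> x * \<psi> x)"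
    using m test_functionsD(2)[OF \<psi>] by (intro lebesgue_on_integral_eq(1)[symmetric] \<Omega>) auto
  finally show "(LINT x|lebesgue_on \<Omega>. \<phi> x * partial b \<psi> x)
      = - (LINT x|lebesgue_on \<Omega>. grad \<phi> x \<bullet> b * \<psi> x)"
    using b by (simp add: inner_grad)
qed

text \<open>The coordinate along \<open>b\<close> has derivative 1 and is bounded by
  \<open>R\<close> on \<Omega>. Integrating \<open>(\<phi> x)\<^sup>2\<close> by parts against it
  leaves a mixed term in \<phi> and its derivative; half of the integral of the square is then
  absorbed on the left.\<close>

lemma Poincare_inequality:
  fixes \<phi> :: "'a::euclidean_space \<Rightarrow> real"
  assumes \<Omega>: "open \<Omega>" "\<Omega> \<subseteq> ball 0 R" and \<phi>: "\<phi> \<in> test_functions \<Omega>"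
  shows "(LINT x|lebesgue_on \<Omega>. (\<phi> x)\<^sup>2) \<le> 4 * R\<^sup>2 * (LINT x|lebesgue_on \<Omega>. (norm (grad \<phi> x))\<^sup>2)"
proof -
  let ?M = "lebesgue_on \<Omega>"
  obtain b :: 'a where b: "b \<in> Basis" using nonempty_Basis by blast
  have sm: "smooth \<phi>" by (rule test_functionsD[OF \<phi>])
  have "compact (closure {x. \<phi> x \<noteq> 0})" "closure {x. \<phi> x \<noteq> 0} \<subseteq> \<Omega>"
    using \<phi> by (auto simp: test_functions_def)
  then have \<phi>2: "(\<lambda>x. \<phi> x * \<phi> x) \<in> test_functions \<Omega>"
    by (intro test_functionsI[of _ "closure {x. \<phi> x \<noteq> 0}"] smooth_mult sm)
      (use closure_subset[of "{x. \<phi> x \<noteq> 0}"] in auto)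
  have p2: "partial b (\<lambda>x. \<phi> x * \<phi> x) x = 2 * (\<phi> x * partial b \<phi> x)" for x
    by (subst partial_mult) (auto intro: smooth_differentiable sm)
  have px: "partial b (\<lambda>x. x \<bullet> b) x = 1" for x
    using partial_eq[of "\<lambda>x. x \<bullet> b" "\<lambda>h. h \<bullet> b" x b] b
    by (simp add: has_derivative_inner_left inner_Basis)
  note ibp = integration_by_parts[OF smooth_inner[of b] \<phi>2 b, unfolded p2 px]
  have i: "integrable lborel (\<lambda>x. (\<phi> x)\<^sup>2)" "integrable lborel (\<lambda>x. (norm (grad \<phi> x))\<^sup>2)"
    by (intro test_functions_square_integrable_lborel[OF \<phi>] norm_grad_square_integrable[OF \<phi>])+
  have "(LINT x|lborel. (\<phi> x)\<^sup>2) = (LINT x|lborel. - ((x \<bullet> b) * (2 * (\<phi> x * partial b \<phi> x))))"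
    using ibp(1) by (simp add: power2_eq_square)
  also have "\<dots> \<le> (LINT x|lborel. (1/2) * (\<phi> x)\<^sup>2 + 2 * R\<^sup>2 * (norm (grad \<phi> x))\<^sup>2)"
  proof (rule integral_mono)
    show "integrable lborel (\<lambda>x. - ((x \<bullet> b) * (2 * (\<phi> x * partial b \<phi> x))))"
      using ibp(2) by simp
    show "integrable lborel (\<lambda>x. (1/2) * (\<phi> x)\<^sup>2 + 2 * R\<^sup>2 * (norm (grad \<phi> x))\<^sup>2)"
      using i by simp
    fix x
    show "- ((x \<bullet> b) * (2 * (\<phi> x * partial b \<phi> x))) \<le> (1/2) * (\<phi> x)\<^sup>2 + 2 * R\<^sup>2 * (norm (grad \<phi> x))\<^sup>2"
    proof (cases "x \<in> \<Omega>")
      case True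
      have "\<bar>x \<bullet> b\<bar> \<le> R"
        using Basis_le_norm[OF b, of x] True \<Omega>(2) by auto
      then have "(x \<bullet> b)\<^sup>2 \<le> R\<^sup>2" by (metis abs_le_square_iff abs_of_nonneg order_trans abs_ge_zero)
      moreover have "(partial b \<phi> x)\<^sup>2 \<le> (norm (grad \<phi> x))\<^sup>2"
        unfolding norm_grad_square using b by (intro member_le_sum) auto
      ultimately have "(x \<bullet> b)\<^sup>2 * (partial b \<phi> x)\<^sup>2 \<le> R\<^sup>2 * (norm (grad \<phi> x))\<^sup>2"
        by (intro mult_mono) auto
      \<comment> \<open>Twice this square is the Young inequality whose coefficient 1/2 permits the
        absorption.\<close>
      moreover have "0 \<le> (\<phi> x / 2 + (x \<bullet> b) * partial b \<phi> x)\<^sup>2" by simp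
      ultimately show ?thesis
        by (simp add: power2_eq_square algebra_simps)
    next
      case False
      then show ?thesis using test_functionsD(2)[OF \<phi>] by simp
    qed
  qed
  also have "\<dots> = (1/2) * (LINT x|lborel. (\<phi> x)\<^sup>2) + 2 * R\<^sup>2 * (LINT x|lborel. (norm (grad \<phi> x))\<^sup>2)"
    using i by simp
  finally have "(LINT x|lborel. (\<phi> x)\<^sup>2) \<le> 4 * R\<^sup>2 * (LINT x|lborel. (norm (grad \<phi> x))\<^sup>2)" by simp
  moreover have "(LINT x|?M. (\<phi> x)\<^sup>2) = (LINT x|lborel. (\<phi> x)\<^sup>2)"
    using test_functions_borel[OF \<phi>] test_functionsD(2)[OF \<phi>]
    by (intro lebesgue_on_integral_eq(1) \<Omega>) auto
  moreover have "(LINT x|?M. (norm (grad \<phi> x))\<^sup>2) = (LINT x|lborel. (norm (grad \<phi> x))\<^sup>2)"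
    using grad_borel[OF \<phi>] grad_zero_outside[OF \<phi>]
    by (intro lebesgue_on_integral_eq(1) \<Omega>) auto
  ultimately show ?thesis by simp
qed

lemma zero_outside_support: "x \<notin> closure {x. f x \<noteq> 0} \<Longrightarrow> f x = 0"
  using closure_subset[of "{x. f x \<noteq> 0}"] by auto

lemma test_functions_diff:
  assumes "\<phi> \<in> test_functions \<Omega>" "\<psi> \<in> test_functions \<Omega>"
  shows "(\<lambda>x. \<phi> x - \<psi> x) \<in> test_functions \<Omega>"
proof -
  let ?S = "closure {x. \<phi> x \<noteq> 0} \<union> closure {x. \<psi> x \<noteq> 0}"
  have c: "compact ?S" "?S \<subseteq> \<Omega>"
    using assms by (auto simp: test_functions_def)
  have "smooth (\<lambda>x. \<phi> x + (-1) * \<psi> x)"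
    by (intro smooth_add smooth_mult smooth_const test_functionsD(1)[OF assms(1)] test_functionsD(1)[OF assms(2)])
  then have "smooth (\<lambda>x. \<phi> x - \<psi> x)" by simp
  moreover have "\<phi> x - \<psi> x = 0" if "x \<notin> ?S" for x
    using that zero_outside_support[of x \<phi>] zero_outside_support[of x \<psi>] by auto
  ultimately show ?thesis using c by (intro test_functionsI[of _ ?S])
qed

lemma test_functions_sum:
  fixes \<phi> :: "nat \<Rightarrow> 'a::euclidean_space \<Rightarrow> real"
  assumes "\<And>n. \<phi> n \<in> test_functions \<Omega>"
  shows "(\<lambda>x. \<Sum>n<m. \<phi> n x) \<in> test_functions \<Omega>"
proof -
  let ?S = "\<Union>n<m. closure {x. \<phi> n x \<noteq> 0}"
  have c: "compact (closure {x. \<phi> n x \<noteq> 0})" "closure {x. \<phi> n x \<noteq> 0} \<subseteq> \<Omega>" for n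
    using assms[of n] by (auto simp: test_functions_def)
  have "compact ?S" by (intro compact_UN c) auto
  moreover have "?S \<subseteq> \<Omega>" using c(2) by auto
  moreover have "smooth (\<lambda>x. \<Sum>n<m. \<phi> n x)" by (intro smooth_sum test_functionsD(1)[OF assms])
  moreover have "(\<Sum>n<m. \<phi> n x) = 0" if "x \<notin> ?S" for x
  proof (rule sum.neutral, rule ballI)
    fix n assume "n \<in> {..<m}"
    with that have "x \<notin> closure {x. \<phi> n x \<noteq> 0}" by auto
    then show "\<phi> n x = 0" by (rule zero_outside_support)
  qed
  ultimately show ?thesis by (intro test_functionsI[of _ ?S])
qed

lemma grad_diff:
  assumes "smooth f" "smooth g"
  shows "grad (\<lambda>x. f x - g x) x = grad f x - grad g x"
proof -
  have "partial b (\<lambda>x. f x - g x) x = partial b f x - partial b g x" for b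
  proof -
    have "((\<lambda>x. f x - g x) has_derivative
        (\<lambda>h. frechet_derivative f (at x) h - frechet_derivative g (at x) h)) (at x)"
      using smooth_differentiable[OF assms(1), of x] smooth_differentiable[OF assms(2), of x]
      unfolding frechet_derivative_works by (rule has_derivative_diff)
    then show ?thesis by (simp add: partial_eq) (simp add: partial_def)
  qed
  then show ?thesis
    by (simp add: grad_def sum_subtractf scaleR_left_diff_distrib)
qed

lemma grad_inner: "grad f x \<bullet> y = (\<Sum>b\<in>Basis. (y \<bullet> b) * partial b f x)"
  unfolding grad_def inner_sum_left by (simp add: inner_commute mult.commute)

lemma grad_sum:
  fixes \<phi> :: "nat \<Rightarrow> 'a::euclidean_space \<Rightarrow> real"
  assumes "\<And>n. smooth (\<phi> n)"
  shows "grad (\<lambda>x. \<Sum>n<m. \<phi> n x) = (\<lambda>x. \<Sum>n<m. grad (\<phi> n) x)"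
proof
  fix x
  show "grad (\<lambda>x. \<Sum>n<m. \<phi> n x) x = (\<Sum>n<m. grad (\<phi> n) x)"
    unfolding grad_def partial_sum[OF assms]
    by (simp add: scaleR_sum_left) (rule sum.swap)
qed

lemma H1_gradientD:
  assumes "H1_gradient \<Omega> u g"
  shows "square_integrable (lebesgue_on \<Omega>) u" "square_integrable (lebesgue_on \<Omega>) g"
    "\<phi> \<in> test_functions \<Omega> \<Longrightarrow> b \<in> Basis \<Longrightarrow>
       (LINT x|lebesgue_on \<Omega>. u x * partial b \<phi> x) = - (LINT x|lebesgue_on \<Omega>. (g x \<bullet> b) * \<phi> x)"
  using assms by (auto simp: H1_gradient_def L2_iff)

lemma test_functions_square_integrable:
  "open \<Omega> \<Longrightarrow> \<phi> \<in> test_functions \<Omega> \<Longrightarrow> square_integrable (lebesgue_on \<Omega>) \<phi>"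
  "open \<Omega> \<Longrightarrow> \<phi> \<in> test_functions \<Omega> \<Longrightarrow> square_integrable (lebesgue_on \<Omega>) (grad \<phi>)"
  using H1_gradientD H1_gradient_test_function by blast+

lemma square_integrable_scaleR_const:
  "square_integrable M (f :: _ \<Rightarrow> real) \<Longrightarrow> square_integrable M (\<lambda>x. f x *\<^sub>R c)"
  by (auto simp: square_integrable_def power_mult_distrib)

lemma square_integrable_mult:
  "square_integrable M f \<Longrightarrow> square_integrable M g \<Longrightarrow> integrable M (\<lambda>x. f x * g x :: real)"
  using square_integrable_inner[of M f g] by (simp add: mult.commute)

lemma H1_gradient_diff:
  assumes \<Omega>: "open \<Omega>" and u: "H1_gradient \<Omega> u g" and v: "H1_gradient \<Omega> v h"
  shows "H1_gradient \<Omega> (\<lambda>x. u x - v x) (\<lambda>x. g x - h x)"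
  unfolding H1_gradient_def L2_iff
proof (intro conjI ballI)
  show "square_integrable (lebesgue_on \<Omega>) (\<lambda>x. u x - v x)"
    "square_integrable (lebesgue_on \<Omega>) (\<lambda>x. g x - h x)"
    by (intro square_integrable_diff H1_gradientD[OF u] H1_gradientD[OF v])+
  fix \<phi> and b :: 'a assume \<phi>: "\<phi> \<in> test_functions \<Omega>" and b: "b \<in> Basis"
  have s: "square_integrable (lebesgue_on \<Omega>) (partial b \<phi>)"
    "square_integrable (lebesgue_on \<Omega>) (\<lambda>x. \<phi> x *\<^sub>R b)"
    by (intro test_functions_square_integrable \<Omega> test_functions_partial \<phi> b square_integrable_scaleR_const)+
  have i: "integrable (lebesgue_on \<Omega>) (\<lambda>x. (k x \<bullet> b) * \<phi> x)" if "H1_gradient \<Omega> z k" for z k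
    using square_integrable_inner[OF H1_gradientD(2)[OF that] s(2)] by (simp add: mult.commute)
  have j: "integrable (lebesgue_on \<Omega>) (\<lambda>x. z x * partial b \<phi> x)" if "H1_gradient \<Omega> z k" for z k
    by (rule square_integrable_mult[OF H1_gradientD(1)[OF that] s(1)])
  show "(LINT x|lebesgue_on \<Omega>. (u x - v x) * partial b \<phi> x)
      = - (LINT x|lebesgue_on \<Omega>. (g x - h x) \<bullet> b * \<phi> x)"
    using H1_gradientD(3)[OF u \<phi> b] H1_gradientD(3)[OF v \<phi> b] i[OF u] i[OF v] j[OF u] j[OF v]
    by (simp add: left_diff_distrib inner_diff_left)
qed

section \<open>Uniqueness of weak solutions\<close>

lemma H10D:
  assumes \<Omega>: "open \<Omega>" and "u \<in> H10 \<Omega>"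
  obtains g \<phi> where "H1_gradient \<Omega> u g" "\<And>n. \<phi> n \<in> test_functions \<Omega>"
    "(\<lambda>n. LINT x|lebesgue_on \<Omega>. (norm (u x - \<phi> n x))\<^sup>2) \<longlonglongrightarrow> 0"
    "(\<lambda>n. LINT x|lebesgue_on \<Omega>. (norm (g x - grad (\<phi> n) x))\<^sup>2) \<longlonglongrightarrow> 0"
proof -
  let ?M = "lebesgue_on \<Omega>"
  obtain g \<phi> where g: "H1_gradient \<Omega> u g" "\<And>n. \<phi> n \<in> test_functions \<Omega>" and
    lim: "(\<lambda>n. (LINT x|?M. (u x - \<phi> n x)\<^sup>2) +
                (LINT x|?M. (norm (g x - grad (\<phi> n) x))\<^sup>2)) \<longlonglongrightarrow> 0"
    using assms(2) unfolding H10_def by blast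
  have l1: "(\<lambda>n. LINT x|?M. (norm (u x - \<phi> n x))\<^sup>2) \<longlonglongrightarrow> 0"
    by (rule Lim_null_comparison[OF always_eventually lim]) simp
  have l2: "(\<lambda>n. LINT x|?M. (norm (g x - grad (\<phi> n) x))\<^sup>2) \<longlonglongrightarrow> 0"
    by (rule Lim_null_comparison[OF always_eventually lim]) simp
  show thesis by (rule that[OF g l1 l2])
qed

lemma tendsto_L2_diff:
  assumes "\<And>n. square_integrable M (\<lambda>x. u x - f n x)" "\<And>n. square_integrable M (\<lambda>x. v x - g n x)"
    and "(\<lambda>n. LINT x|M. (norm (u x - f n x))\<^sup>2) \<longlonglongrightarrow> 0"
    and "(\<lambda>n. LINT x|M. (norm (v x - g n x))\<^sup>2) \<longlonglongrightarrow> 0"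
  shows "(\<lambda>n. LINT x|M. (norm ((u x - v x) - (f n x - g n x)))\<^sup>2) \<longlonglongrightarrow> 0"
proof -
  have lim: "(\<lambda>n. 2 * (LINT x|M. (norm (u x - f n x))\<^sup>2) + 2 * (LINT x|M. (norm (v x - g n x))\<^sup>2))
      \<longlonglongrightarrow> 2 * 0 + 2 * 0"
    by (intro tendsto_intros assms)
  have "norm (LINT x|M. (norm ((u x - v x) - (f n x - g n x)))\<^sup>2)
      \<le> 2 * (LINT x|M. (norm (u x - f n x))\<^sup>2) + 2 * (LINT x|M. (norm (v x - g n x))\<^sup>2)" for n
  proof -
    have eq: "(u x - v x) - (f n x - g n x) = (u x - f n x) + (-1) *\<^sub>R (v x - g n x)" for x by simp
    show ?thesis
      using integral_norm_add_square_le[OF assms(1)[of n] square_integrable_scaleR[OF assms(2)[of n], of "-1"]]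
      by (simp only: eq norm_scaleR abs_neg_one mult_1 real_norm_def abs_of_nonneg[OF Bochner_Integration.integral_nonneg] zero_le_power2)
  qed
  then show ?thesis
    by (intro Lim_null_comparison[OF always_eventually lim[simplified]]) blast
qed

lemma H10_diff:
  assumes \<Omega>: "open \<Omega>" and u: "u \<in> H10 \<Omega>" and v: "v \<in> H10 \<Omega>"
  shows "(\<lambda>x. u x - v x) \<in> H10 \<Omega>"
proof -
  let ?M = "lebesgue_on \<Omega>"
  obtain g \<phi> where g: "H1_gradient \<Omega> u g" and \<phi>: "\<And>n. \<phi> n \<in> test_functions \<Omega>" and
    l: "(\<lambda>n. LINT x|?M. (norm (u x - \<phi> n x))\<^sup>2) \<longlonglongrightarrow> 0"
    "(\<lambda>n. LINT x|?M. (norm (g x - grad (\<phi> n) x))\<^sup>2) \<longlonglongrightarrow> 0"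
    using H10D[OF \<Omega> u] by blast
  obtain h \<psi> where h: "H1_gradient \<Omega> v h" and \<psi>: "\<And>n. \<psi> n \<in> test_functions \<Omega>" and
    k: "(\<lambda>n. LINT x|?M. (norm (v x - \<psi> n x))\<^sup>2) \<longlonglongrightarrow> 0"
    "(\<lambda>n. LINT x|?M. (norm (h x - grad (\<psi> n) x))\<^sup>2) \<longlonglongrightarrow> 0"
    using H10D[OF \<Omega> v] by blast
  note s = square_integrable_diff H1_gradientD[OF g] H1_gradientD[OF h]
    test_functions_square_integrable[OF \<Omega> \<phi>] test_functions_square_integrable[OF \<Omega> \<psi>]
  have "(\<lambda>n. LINT x|?M. (norm ((u x - v x) - (\<phi> n x - \<psi> n x)))\<^sup>2) \<longlonglongrightarrow> 0"
    by (intro tendsto_L2_diff l k s)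
  moreover have "(\<lambda>n. LINT x|?M. (norm ((g x - h x) - (grad (\<phi> n) x - grad (\<psi> n) x)))\<^sup>2) \<longlonglongrightarrow> 0"
    by (intro tendsto_L2_diff l k s)
  ultimately have "(\<lambda>n. (LINT x|?M. (norm ((u x - v x) - (\<phi> n x - \<psi> n x)))\<^sup>2) +
      (LINT x|?M. (norm ((g x - h x) - (grad (\<phi> n) x - grad (\<psi> n) x)))\<^sup>2)) \<longlonglongrightarrow> 0 + 0"
    by (rule tendsto_add)
  moreover have "grad (\<lambda>x. \<phi> n x - \<psi> n x) x = grad (\<phi> n) x - grad (\<psi> n) x" for n x
    by (intro grad_diff test_functionsD(1)[OF \<phi>] test_functionsD(1)[OF \<psi>])
  ultimately show ?thesis
    unfolding H10_def using H1_gradient_diff[OF \<Omega> g h] test_functions_diff[OF \<phi> \<psi>]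
    by (intro CollectI exI[of _ "\<lambda>x. g x - h x"] conjI exI[of _ "\<lambda>n x. \<phi> n x - \<psi> n x"]) simp_all
qed

lemma AE_zero_of_square_integral_zero:
  assumes "square_integrable M f" "(LINT x|M. (norm (f x))\<^sup>2) = 0"
  shows "AE x in M. f x = 0"
  using assms integral_nonneg_eq_0_iff_AE[of M "\<lambda>x. (norm (f x))\<^sup>2"]
  by (auto simp: square_integrable_def)

text \<open>The weak gradient occurring in the definition of \<^const>\<open>H10\<close> need not be \<open>h\<close>, but it is
  orthogonal to all test fields, hence to the approximating gradients and so to itself. This avoids
  the uniqueness of weak gradients.\<close>

lemma H10_gradient_zero:
  assumes \<Omega>: "open \<Omega>" "bounded \<Omega>" and z: "z \<in> H10 \<Omega>"
    and h: "H1_gradient \<Omega> z h" "AE x in lebesgue_on \<Omega>. h x = 0"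
  shows "AE x in lebesgue_on \<Omega>. z x = 0"
proof -
  let ?M = "lebesgue_on \<Omega>"
  obtain g \<phi> where g: "H1_gradient \<Omega> z g" and \<phi>: "\<And>n. \<phi> n \<in> test_functions \<Omega>" and
    l: "(\<lambda>n. LINT x|?M. (norm (z x - \<phi> n x))\<^sup>2) \<longlonglongrightarrow> 0"
    "(\<lambda>n. LINT x|?M. (norm (g x - grad (\<phi> n) x))\<^sup>2) \<longlonglongrightarrow> 0"
    using H10D[OF \<Omega>(1) z] by blast
  note sg = H1_gradientD(2)[OF g] and sz = H1_gradientD(1)[OF g]
  note s\<phi> = test_functions_square_integrable[OF \<Omega>(1) \<phi>]
  have orth: "(LINT x|?M. (g x \<bullet> b) * \<psi> x) = 0" if "\<psi> \<in> test_functions \<Omega>" "b \<in> Basis" for \<psi> b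
  proof -
    have "(LINT x|?M. (h x \<bullet> b) * \<psi> x) = (LINT x|?M. 0)"
    proof (rule integral_cong_AE)
      have [measurable]: "h \<in> borel_measurable ?M" "\<psi> \<in> borel_measurable ?M"
        using H1_gradientD(2)[OF h(1)] test_functions_square_integrable(1)[OF \<Omega>(1) that(1)]
        by (auto simp: square_integrable_def)
      show "(\<lambda>x. (h x \<bullet> b) * \<psi> x) \<in> borel_measurable ?M" by measurable
      show "AE x in ?M. (h x \<bullet> b) * \<psi> x = 0"
        using h(2) by eventually_elim simp
    qed simp
    then show ?thesis using H1_gradientD(3)[OF g that] H1_gradientD(3)[OF h(1) that] by simp
  qed
  have "(LINT x|?M. grad (\<phi> n) x \<bullet> g x) = 0" for n
  proof -
    have "integrable ?M (\<lambda>x. (g x \<bullet> b) * partial b (\<phi> n) x)" if "b \<in> Basis" for b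
      using square_integrable_inner[OF sg square_integrable_scaleR_const[OF
            test_functions_square_integrable(1)[OF \<Omega>(1) test_functions_partial[OF \<phi>[of n] that]], where c = b]]
      by (simp add: mult.commute)
    then have "(LINT x|?M. (\<Sum>b\<in>Basis. (g x \<bullet> b) * partial b (\<phi> n) x)) = 0"
      by (subst Bochner_Integration.integral_sum)
        (auto intro!: sum.neutral orth test_functions_partial \<phi>)
    then show ?thesis by (simp add: grad_inner)
  qed
  moreover have "(\<lambda>n. LINT x|?M. grad (\<phi> n) x \<bullet> g x) \<longlonglongrightarrow> (LINT x|?M. g x \<bullet> g x)"
    by (rule square_integrable_tendsto_inner[OF s\<phi>(2) sg sg l(2)])
  ultimately have "(LINT x|?M. (norm (g x))\<^sup>2) = 0"
    by (simp add: LIMSEQ_const_iff power2_norm_eq_inner)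
  then have g0: "AE x in ?M. g x = 0"
    by (rule AE_zero_of_square_integral_zero[OF sg])
  obtain R where R: "\<Omega> \<subseteq> ball 0 R"
    using \<Omega>(2) bounded_subset_ballD by blast
  \<comment> \<open>As \<open>g\<close> vanishes almost everywhere, the approximating gradients tend
    to zero; the Poincare inequality then forces \<open>\<phi> n\<close>, and hence
    \<open>z\<close>, to zero in square norm.\<close>
  have grad_lim: "(\<lambda>n. LINT x|?M. (norm (grad (\<phi> n) x))\<^sup>2) \<longlonglongrightarrow> 0"
  proof -
    have [measurable]: "g \<in> borel_measurable ?M" "grad (\<phi> n) \<in> borel_measurable ?M" for n
      using sg s\<phi>(2) by (auto simp: square_integrable_def)
    have "(LINT x|?M. (norm (g x - grad (\<phi> n) x))\<^sup>2)
        = (LINT x|?M. (norm (grad (\<phi> n) x))\<^sup>2)" for n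
    proof (rule integral_cong_AE)
      show "AE x in ?M. (norm (g x - grad (\<phi> n) x))\<^sup>2 = (norm (grad (\<phi> n) x))\<^sup>2"
        using g0 by eventually_elim simp
    qed measurable
    with l(2) show ?thesis by simp
  qed
  have "(\<lambda>n. LINT x|?M. (norm (\<phi> n x))\<^sup>2) \<longlonglongrightarrow> 0"
  proof (rule Lim_null_comparison[OF always_eventually])
    show "(\<lambda>n. 4 * R\<^sup>2 * (LINT x|?M. (norm (grad (\<phi> n) x))\<^sup>2)) \<longlonglongrightarrow> 0"
      by (rule tendsto_mult_right_zero[OF grad_lim])
    show "\<forall>n. norm (LINT x|?M. (norm (\<phi> n x))\<^sup>2)
        \<le> 4 * R\<^sup>2 * (LINT x|?M. (norm (grad (\<phi> n) x))\<^sup>2)"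
      using Poincare_inequality[OF \<Omega>(1) R \<phi>] by simp
  qed
  then have "(\<lambda>n. 2 * (LINT x|?M. (norm (z x - \<phi> n x))\<^sup>2) + 2 * (LINT x|?M. (norm (\<phi> n x))\<^sup>2))
      \<longlonglongrightarrow> 2 * 0 + 2 * 0"
    by (intro tendsto_intros l)
  moreover have "(LINT x|?M. (norm (z x))\<^sup>2)
      \<le> 2 * (LINT x|?M. (norm (z x - \<phi> n x))\<^sup>2) + 2 * (LINT x|?M. (norm (\<phi> n x))\<^sup>2)" for n
    using integral_norm_add_square_le[OF square_integrable_diff[OF sz s\<phi>(1)[of n]] s\<phi>(1)[of n]] by simp
  ultimately have "(LINT x|?M. (norm (z x))\<^sup>2) \<le> 0"
    using LIMSEQ_le_const[of _ "2 * 0 + 2 * 0 :: real"] by fastforce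
  then have "(LINT x|?M. (norm (z x))\<^sup>2) = 0"
    by (intro antisym) simp_all
  then show ?thesis by (rule AE_zero_of_square_integral_zero[OF sz])
qed

text \<open>Both weak formulations may be tested with \<open>w - u\<close>, and since they hold for
  every weak gradient of the test element, \<open>k - g\<close> is admissible there. Subtracting
  shows that \<open>k - g\<close> has square norm zero.\<close>

lemma weak_solution_unique:
  assumes \<Omega>: "open \<Omega>" "bounded \<Omega>" and u: "weak_solution \<Omega> F u" and w: "weak_solution \<Omega> F w"
  shows "AE x in lebesgue_on \<Omega>. w x = u x"
proof -
  let ?M = "lebesgue_on \<Omega>"
  obtain g where g: "H1_gradient \<Omega> u g" "\<And>v h. v \<in> H10 \<Omega> \<Longrightarrow> H1_gradient \<Omega> v h \<Longrightarrow>
      (LINT x|?M. g x \<bullet> h x) = (LINT x|?M. F x * v x)"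
    using u by (auto simp: weak_solution_def)
  obtain k where k: "H1_gradient \<Omega> w k" "\<And>v h. v \<in> H10 \<Omega> \<Longrightarrow> H1_gradient \<Omega> v h \<Longrightarrow>
      (LINT x|?M. k x \<bullet> h x) = (LINT x|?M. F x * v x)"
    using w by (auto simp: weak_solution_def)
  have z: "(\<lambda>x. w x - u x) \<in> H10 \<Omega>" "H1_gradient \<Omega> (\<lambda>x. w x - u x) (\<lambda>x. k x - g x)"
    using u w by (auto simp: weak_solution_def intro!: H10_diff H1_gradient_diff \<Omega> g k)
  note s = H1_gradientD(2)[OF g(1)] H1_gradientD(2)[OF k(1)] H1_gradientD(2)[OF z(2)]
  have "(LINT x|?M. (norm (k x - g x))\<^sup>2)
      = (LINT x|?M. k x \<bullet> (k x - g x) - g x \<bullet> (k x - g x))"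
    by (simp only: power2_norm_eq_inner inner_diff_left)
  also have "\<dots> = 0"
    using g(2)[OF z] k(2)[OF z] square_integrable_inner[OF s(2,3)] square_integrable_inner[OF s(1,3)]
    by simp
  finally have "AE x in ?M. k x - g x = 0"
    by (rule AE_zero_of_square_integral_zero[OF s(3)])
  from H10_gradient_zero[OF \<Omega> z this] show ?thesis by simp
qed

section \<open>Series of test functions as weak solutions\<close>

definition laplacian :: "('a::euclidean_space \<Rightarrow> real) \<Rightarrow> 'a \<Rightarrow> real" where
  "laplacian f x = (\<Sum>b\<in>Basis. partial b (partial b f) x)"

lemma laplacian_sum:
  fixes \<phi> :: "nat \<Rightarrow> 'a::euclidean_space \<Rightarrow> real"
  assumes "\<And>n. smooth (\<phi> n)"
  shows "laplacian (\<lambda>x. \<Sum>n<m. \<phi> n x) = (\<lambda>x. \<Sum>n<m. laplacian (\<phi> n) x)"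
proof
  fix x
  have "laplacian (\<lambda>x. \<Sum>n<m. \<phi> n x) x = (\<Sum>b\<in>Basis. \<Sum>n<m. partial b (partial b (\<phi> n)) x)"
    unfolding laplacian_def partial_sum[OF assms]
    by (intro sum.cong refl) (simp add: partial_sum smooth_partial assms)
  also have "\<dots> = (\<Sum>n<m. laplacian (\<phi> n) x)"
    unfolding laplacian_def by (rule sum.swap)
  finally show "laplacian (\<lambda>x. \<Sum>n<m. \<phi> n x) x = (\<Sum>n<m. laplacian (\<phi> n) x)" .
qed

lemma laplacian_borel: "\<phi> \<in> test_functions \<Omega> \<Longrightarrow> laplacian \<phi> \<in> borel_measurable borel"
  unfolding laplacian_def[abs_def]
  by (intro borel_measurable_sum) (rule test_functions_borel[OF test_functions_partial[OF test_functions_partial]])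

text \<open>The definition of the weak gradient \<open>h\<close> is applied to the test functions
  \<open>partial b \<phi>\<close>, one for each direction. This is the weak equation for a single
  test function.\<close>

lemma grad_inner_integral:
  assumes \<Omega>: "open \<Omega>" and \<phi>: "\<phi> \<in> test_functions \<Omega>" and h: "H1_gradient \<Omega> v h"
  shows "(LINT x|lebesgue_on \<Omega>. grad \<phi> x \<bullet> h x) = - (LINT x|lebesgue_on \<Omega>. laplacian \<phi> x * v x)"
proof -
  let ?M = "lebesgue_on \<Omega>"
  have i: "integrable ?M (\<lambda>x. (h x \<bullet> b) * partial b \<phi> x)"
    "integrable ?M (\<lambda>x. v x * partial b (partial b \<phi>) x)" if "b \<in> Basis" for b
    using square_integrable_inner[OF H1_gradientD(2)[OF h] square_integrable_scaleR_const[OF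
          test_functions_square_integrable(1)[OF \<Omega> test_functions_partial[OF \<phi> that]], of b]]
      square_integrable_mult[OF H1_gradientD(1)[OF h] test_functions_square_integrable(1)[OF \<Omega>
          test_functions_partial[OF test_functions_partial[OF \<phi> that] that]]]
    by (simp_all add: mult.commute)
  have "(LINT x|?M. grad \<phi> x \<bullet> h x)
      = (LINT x|?M. (\<Sum>b\<in>Basis. (h x \<bullet> b) * partial b \<phi> x))"
    by (simp add: grad_inner)
  also have "\<dots> = (\<Sum>b\<in>Basis. LINT x|?M. (h x \<bullet> b) * partial b \<phi> x)"
    by (rule Bochner_Integration.integral_sum) (rule i)
  also have "\<dots> = (\<Sum>b\<in>Basis. - (LINT x|?M. v x * partial b (partial b \<phi>) x))"
    using H1_gradientD(3)[OF h test_functions_partial[OF \<phi>]] by (intro sum.cong) auto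
  also have "\<dots> = - (LINT x|?M. (\<Sum>b\<in>Basis. v x * partial b (partial b \<phi>) x))"
    by (subst Bochner_Integration.integral_sum) (auto simp: sum_negf i)
  finally show ?thesis by (simp add: laplacian_def sum_distrib_right sum_distrib_left mult.commute)
qed

text \<open>The partial sums are test functions, and they, their gradients and their Laplacians
  converge in square norm. This puts the limit into \<open>H10\<close> directly by its definition,
  and the weak equation of the partial sums passes to the limit.\<close>

lemma weak_solution_series:
  fixes \<phi> :: "nat \<Rightarrow> 'a::euclidean_space \<Rightarrow> real"
  assumes \<Omega>: "open \<Omega>" and \<phi>: "\<And>n. \<phi> n \<in> test_functions \<Omega>"
    and w: "\<And>n. w n > 0" "summable w"
    and b0: "\<And>n. (\<integral>\<^sup>+x. ennreal ((norm (\<phi> n x))\<^sup>2) \<partial>lebesgue_on \<Omega>) \<le> ennreal ((w n)\<^sup>2)"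
    and b1: "\<And>n. (\<integral>\<^sup>+x. ennreal ((norm (grad (\<phi> n) x))\<^sup>2) \<partial>lebesgue_on \<Omega>) \<le> ennreal ((w n)\<^sup>2)"
    and b2: "\<And>n. (\<integral>\<^sup>+x. ennreal ((norm (laplacian (\<phi> n) x))\<^sup>2) \<partial>lebesgue_on \<Omega>) \<le> ennreal ((w n)\<^sup>2)"
  shows "AE x in lebesgue_on \<Omega>. summable (\<lambda>n. norm (\<phi> n x))"
    and "\<exists>F \<in> L2 \<Omega>. weak_solution \<Omega> F (\<lambda>x. \<Sum>n. \<phi> n x)"
proof -
  let ?M = "lebesgue_on \<Omega>"
  have m0: "\<phi> n \<in> borel_measurable ?M" and m1: "grad (\<phi> n) \<in> borel_measurable ?M"
    and m2: "laplacian (\<phi> n) \<in> borel_measurable ?M" for n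
    by (intro borel_measurable_lebesgue_on test_functions_borel[OF \<phi>] grad_borel[OF \<phi>] laplacian_borel[OF \<phi>])+
  note s0 = square_integrable_series[OF m0 b0 w] and s1 = square_integrable_series[OF m1 b1 w]
    and s2 = square_integrable_series[OF m2 b2 w]
  show "AE x in ?M. summable (\<lambda>n. norm (\<phi> n x))" by (rule s0(1))
  define s where "s = (\<lambda>m x. \<Sum>n<m. \<phi> n x)"
  define u where "u = (\<lambda>x. \<Sum>n. \<phi> n x)"
  define g where "g = (\<lambda>x. \<Sum>n. grad (\<phi> n) x)"
  define L where "L = (\<lambda>x. \<Sum>n. laplacian (\<phi> n) x)"
  have s: "s m \<in> test_functions \<Omega>" for m unfolding s_def by (rule test_functions_sum[OF \<phi>])
  have gs: "grad (s m) = (\<lambda>x. \<Sum>n<m. grad (\<phi> n) x)" for m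
    unfolding s_def by (rule grad_sum[OF test_functionsD(1)[OF \<phi>]])
  have ls: "laplacian (s m) = (\<lambda>x. \<Sum>n<m. laplacian (\<phi> n) x)" for m
    unfolding s_def by (rule laplacian_sum[OF test_functionsD(1)[OF \<phi>]])
  note ss = test_functions_square_integrable[OF \<Omega> s]
  have u: "square_integrable ?M u" and g: "square_integrable ?M g" and L: "square_integrable ?M L"
    unfolding u_def g_def L_def by (fact s0(2) s1(2) s2(2))+
  have lu: "(\<lambda>m. LINT x|?M. (norm (u x - s m x))\<^sup>2) \<longlonglongrightarrow> 0"
    unfolding u_def s_def by (rule s0(3))
  have lg: "(\<lambda>m. LINT x|?M. (norm (g x - grad (s m) x))\<^sup>2) \<longlonglongrightarrow> 0"
    unfolding g_def gs by (rule s1(3))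
  have lL: "(\<lambda>m. LINT x|?M. (norm (L x - laplacian (s m) x))\<^sup>2) \<longlonglongrightarrow> 0"
    unfolding L_def ls by (rule s2(3))
  have sL: "square_integrable ?M (laplacian (s m))" for m
  proof -
    have "square_integrable ?M (\<lambda>x. \<Sum>b\<in>B. partial b (partial b (s m)) x)" if "B \<subseteq> Basis" for B
      using finite_subset[OF that finite_Basis] that
    proof (induction B rule: finite_induct)
      case (insert b B)
      then have "square_integrable ?M (partial b (partial b (s m)))"
        by (intro test_functions_square_integrable(1)[OF \<Omega>] test_functions_partial s) auto
      with insert show ?case by (simp add: square_integrable_add)
    qed (simp add: square_integrable_def)
    then show ?thesis by (simp add: laplacian_def[abs_def])
  qed
  have H1: "H1_gradient \<Omega> u g"
    unfolding H1_gradient_def L2_iff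
  proof (intro conjI ballI u g)
    fix \<psi> and b :: 'a assume \<psi>: "\<psi> \<in> test_functions \<Omega>" and b: "b \<in> Basis"
    have "(\<lambda>m. LINT x|?M. s m x \<bullet> partial b \<psi> x) \<longlonglongrightarrow> (LINT x|?M. u x \<bullet> partial b \<psi> x)"
      by (rule square_integrable_tendsto_inner[OF ss(1) u
            test_functions_square_integrable(1)[OF \<Omega> test_functions_partial[OF \<psi> b]] lu])
    moreover have "(\<lambda>m. LINT x|?M. grad (s m) x \<bullet> (\<psi> x *\<^sub>R b)) \<longlonglongrightarrow> (LINT x|?M. g x \<bullet> (\<psi> x *\<^sub>R b))"
      by (rule square_integrable_tendsto_inner[OF ss(2) g
            square_integrable_scaleR_const[OF test_functions_square_integrable(1)[OF \<Omega> \<psi>]] lg])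
    moreover have "(LINT x|?M. s m x \<bullet> partial b \<psi> x) = - (LINT x|?M. grad (s m) x \<bullet> (\<psi> x *\<^sub>R b))" for m
      using H1_gradientD(3)[OF H1_gradient_test_function[OF \<Omega> s] \<psi> b] by (simp add: mult.commute)
    ultimately have "(LINT x|?M. u x \<bullet> partial b \<psi> x) = - (LINT x|?M. g x \<bullet> (\<psi> x *\<^sub>R b))"
      by (intro LIMSEQ_unique[OF _ tendsto_minus]) simp_all
    then show "(LINT x|?M. u x * partial b \<psi> x) = - (LINT x|?M. (g x \<bullet> b) * \<psi> x)"
      by (simp add: mult.commute)
  qed
  have "(\<lambda>m. (LINT x|?M. (norm (u x - s m x))\<^sup>2) + (LINT x|?M. (norm (g x - grad (s m) x))\<^sup>2)) \<longlonglongrightarrow> 0 + 0"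
    by (rule tendsto_add[OF lu lg])
  then have H10: "u \<in> H10 \<Omega>"
    unfolding H10_def using H1 s by (intro CollectI exI[of _ g] conjI exI[of _ s]) simp_all
  have "(LINT x|?M. g x \<bullet> h x) = (LINT x|?M. - L x * v x)" if h: "H1_gradient \<Omega> v h" for v h
  proof -
    note hv = H1_gradientD(1,2)[OF h]
    have "(\<lambda>m. LINT x|?M. grad (s m) x \<bullet> h x) \<longlonglongrightarrow> (LINT x|?M. g x \<bullet> h x)"
      by (rule square_integrable_tendsto_inner[OF ss(2) g hv(2) lg])
    moreover have "(\<lambda>m. LINT x|?M. laplacian (s m) x \<bullet> v x) \<longlonglongrightarrow> (LINT x|?M. L x \<bullet> v x)"
      by (rule square_integrable_tendsto_inner[OF sL L hv(1) lL])
    ultimately have "(LINT x|?M. g x \<bullet> h x) = - (LINT x|?M. L x \<bullet> v x)"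
      by (intro LIMSEQ_unique[OF _ tendsto_minus])
        (simp_all add: grad_inner_integral[OF \<Omega> s h])
    then show ?thesis by simp
  qed
  then have "weak_solution \<Omega> (\<lambda>x. - L x) u"
    unfolding weak_solution_def using H10 H1 by auto
  moreover have "(\<lambda>x. - L x) \<in> L2 \<Omega>"
    using square_integrable_scaleR[OF L, of "-1"] by (simp add: L2_iff)
  ultimately show "\<exists>F \<in> L2 \<Omega>. weak_solution \<Omega> F (\<lambda>x. \<Sum>n. \<phi> n x)"
    unfolding u_def by blast
qed

section \<open>A Cantor set\<close>

text \<open>The usual parametrization of a Cantor set expands base \<open>B\<close> digits in powers of \<open>\<mu> < 1/B\<close>.
  With floors in place of the digits the parametrization is increasing term by term.\<close>

locale cantor =
  fixes B :: nat and \<mu> :: real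
  assumes B: "B \<ge> 2" and \<mu>: "\<mu> > 0" and q: "B * \<mu> < 1"
begin

definition cantor_fun :: "real \<Rightarrow> real" where
  "cantor_fun s = (\<Sum>i. \<mu> ^ i * of_int \<lfloor>real B ^ i * s\<rfloor>)"

lemma B_pow: "(0::real) < real B ^ i" using B by simp

lemma cantor_summable:
  assumes "0 \<le> s" "s < 1"
  shows "summable (\<lambda>i. \<mu> ^ i * of_int \<lfloor>real B ^ i * s\<rfloor>)"
proof (rule summable_comparison_test')
  show "summable (\<lambda>i. (real B * \<mu>) ^ i)" using q \<mu> by (intro summable_geometric) simp
  fix i
  have "real_of_int \<lfloor>real B ^ i * s\<rfloor> \<le> real B ^ i * s" by linarith
  also have "\<dots> \<le> real B ^ i * 1" using assms by (intro mult_left_mono) auto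
  finally have "real_of_int \<lfloor>real B ^ i * s\<rfloor> \<le> real B ^ i" by simp
  moreover have "0 \<le> \<lfloor>real B ^ i * s\<rfloor>" using assms by simp
  ultimately show "norm (\<mu> ^ i * of_int \<lfloor>real B ^ i * s\<rfloor>) \<le> (real B * \<mu>) ^ i"
    using \<mu> by (simp add: abs_mult power_mult_distrib mult.commute[of "\<mu> ^ i"] mult_right_mono)
qed

lemma cantor_fun_diff:
  assumes "0 \<le> s" "s < 1" "0 \<le> t" "t < 1"
  shows "cantor_fun t - cantor_fun s = (\<Sum>i. \<mu> ^ i * (of_int \<lfloor>real B ^ i * t\<rfloor> - of_int \<lfloor>real B ^ i * s\<rfloor>))"
    and "summable (\<lambda>i. \<mu> ^ i * (real_of_int \<lfloor>real B ^ i * t\<rfloor> - of_int \<lfloor>real B ^ i * s\<rfloor>))"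
  using suminf_diff[OF cantor_summable[OF assms(3,4)] cantor_summable[OF assms(1,2)]]
    summable_diff[OF cantor_summable[OF assms(3,4)] cantor_summable[OF assms(1,2)]]
  by (simp_all add: cantor_fun_def right_diff_distrib)

text \<open>Every term of the series is increasing in the argument, so the difference of two values
  is at least its \<open>j\<close>-th term. Taking \<open>m = 0\<close> gives monotonicity,
  \<open>m = 1\<close> separation.\<close>

lemma cantor_fun_growth:
  assumes "0 \<le> s" "s \<le> t" "t < 1" and m: "\<lfloor>real B ^ j * s\<rfloor> + m \<le> \<lfloor>real B ^ j * t\<rfloor>"
  shows "\<mu> ^ j * of_int m \<le> cantor_fun t - cantor_fun s"
proof -
  have le: "\<lfloor>real B ^ i * s\<rfloor> \<le> \<lfloor>real B ^ i * t\<rfloor>" for i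
    using assms by (intro floor_mono mult_left_mono) auto
  have "\<mu> ^ j * of_int m \<le> \<mu> ^ j * (of_int \<lfloor>real B ^ j * t\<rfloor> - of_int \<lfloor>real B ^ j * s\<rfloor>)"
    using m \<mu> by (intro mult_left_mono) auto
  also have "\<dots> = (\<Sum>i\<in>{j}. \<mu> ^ i * (of_int \<lfloor>real B ^ i * t\<rfloor> - of_int \<lfloor>real B ^ i * s\<rfloor>))" by simp
  also have "\<dots> \<le> (\<Sum>i. \<mu> ^ i * (of_int \<lfloor>real B ^ i * t\<rfloor> - of_int \<lfloor>real B ^ i * s\<rfloor>))"
    using assms le \<mu> by (intro sum_le_suminf cantor_fun_diff) auto
  also have "\<dots> = cantor_fun t - cantor_fun s"
    using assms by (intro cantor_fun_diff(1)[symmetric]) auto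
  finally show ?thesis .
qed

text \<open>Rounding \<open>s\<close> down to the grid of mesh \<open>B ^ (-j)\<close> leaves all
  terms up to level \<open>j\<close> unchanged; at level \<open>j + i\<close> the floors differ by
  at most \<open>B ^ i\<close>, which leaves a geometric tail.\<close>

lemma cantor_fun_truncate:
  assumes s: "0 \<le> s" "s < 1" and k: "k = \<lfloor>real B ^ j * s\<rfloor>"
  shows "0 \<le> k" "k < int B ^ j" "0 \<le> cantor_fun s - cantor_fun (k / real B ^ j)"
    "cantor_fun s - cantor_fun (k / real B ^ j) \<le> \<mu> ^ j * (B * \<mu> / (1 - B * \<mu>))"
proof -
  show k0: "0 \<le> k" using s k by simp
  have "real B ^ j * s < real B ^ j * 1" using s B_pow[of j] by (intro mult_strict_left_mono) auto
  then have "real_of_int k < real B ^ j" unfolding k by linarith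
  then show kB: "k < int B ^ j" by (metis of_int_less_iff of_int_of_nat_eq of_nat_power)
  have k1: "real_of_int k \<le> real B ^ j * s" "real B ^ j * s < k + 1" unfolding k by linarith+
  define s0 where "s0 = k / real B ^ j"
  have s0: "0 \<le> s0" "s0 \<le> s" "s0 < 1"
    using k0 k1 s B_pow[of j] \<open>real_of_int k < real B ^ j\<close> by (auto simp: s0_def field_simps)
  show "0 \<le> cantor_fun s - cantor_fun (k / real B ^ j)"
    using cantor_fun_growth[of s0 s 0 0] s s0 floor_mono[OF s0(2)] by (simp add: s0_def)
  define D where "D = (\<lambda>i. \<mu> ^ i * (real_of_int \<lfloor>real B ^ i * s\<rfloor> - of_int \<lfloor>real B ^ i * s0\<rfloor>))"
  have sD: "summable D" unfolding D_def by (rule cantor_fun_diff) (use s s0 in auto)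
  \<comment> \<open>Floors at level \<open>i\<close> are integer quotients of the floors at level
    \<open>j\<close>, which coincide for \<open>s\<close> and its rounding.\<close>
  have D0: "D i = 0" if ij: "i \<le> j" for i
  proof -
    obtain d where d: "j = i + d" using le_Suc_ex[OF ij] by auto
    have e: "real B ^ i * x = (real B ^ j * x) / real_of_int (int B ^ d)" for x :: real
      using B by (simp add: d power_add)
    have "\<lfloor>real B ^ i * s\<rfloor> = k div int B ^ d"
      using floor_divide_real_eq_div[of "int B ^ d" "real B ^ j * s"] by (simp only: e k) simp
    moreover have "\<lfloor>real B ^ i * s0\<rfloor> = k div int B ^ d"
    proof -
      have "real B ^ j * s0 = of_int k" using B_pow[of j] by (simp add: s0_def)
      then show ?thesis unfolding e by (simp only: floor_divide_of_int_eq)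
    qed
    ultimately show ?thesis by (simp add: D_def)
  qed
  have D1: "D (i + Suc j) \<le> \<mu> ^ j * (B * \<mu> * (real B * \<mu>) ^ i)" for i
  proof -
    have p: "real B ^ (i + Suc j) = real B ^ Suc i * real B ^ j" by (simp add: power_add)
    have "real B ^ (i + Suc j) * s0 = of_int (int B ^ Suc i * k)"
      unfolding p s0_def using B_pow[of j] by simp
    then have "\<lfloor>real B ^ (i + Suc j) * s0\<rfloor> = int B ^ Suc i * k" by (metis floor_of_int)
    moreover have "real_of_int \<lfloor>real B ^ (i + Suc j) * s\<rfloor> \<le> real B ^ Suc i * (k + 1)"
    proof -
      have "real_of_int \<lfloor>real B ^ (i + Suc j) * s\<rfloor> \<le> real B ^ (i + Suc j) * s" by linarith
      also have "\<dots> = real B ^ Suc i * (real B ^ j * s)" unfolding p by simp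
      also have "\<dots> \<le> real B ^ Suc i * (k + 1)" using k1 by (intro mult_left_mono) auto
      finally show ?thesis .
    qed
    ultimately have "real_of_int \<lfloor>real B ^ (i + Suc j) * s\<rfloor> - of_int \<lfloor>real B ^ (i + Suc j) * s0\<rfloor> \<le> real B ^ Suc i"
      by (simp add: algebra_simps)
    then have "D (i + Suc j) \<le> \<mu> ^ (i + Suc j) * real B ^ Suc i"
      unfolding D_def using \<mu> by (intro mult_left_mono) auto
    also have "\<dots> = \<mu> ^ j * (B * \<mu> * (real B * \<mu>) ^ i)" by (simp add: power_add power_mult_distrib)
    finally show ?thesis .
  qed
  have geo: "(\<lambda>i. \<mu> ^ j * (B * \<mu> * (real B * \<mu>) ^ i)) sums (\<mu> ^ j * (B * \<mu> * (1 / (1 - B * \<mu>))))"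
    using q \<mu> by (intro sums_mult geometric_sums) simp
  have "cantor_fun s - cantor_fun s0 = (\<Sum>i. D i)"
    unfolding D_def by (rule cantor_fun_diff) (use s s0 in auto)
  also have "\<dots> = (\<Sum>i. D (i + Suc j)) + (\<Sum>i<Suc j. D i)"
    by (rule suminf_split_initial_segment[OF sD])
  also have "(\<Sum>i<Suc j. D i) = 0" using D0 by (intro sum.neutral) auto
  also have "(\<Sum>i. D (i + Suc j)) + 0 \<le> (\<Sum>i. \<mu> ^ j * (B * \<mu> * (real B * \<mu>) ^ i))"
    using D1 suminf_le[OF D1 summable_ignore_initial_segment[OF sD] sums_summable[OF geo]] by simp
  also have "\<dots> = \<mu> ^ j * (B * \<mu> / (1 - B * \<mu>))"
    using sums_unique[OF geo] by simp
  finally show "cantor_fun s - cantor_fun (k / real B ^ j) \<le> \<mu> ^ j * (B * \<mu> / (1 - B * \<mu>))"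
    by (simp add: s0_def)
qed

lemma cantor_fun_0: "cantor_fun 0 = 0"
  by (simp add: cantor_fun_def)

text \<open>At the first level \<open>j\<close> with \<open>B ^ (-j) \<le> t - s\<close> the floors
  of the two points differ by at least one, so \<open>cantor_fun\<close> grows by at least
  \<open>\<mu> ^ j\<close>, whose \<theta>-th power is \<open>B ^ (-j)\<close>. Minimality of
  \<open>j\<close> costs the factor \<open>B\<close>.\<close>

lemma cantor_fun_inverse_Hoelder:
  assumes "\<theta> > 0" "\<mu> powr \<theta> = 1 / B" and st: "0 \<le> s" "s \<le> t" "t < 1"
  shows "t - s \<le> B * (cantor_fun t - cantor_fun s) powr \<theta>"
proof (cases "s = t")
  case False
  then have pos: "t - s > 0" using st by simp
  have "\<exists>j. (1 / real B) ^ j < t - s"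
    by (rule real_arch_pow_inv[OF pos]) (use B in auto)
  then have ex: "\<exists>j. (1 / real B) ^ j \<le> t - s" by (meson less_imp_le)
  define j where "j = (LEAST j. (1 / real B) ^ j \<le> t - s)"
  have j: "(1 / real B) ^ j \<le> t - s" unfolding j_def by (rule LeastI_ex[OF ex])
  \<comment> \<open>Level 0 would require \<open>t - s \<ge> 1\<close>, so a preceding level
    exists.\<close>
  have "j \<noteq> 0" using j st by (intro notI) simp
  then obtain i where i: "j = Suc i" by (cases j) auto
  have "\<not> (1 / real B) ^ i \<le> t - s"
    using not_less_Least[of i "\<lambda>j. (1 / real B) ^ j \<le> t - s"] i unfolding j_def by simp
  then have up: "t - s < B * (1 / B) ^ j" using B by (simp add: i)
  have "real B ^ j * s + 1 \<le> real B ^ j * t"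
    using j B_pow[of j] by (simp add: power_one_over field_simps)
  then have "\<lfloor>real B ^ j * s\<rfloor> + 1 \<le> \<lfloor>real B ^ j * t\<rfloor>" by linarith
  then have "\<mu> ^ j \<le> cantor_fun t - cantor_fun s"
    using cantor_fun_growth[OF st, of j 1] by simp
  then have "(\<mu> ^ j) powr \<theta> \<le> (cantor_fun t - cantor_fun s) powr \<theta>"
    using \<mu> assms(1) by (intro powr_mono2) auto
  moreover have "(\<mu> ^ j) powr \<theta> = (\<mu> powr \<theta>) ^ j"
    using \<mu> by (simp add: powr_powr mult.commute flip: powr_realpow)
  ultimately have "B * (1 / real B) ^ j \<le> B * (cantor_fun t - cantor_fun s) powr \<theta>"
    by (intro mult_left_mono) (auto simp: assms(2))
  with up show ?thesis by simp
qed simp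

definition cantor_map :: "'a::euclidean_space \<Rightarrow> real \<Rightarrow> 'a \<Rightarrow> 'a" where
  "cantor_map p \<rho> t = p + \<rho> *\<^sub>R (\<Sum>b\<in>Basis. cantor_fun (t \<bullet> b) *\<^sub>R b)"

text \<open>Half-open, so that in each coordinate the floors at level \<open>j\<close> take values
  in the \<open>B ^ j\<close> numbers used by \<open>cantor_index\<close>.\<close>

definition unit_cube :: "'a::euclidean_space set" where
  "unit_cube = {t. \<forall>b\<in>Basis. 0 \<le> t \<bullet> b \<and> t \<bullet> b < 1}"

definition cantor_index :: "nat \<Rightarrow> ('a::euclidean_space \<Rightarrow> nat) set" where
  "cantor_index j = Basis \<rightarrow>\<^sub>E {..<B ^ j}"

text \<open>A piece is represented by the image of the lower corner of its parameter cell. Unlike a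
  midpoint, this is itself a point of the Cantor set.\<close>

definition cantor_center :: "'a::euclidean_space \<Rightarrow> real \<Rightarrow> nat \<Rightarrow> ('a \<Rightarrow> nat) \<Rightarrow> 'a" where
  "cantor_center p \<rho> j \<kappa> = cantor_map p \<rho> (\<Sum>b\<in>Basis. (\<kappa> b / real B ^ j) *\<^sub>R b)"

lemma finite_cantor_index: "finite (cantor_index j)"
  by (auto simp: cantor_index_def intro!: finite_PiE)

lemma card_cantor_index: "card (cantor_index j :: ('a::euclidean_space \<Rightarrow> nat) set) = (B ^ j) ^ DIM('a)"
  by (simp add: cantor_index_def card_PiE)

lemma cantor_map_inner: "b \<in> Basis \<Longrightarrow> cantor_map p \<rho> t \<bullet> b = p \<bullet> b + \<rho> * cantor_fun (t \<bullet> b)"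
  by (simp add: cantor_map_def inner_add_left)

lemma cantor_center_inner:
  "b \<in> Basis \<Longrightarrow> cantor_center p \<rho> j \<kappa> \<bullet> b = p \<bullet> b + \<rho> * cantor_fun (\<kappa> b / real B ^ j)"
  by (simp add: cantor_center_def cantor_map_inner)

lemma cantor_fun_grid_growth:
  assumes "k < l" "l < B ^ j"
  shows "\<mu> ^ j \<le> cantor_fun (real l / real B ^ j) - cantor_fun (real k / real B ^ j)"
proof -
  have l: "real l < real B ^ j" using assms(2) by (metis of_nat_less_iff of_nat_power)
  have e: "\<lfloor>real B ^ j * (real m / real B ^ j)\<rfloor> = int m" for m using B_pow[of j] by simp
  show ?thesis
    using cantor_fun_growth[of "k / real B ^ j" "l / real B ^ j" j 1] assms(1) l B_pow[of j]
    unfolding e by (simp add: divide_right_mono)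
qed

lemma cantor_center_separated:
  assumes "\<kappa> \<in> cantor_index j" "\<kappa>' \<in> cantor_index j" "\<kappa> \<noteq> \<kappa>'" "\<rho> \<ge> 0"
  shows "\<rho> * \<mu> ^ j \<le> dist (cantor_center p \<rho> j \<kappa>) (cantor_center p \<rho> j \<kappa>')"
proof -
  obtain b where b: "b \<in> Basis" "\<kappa> b \<noteq> \<kappa>' b"
    using assms PiE_ext unfolding cantor_index_def by blast
  have lt: "\<kappa> b < B ^ j" "\<kappa>' b < B ^ j" using assms b by (auto simp: cantor_index_def)
  have "\<mu> ^ j \<le> \<bar>cantor_fun (\<kappa> b / real B ^ j) - cantor_fun (\<kappa>' b / real B ^ j)\<bar>"
    using cantor_fun_grid_growth[of "\<kappa> b" "\<kappa>' b" j] cantor_fun_grid_growth[of "\<kappa>' b" "\<kappa> b" j] lt b(2)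
    by (cases "\<kappa> b < \<kappa>' b") auto
  then have "\<rho> * \<mu> ^ j \<le> \<rho> * \<bar>cantor_fun (\<kappa> b / real B ^ j) - cantor_fun (\<kappa>' b / real B ^ j)\<bar>"
    using assms(4) by (rule mult_left_mono)
  also have "\<dots> = \<bar>(cantor_center p \<rho> j \<kappa> - cantor_center p \<rho> j \<kappa>') \<bullet> b\<bar>"
    using b(1) assms(4) by (simp add: inner_diff_left cantor_center_inner abs_mult flip: right_diff_distrib)
  also have "\<dots> \<le> dist (cantor_center p \<rho> j \<kappa>) (cantor_center p \<rho> j \<kappa>')"
    unfolding dist_norm using b(1) by (rule Basis_le_norm)
  finally show ?thesis .
qed

text \<open>The parameter is truncated in every coordinate; the factor \<open>DIM('a)\<close> is the
  price of estimating the norm by the sum of the coordinates.\<close>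

lemma cantor_map_near_center:
  fixes t :: "'a::euclidean_space"
  assumes t: "t \<in> unit_cube" and "\<rho> \<ge> 0"
  shows "\<exists>\<kappa>\<in>cantor_index j. dist (cantor_map p \<rho> t) (cantor_center p \<rho> j \<kappa>)
     \<le> DIM('a) * (\<rho> * \<mu> ^ j * (B * \<mu> / (1 - B * \<mu>)))"
proof -
  define \<kappa> where "\<kappa> = (\<lambda>b\<in>Basis. nat \<lfloor>real B ^ j * (t \<bullet> (b::'a))\<rfloor>)"
  have tb: "0 \<le> t \<bullet> b" "t \<bullet> b < 1" if "b \<in> Basis" for b using t that by (auto simp: unit_cube_def)
  note tr = cantor_fun_truncate[OF tb refl, of _ j]
  have k: "real (\<kappa> b) = of_int \<lfloor>real B ^ j * (t \<bullet> b)\<rfloor>" if "b \<in> Basis" for b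
    using tr(1)[OF that that] that by (simp add: \<kappa>_def)
  have "\<kappa> b < B ^ j" if "b \<in> Basis" for b
    using tr(1,2)[OF that that] that by (simp add: \<kappa>_def nat_less_iff)
  then have "\<kappa> \<in> cantor_index j"
    by (auto simp: cantor_index_def \<kappa>_def)
  moreover have "dist (cantor_map p \<rho> t) (cantor_center p \<rho> j \<kappa>)
     \<le> DIM('a) * (\<rho> * \<mu> ^ j * (B * \<mu> / (1 - B * \<mu>)))"
  proof -
    have "dist (cantor_map p \<rho> t) (cantor_center p \<rho> j \<kappa>)
        \<le> (\<Sum>b\<in>Basis. \<bar>(cantor_map p \<rho> t - cantor_center p \<rho> j \<kappa>) \<bullet> b\<bar>)"
      unfolding dist_norm by (rule norm_le_l1)
    also have "\<dots> \<le> (\<Sum>b\<in>(Basis::'a set). \<rho> * \<mu> ^ j * (B * \<mu> / (1 - B * \<mu>)))"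
    proof (rule sum_mono)
      fix b :: 'a assume b: "b \<in> Basis"
      have "\<bar>(cantor_map p \<rho> t - cantor_center p \<rho> j \<kappa>) \<bullet> b\<bar>
          = \<rho> * (cantor_fun (t \<bullet> b) - cantor_fun (of_int \<lfloor>real B ^ j * (t \<bullet> b)\<rfloor> / real B ^ j))"
        using b assms(2) tr(3)[OF b b]
        by (simp add: inner_diff_left cantor_center_inner cantor_map_inner k abs_mult flip: right_diff_distrib)
      also have "\<dots> \<le> \<rho> * (\<mu> ^ j * (B * \<mu> / (1 - B * \<mu>)))"
        by (intro mult_left_mono tr(4)[OF b b] assms)
      finally show "\<bar>(cantor_map p \<rho> t - cantor_center p \<rho> j \<kappa>) \<bullet> b\<bar>
          \<le> \<rho> * \<mu> ^ j * (B * \<mu> / (1 - B * \<mu>))" by (simp add: mult.assoc)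
    qed
    finally show ?thesis by simp
  qed
  ultimately show ?thesis by blast
qed

lemma cantor_center_in_set:
  assumes "\<kappa> \<in> cantor_index j"
  shows "\<exists>t\<in>unit_cube. cantor_center p \<rho> j \<kappa> = cantor_map p \<rho> t"
proof -
  have "real (\<kappa> b) < real B ^ j" if "b \<in> Basis" for b
  proof -
    have "\<kappa> b < B ^ j" using assms that by (auto simp: cantor_index_def)
    then show ?thesis by (metis of_nat_less_iff of_nat_power)
  qed
  then have "(\<Sum>b\<in>Basis. (\<kappa> b / real B ^ j) *\<^sub>R b) \<in> unit_cube"
    using B_pow[of j] by (auto simp: unit_cube_def)
  then show ?thesis by (auto simp: cantor_center_def)
qed

lemma cantor_map_0: "cantor_map p \<rho> 0 = p"
  by (simp add: cantor_map_def cantor_fun_0)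

lemma zero_in_unit_cube: "0 \<in> unit_cube"
  by (simp add: unit_cube_def)

text \<open>Since \<open>cantor_map\<close> has a Hoelder continuous inverse with exponent \<open>\<theta>\<close>, any cover of its
  image by sets of diameters \<open>D\<^sub>i\<close> yields a cover of the unit cube by cubes of side
  \<open>O(D\<^sub>i powr \<theta>)\<close>, whose volumes must add up to at least one.\<close>

lemma cantor_cover_lower_bound:
  fixes U :: "nat \<Rightarrow> 'a::euclidean_space set" and \<theta> :: real
  assumes \<theta>: "\<theta> > 0" "\<mu> powr \<theta> = 1 / B" and \<rho>: "\<rho> > 0"
    and cover: "cantor_map p \<rho> ` unit_cube \<subseteq> (\<Union>i. U i)" and bdd: "\<And>i. bounded (U i)"
  shows "1 \<le> (\<Sum>i. ennreal ((2 * B / \<rho> powr \<theta>) ^ DIM('a) * diameter (U i) powr (DIM('a) * \<theta>)))"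
proof -
  define D where "D = (\<lambda>i. diameter (U i))"
  have D0: "D i \<ge> 0" for i using bdd by (simp add: D_def diameter_ge_0)
  define r where "r = (\<lambda>i. B * (D i / \<rho>) powr \<theta>)"
  have r0: "r i \<ge> 0" for i by (simp add: r_def)
  define T where "T = (\<lambda>i. {t \<in> unit_cube. cantor_map p \<rho> t \<in> U i})"
  \<comment> \<open>If \<open>T i\<close> is empty this point is arbitrary, and the inclusion of
    \<open>T i\<close> in the cube \<open>C i\<close> is trivial.\<close>
  define c where "c = (\<lambda>i. SOME t. t \<in> T i)"
  define C where "C = (\<lambda>i. cbox (c i - r i *\<^sub>R One) (c i + r i *\<^sub>R One))"
  have TC: "T i \<subseteq> C i" for i
  proof
    fix t assume t: "t \<in> T i"
    then have c: "c i \<in> T i" unfolding c_def by (rule someI)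
    have "\<bar>t \<bullet> b - c i \<bullet> b\<bar> \<le> r i" if b: "b \<in> Basis" for b
    proof -
      have le: "y \<bullet> b - x \<bullet> b \<le> r i" if xy: "x \<in> T i" "y \<in> T i" "x \<bullet> b \<le> y \<bullet> b" for x y
      proof -
        have u: "0 \<le> x \<bullet> b" "y \<bullet> b < 1" using xy b by (auto simp: T_def unit_cube_def)
        have "\<rho> * (cantor_fun (y \<bullet> b) - cantor_fun (x \<bullet> b)) = (cantor_map p \<rho> y - cantor_map p \<rho> x) \<bullet> b"
          using b by (simp add: inner_diff_left cantor_map_inner right_diff_distrib)
        also have "\<dots> \<le> dist (cantor_map p \<rho> y) (cantor_map p \<rho> x)"
          unfolding dist_norm using Basis_le_norm[OF b] abs_le_D1 by blast
        also have "\<dots> \<le> D i"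
          unfolding D_def using xy bdd by (intro diameter_bounded_bound) (auto simp: T_def)
        finally have "cantor_fun (y \<bullet> b) - cantor_fun (x \<bullet> b) \<le> D i / \<rho>"
          using \<rho> by (simp add: field_simps)
        moreover have "0 \<le> cantor_fun (y \<bullet> b) - cantor_fun (x \<bullet> b)"
          using cantor_fun_growth[OF u(1) xy(3) u(2), of 0 0] floor_mono[OF xy(3)] by simp
        ultimately have "(cantor_fun (y \<bullet> b) - cantor_fun (x \<bullet> b)) powr \<theta> \<le> (D i / \<rho>) powr \<theta>"
          using \<theta> by (intro powr_mono2) auto
        then have "B * (cantor_fun (y \<bullet> b) - cantor_fun (x \<bullet> b)) powr \<theta> \<le> r i"
          unfolding r_def by (intro mult_left_mono) auto
        with cantor_fun_inverse_Hoelder[OF \<theta> u(1) xy(3) u(2)] show ?thesis by simp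
      qed
      show ?thesis
        using le[OF t c] le[OF c t] by linarith
    qed
    then show "t \<in> C i"
      by (force simp: C_def mem_box inner_diff_left inner_add_left abs_le_iff)
  qed
  \<comment> \<open>The open unit box has volume one, which is the left-hand side of the claimed
    bound.\<close>
  have "box 0 One \<subseteq> (unit_cube :: 'a set)"
    by (auto simp: unit_cube_def mem_box intro: less_imp_le)
  also have "unit_cube \<subseteq> (\<Union>i. T i)"
    using cover by (auto simp: T_def)
  also have "(\<Union>i. T i) \<subseteq> (\<Union>i. C i)" by (rule UN_mono[OF subset_refl TC])
  finally have "box 0 One \<subseteq> (\<Union>i. C i)" .
  then have "emeasure lborel (box 0 One :: 'a set) \<le> emeasure lborel (\<Union>i. C i)"
    by (intro emeasure_mono) (auto simp: C_def)
  also have "\<dots> \<le> (\<Sum>i. emeasure lborel (C i))"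
    by (rule emeasure_subadditive_countably) (auto simp: C_def)
  finally have main: "emeasure lborel (box 0 One :: 'a set) \<le> (\<Sum>i. emeasure lborel (C i))" .
  have "emeasure lborel (C i) = ennreal ((2 * B / \<rho> powr \<theta>) ^ DIM('a) * D i powr (DIM('a) * \<theta>))" for i
  proof -
    have "emeasure lborel (C i) = ennreal (\<Prod>b\<in>(Basis::'a set). 2 * r i)"
      unfolding C_def using r0[of i]
      by (subst emeasure_lborel_cbox) (auto simp: inner_diff_left inner_add_left algebra_simps)
    also have "(\<Prod>b\<in>(Basis::'a set). 2 * r i) = (2 * B / \<rho> powr \<theta>) ^ DIM('a) * (D i powr \<theta>) ^ DIM('a)"
      using D0[of i] \<rho> by (simp add: r_def powr_divide mult.assoc flip: power_mult_distrib)
    also have "(D i powr \<theta>) ^ DIM('a) = D i powr (DIM('a) * \<theta>)"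
      by (cases "D i = 0") (use D0[of i] in \<open>simp_all add: powr_realpow[symmetric] powr_powr mult.commute\<close>)
    finally show ?thesis .
  qed
  with main show ?thesis by (simp add: D_def emeasure_lborel_box)
qed

end

section \<open>Hausdorff measure\<close>

lemma hausdorff_premeasure_mono: "S \<subseteq> T \<Longrightarrow> hausdorff_premeasure s \<delta> S \<le> hausdorff_premeasure s \<delta> T"
  unfolding hausdorff_premeasure_def by (rule INF_superset_mono) auto

text \<open>Nearly optimal covers of the sets \<open>S k\<close>, with errors
  \<open>e / 2 ^ Suc k\<close>, are merged into one sequence by pairing. The scale \<delta> stays
  fixed throughout.\<close>

lemma hausdorff_premeasure_subadditive:
  fixes S :: "nat \<Rightarrow> 'a::metric_space set"
  shows "hausdorff_premeasure s \<delta> (\<Union>k. S k) \<le> (\<Sum>k. hausdorff_premeasure s \<delta> (S k))"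
proof (rule ennreal_le_epsilon)
  fix e :: real assume fin: "(\<Sum>k. hausdorff_premeasure s \<delta> (S k)) < top" and e: "0 < e"
  have "\<exists>U. S k \<subseteq> (\<Union>i. U i) \<and> (\<forall>i::nat. bounded (U i) \<and> diameter (U i) \<le> \<delta>) \<and>
      (\<Sum>i. ennreal (diameter (U i) powr s)) \<le> hausdorff_premeasure s \<delta> (S k) + ennreal e * ennreal ((1/2) ^ Suc k)" for k
  proof -
    have "hausdorff_premeasure s \<delta> (S k) < top"
      using fin ennreal_suminf_lessD by blast
    moreover have "0 < ennreal e * ennreal ((1/2) ^ Suc k)"
      using e by (simp add: ennreal_zero_less_mult_iff)
    ultimately have "hausdorff_premeasure s \<delta> (S k) < hausdorff_premeasure s \<delta> (S k) + ennreal e * ennreal ((1/2) ^ Suc k)"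
      using ennreal_add_left_cancel_less[of "hausdorff_premeasure s \<delta> (S k)" 0] by (simp add: less_top)
    then have "\<exists>U\<in>{U :: nat \<Rightarrow> 'a set. S k \<subseteq> (\<Union>i. U i) \<and> (\<forall>i. bounded (U i) \<and> diameter (U i) \<le> \<delta>)}.
        (\<Sum>i. ennreal (diameter (U i) powr s)) < hausdorff_premeasure s \<delta> (S k) + ennreal e * ennreal ((1/2) ^ Suc k)"
      by (subst (asm) hausdorff_premeasure_def, subst (asm) INF_less_iff)
    then show ?thesis by (auto intro: less_imp_le)
  qed
  then obtain U :: "nat \<Rightarrow> nat \<Rightarrow> 'a set" where U: "\<And>k. S k \<subseteq> (\<Union>i. U k i)"
    "\<And>k i. bounded (U k i)" "\<And>k i. diameter (U k i) \<le> \<delta>"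
    "\<And>k. (\<Sum>i. ennreal (diameter (U k i) powr s)) \<le> hausdorff_premeasure s \<delta> (S k) + ennreal e * ennreal ((1/2) ^ Suc k)"
    by metis
  define V where "V = (\<lambda>n. case prod_decode n of (k, i) \<Rightarrow> U k i)"
  have V: "V (prod_encode (k, i)) = U k i" for k i by (simp add: V_def)
  have "(\<Union>k. S k) \<subseteq> (\<Union>n. V n)"
  proof
    fix x assume "x \<in> (\<Union>k. S k)"
    then obtain k i where "x \<in> U k i" using U(1) by blast
    then have "x \<in> V (prod_encode (k, i))" by (simp add: V)
    then show "x \<in> (\<Union>n. V n)" by blast
  qed
  moreover have "bounded (V n)" "diameter (V n) \<le> \<delta>" for n
    using U(2,3) by (auto simp: V_def split: prod.split)
  ultimately have "hausdorff_premeasure s \<delta> (\<Union>k. S k) \<le> (\<Sum>n. ennreal (diameter (V n) powr s))"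
    unfolding hausdorff_premeasure_def by (intro INF_lower) auto
  also have "\<dots> = (\<Sum>n. (\<lambda>(k, i). ennreal (diameter (U k i) powr s)) (prod_decode n))"
    by (intro suminf_cong) (simp add: V_def split: prod.split)
  also have "\<dots> = (\<Sum>k. \<Sum>i. ennreal (diameter (U k i) powr s))"
    by (rule suminf_ennreal_2dimen) simp
  also have "\<dots> \<le> (\<Sum>k. hausdorff_premeasure s \<delta> (S k) + ennreal e * ennreal ((1/2) ^ Suc k))"
    by (intro suminf_le U(4)) auto
  also have "\<dots> = (\<Sum>k. hausdorff_premeasure s \<delta> (S k)) + (\<Sum>k. ennreal e * ennreal ((1/2) ^ Suc k))"
    by (rule suminf_add[symmetric]) auto
  also have "(\<Sum>k. ennreal e * ennreal ((1/2) ^ Suc k)) = ennreal e"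
    unfolding ennreal_suminf_cmult
    by (subst suminf_ennreal_eq[OF zero_le_power power_half_series]) auto
  finally show "hausdorff_premeasure s \<delta> (\<Union>k. S k) \<le> (\<Sum>k. hausdorff_premeasure s \<delta> (S k)) + ennreal e" .
qed

lemma hausdorff_premeasure_Union_cball:
  fixes c :: "'i \<Rightarrow> 'a::euclidean_space"
  assumes I: "finite I" and r: "0 \<le> r" "2 * r \<le> \<delta>"
  shows "hausdorff_premeasure s \<delta> (\<Union>i\<in>I. cball (c i) r) \<le> ennreal (card I * (2 * r) powr s)"
proof -
  obtain h where h: "bij_betw h {..<card I} I"
    using ex_bij_betw_nat_finite[OF I] by (auto simp: atLeast0LessThan)
  \<comment> \<open>The finite cover is padded with empty sets, which contribute nothing because
    their diameter is 0 and \<open>0 powr s = 0\<close>.\<close>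
  define U where "U = (\<lambda>n. if n < card I then cball (c (h n)) r else {})"
  have "(\<Union>i\<in>I. cball (c i) r) \<subseteq> (\<Union>n. U n)"
  proof
    fix x assume "x \<in> (\<Union>i\<in>I. cball (c i) r)"
    then obtain i where i: "i \<in> I" "x \<in> cball (c i) r" by auto
    then have "i \<in> h ` {..<card I}" by (simp add: bij_betw_imp_surj_on[OF h])
    then obtain n where "n < card I" "x \<in> cball (c (h n)) r" using i(2) by auto
    then have "x \<in> U n" by (simp add: U_def)
    then show "x \<in> (\<Union>n. U n)" by blast
  qed
  moreover have "bounded (U n)" "diameter (U n) \<le> \<delta>" for n
    using r by (auto simp: U_def)
  ultimately have "hausdorff_premeasure s \<delta> (\<Union>i\<in>I. cball (c i) r) \<le> (\<Sum>n. ennreal (diameter (U n) powr s))"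
    unfolding hausdorff_premeasure_def by (intro INF_lower) auto
  also have "\<dots> = (\<Sum>n<card I. ennreal (diameter (U n) powr s))"
    by (rule suminf_finite) (auto simp: U_def)
  also have "\<dots> = (\<Sum>n<card I. ennreal ((2 * r) powr s))"
    using r by (intro sum.cong) (auto simp: U_def)
  also have "\<dots> = ennreal (card I * (2 * r) powr s)"
    by (simp add: ennreal_mult ennreal_of_nat_eq_real_of_nat)
  finally show ?thesis .
qed

text \<open>The balls of radius \<open>r/2\<close> are disjoint, so at most one summand is nonzero
  at any point and the number of pieces does not enter the bound. The general codomain admits
  values, gradients and Laplacians of bumps alike.\<close>

lemma norm_sum_disjoint_le:
  fixes f :: "'a::euclidean_space \<Rightarrow> 'b::real_normed_vector" and c :: "'i \<Rightarrow> 'a"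
  assumes I: "finite I" and r: "r > 0" and K: "\<And>y. norm (f y) \<le> K"
    and sep: "\<And>i j. i \<in> I \<Longrightarrow> j \<in> I \<Longrightarrow> i \<noteq> j \<Longrightarrow> r \<le> dist (c i) (c j)"
    and supp: "\<And>y. norm y \<ge> 1/2 \<Longrightarrow> f y = 0"
  shows "norm (\<Sum>i\<in>I. f ((1/r) *\<^sub>R (x - c i))) \<le> K * indicator (\<Union>i\<in>I. ball (c i) (r/2)) x"
proof -
  have out: "f ((1/r) *\<^sub>R (x - c i)) = 0" if "x \<notin> ball (c i) (r/2)" for i
  proof (rule supp)
    have eq: "norm ((1/r) *\<^sub>R (x - c i)) = norm (x - c i) / r" using r by simp
    have "r / 2 \<le> norm (x - c i)"
      using that by (simp add: dist_norm norm_minus_commute)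
    then show "1/2 \<le> norm ((1/r) *\<^sub>R (x - c i))" unfolding eq using r by (simp add: field_simps)
  qed
  show ?thesis
  proof (cases "x \<in> (\<Union>i\<in>I. ball (c i) (r/2))")
    case True
    then obtain k where k: "k \<in> I" "x \<in> ball (c k) (r/2)" by blast
    have "f ((1/r) *\<^sub>R (x - c i)) = 0" if "i \<in> I - {k}" for i
    proof (rule out, rule notI)
      assume "x \<in> ball (c i) (r/2)"
      then have "dist (c i) (c k) < r"
        using k(2) dist_triangle_half_r[of x "c i" r "c k"] by (simp add: dist_commute)
      with sep[of i k] that k(1) show False by auto
    qed
    then have "(\<Sum>i\<in>I. f ((1/r) *\<^sub>R (x - c i))) = f ((1/r) *\<^sub>R (x - c k))"
      using I k(1) by (subst sum.remove[of I k]) auto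
    then show ?thesis using K True by simp
  next
    case False
    then have "(\<Sum>i\<in>I. f ((1/r) *\<^sub>R (x - c i))) = 0"
      by (intro sum.neutral ballI out) blast
    then show ?thesis using False by simp
  qed
qed

lemma emeasure_Union_ball_le:
  fixes c :: "'i \<Rightarrow> 'a::euclidean_space"
  assumes "finite I" "r \<ge> 0"
  shows "emeasure lborel (\<Union>i\<in>I. ball (c i) r) \<le> ennreal (card I * (unit_ball_vol DIM('a) * r ^ DIM('a)))"
proof -
  have "emeasure lborel (\<Union>i\<in>I. ball (c i) r) \<le> (\<Sum>i\<in>I. emeasure lborel (ball (c i) r))"
    using assms by (intro emeasure_subadditive_finite) auto
  also have "\<dots> = ennreal (card I * (unit_ball_vol DIM('a) * r ^ DIM('a)))"
    using assms by (simp add: emeasure_ball ennreal_mult ennreal_of_nat_eq_real_of_nat)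
  finally show ?thesis .
qed

abbreviation ball_integral :: "('a::euclidean_space \<Rightarrow> ennreal) \<Rightarrow> 'a \<Rightarrow> real \<Rightarrow> ennreal" where
  "ball_integral f a R \<equiv> (\<integral>\<^sup>+x. f x * indicator (ball a R) x \<partial>lborel)"

section \<open>Singular families of test functions\<close>

text \<open>The Cantor set has dimension \<open>DIM('a) ln B / ln (1/\<mu>)\<close>; \<open>summable_ratio\<close> says that this is
  less than \<open>\<beta>\<close>.\<close>

locale singular_block = cantor +
  fixes p :: "'a::euclidean_space" and \<rho> \<gamma> \<beta> K :: real and \<psi> :: "'a \<Rightarrow> real"
  assumes \<rho>: "0 < \<rho>" "\<rho> \<le> 1" and \<gamma>: "\<gamma> > 0"
    and small: "DIM('a) * (B * \<mu> / (1 - B * \<mu>)) \<le> 1 / 8"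
    and beta: "\<beta> = real DIM('a) - 4 - 2 * \<gamma>" "\<beta> > 0"
    and summable_ratio: "real B ^ DIM('a) * \<mu> powr \<beta> < 1"
    and \<psi>: "smooth \<psi>" "\<And>x. \<psi> x \<ge> 0" "\<And>x. norm x \<ge> 3/8 \<Longrightarrow> \<psi> x = 0" "\<And>x. norm x \<le> 1/4 \<Longrightarrow> \<psi> x \<ge> 1"
    and K: "K > 0" "\<And>x. \<bar>\<psi> x\<bar> \<le> K" "\<And>x. norm (grad \<psi> x) \<le> K" "\<And>x. \<bar>laplacian \<psi> x\<bar> \<le> K"
begin

definition r :: "nat \<Rightarrow> real" where "r j = \<rho> * \<mu> ^ j"
text \<open>The common ratio of all series over generations: passing to the next one multiplies the
  number of pieces by \<open>B ^ DIM('a)\<close> and \<open>r j powr \<beta>\<close> by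
  \<open>\<mu> powr \<beta>\<close>.\<close>

definition \<kappa> :: real where "\<kappa> = real B ^ DIM('a) * \<mu> powr \<beta>"
abbreviation "c j \<equiv> cantor_center p \<rho> j"
abbreviation "I j \<equiv> cantor_index j :: ('a \<Rightarrow> nat) set"
abbreviation "\<xi> j i x \<equiv> (1 / r j) *\<^sub>R (x - c j i)"
definition S :: "nat \<Rightarrow> 'a set" where "S j = (\<Union>i\<in>I j. ball (c j i) (r j / 2))"
definition \<phi> :: "nat \<Rightarrow> 'a \<Rightarrow> real" where
  "\<phi> j x = r j powr (-\<gamma>) * (\<Sum>i\<in>I j. \<psi> (\<xi> j i x))"
definition A :: "'a set" where "A = cantor_map p \<rho> ` unit_cube"
definition E :: "nat \<Rightarrow> 'a set" where "E j = (\<Union>i\<in>I j. cball (c j i) (r j))"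

lemma \<mu>1: "\<mu> < 1"
proof -
  have "1 * \<mu> \<le> B * \<mu>" using B \<mu> by (intro mult_right_mono) auto
  then show ?thesis using q by simp
qed

lemma r_pos: "r j > 0" and r_le: "r j \<le> \<rho>" and r_le1: "r j \<le> 1"
proof -
  have "\<mu> ^ j \<le> 1" using \<mu> \<mu>1 by (intro power_le_one) auto
  then have "\<rho> * \<mu> ^ j \<le> \<rho> * 1" using \<rho> by (intro mult_left_mono) auto
  then show le: "r j \<le> \<rho>" by (simp add: r_def)
  show "r j > 0" using \<rho> \<mu> by (simp add: r_def)
  show "r j \<le> 1" using le \<rho>(2) by (rule order_trans)
qed

lemma r_mono: "i \<le> j \<Longrightarrow> r j \<le> r i"
  using \<rho> \<mu> \<mu>1 by (auto simp: r_def intro!: mult_left_mono power_decreasing)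

text \<open>The assumption \<open>small\<close> reduces the truncation error to an eighth of the
  spacing of the centres, which keeps the pieces well separated.\<close>

lemma near_center: "a \<in> A \<Longrightarrow> \<exists>i\<in>I j. dist a (c j i) \<le> r j / 8"
proof -
  assume "a \<in> A"
  then obtain t where t: "t \<in> unit_cube" "a = cantor_map p \<rho> t" by (auto simp: A_def)
  obtain i where i: "i \<in> I j" "dist a (c j i) \<le> DIM('a) * (\<rho> * \<mu> ^ j * (B * \<mu> / (1 - B * \<mu>)))"
    using cantor_map_near_center[OF t(1), where \<rho> = \<rho> and p = p and j = j] t(2) \<rho> by auto
  have "DIM('a) * (\<rho> * \<mu> ^ j * (B * \<mu> / (1 - B * \<mu>))) = r j * (DIM('a) * (B * \<mu> / (1 - B * \<mu>)))"
    by (simp add: r_def)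
  also have "\<dots> \<le> r j * (1 / 8)" using r_pos[of j] by (intro mult_left_mono small) auto
  finally have "dist a (c j i) \<le> r j / 8" using i(2) by linarith
  with i(1) show ?thesis by blast
qed

lemma center_in: "i \<in> I j \<Longrightarrow> c j i \<in> A"
  using cantor_center_in_set[of i j p \<rho>] by (auto simp: A_def)

lemma center_0: "c 0 i = p" if "i \<in> I 0"
proof -
  have "i b = 0" if "b \<in> Basis" for b using \<open>i \<in> I 0\<close> that by (auto simp: cantor_index_def)
  then show ?thesis by (simp add: cantor_center_def cantor_map_0)
qed

lemma A_near_p: "a \<in> A \<Longrightarrow> dist a p \<le> \<rho> / 8"
  using near_center[of a 0] center_0 by (auto simp: r_def)

lemma p_in_A: "p \<in> A"
  unfolding A_def using zero_in_unit_cube cantor_map_0[of p \<rho>] by (metis imageI)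

lemma separated: "i \<in> I j \<Longrightarrow> k \<in> I j \<Longrightarrow> i \<noteq> k \<Longrightarrow> r j \<le> dist (c j i) (c j k)"
  unfolding r_def using cantor_center_separated[of i j k \<rho> p] \<rho> by simp

lemma norm_sum_bump_le:
  fixes f :: "'a \<Rightarrow> 'b::real_normed_vector"
  assumes "\<And>y. norm (f y) \<le> K" "\<And>y. norm y \<ge> 1/2 \<Longrightarrow> f y = 0"
  shows "norm (\<Sum>i\<in>I j. f (\<xi> j i x)) \<le> K * indicator (S j) x"
  unfolding S_def by (rule norm_sum_disjoint_le[OF finite_cantor_index r_pos assms(1) separated assms(2)])

lemma emeasure_S: "emeasure lborel (S j) \<le> ennreal (unit_ball_vol DIM('a) * ((real B ^ j) ^ DIM('a) * r j ^ DIM('a)))"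
proof -
  have "emeasure lborel (S j) \<le> ennreal (card (I j) * (unit_ball_vol DIM('a) * (r j / 2) ^ DIM('a)))"
    unfolding S_def using r_pos[of j] by (intro emeasure_Union_ball_le finite_cantor_index) simp
  also have "\<dots> \<le> ennreal (card (I j) * (unit_ball_vol DIM('a) * r j ^ DIM('a)))"
    using r_pos[of j] by (intro ennreal_leI mult_left_mono power_mono) auto
  finally show ?thesis by (simp add: card_cantor_index mult_ac)
qed

lemma S_measurable [measurable]: "S j \<in> sets borel"
  unfolding S_def by (intro borel_open open_UN) auto

lemma ratio_pow: "(real B ^ j) ^ DIM('a) * r j powr \<beta> = \<rho> powr \<beta> * \<kappa> ^ j"
proof -
  have "r j powr \<beta> = \<rho> powr \<beta> * (\<mu> powr \<beta>) ^ j"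
    using \<mu> \<rho> by (simp add: r_def powr_mult powr_powr mult.commute flip: powr_realpow)
  then show ?thesis by (simp add: \<kappa>_def power_mult_distrib mult_ac flip: power_mult)
qed

lemma \<kappa>: "0 < \<kappa>" "\<kappa> < 1"
  using summable_ratio \<mu> B by (auto simp: \<kappa>_def)

text \<open>The square root of the bound for the squared norms of generation \<open>j\<close>; it is
  still geometric in \<open>j\<close>.\<close>

definition w :: "nat \<Rightarrow> real" where
  "w j = K * sqrt (unit_ball_vol DIM('a) * \<rho> powr \<beta>) * sqrt \<kappa> ^ j"

lemma w: "w j > 0" "summable w"
proof -
  show "w j > 0" using K(1) \<kappa> \<rho> by (simp add: w_def)
  show "summable w"
    unfolding w_def using \<kappa> by (intro summable_mult summable_geometric) simp
qed

section \<open>Square norms of one generation\<close>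

text \<open>The hypothesis has the size of a Laplacian of a generation. Its square times the volume
  of \<open>S j\<close> is of order \<open>B ^ (j * DIM('a))\<close> times \<open>r j\<close> to the
  power \<open>DIM('a) - 4 - 2 * \<gamma>\<close>, which explains the value of \<beta>.\<close>

lemma square_bound:
  fixes g :: "'a \<Rightarrow> 'b::real_normed_vector"
  assumes "\<And>x. norm (g x) \<le> r j powr (-\<gamma>) * (1 / (r j)\<^sup>2) * (K * indicator (S j) x)"
  shows "(\<integral>\<^sup>+x. ennreal ((norm (g x))\<^sup>2) \<partial>lborel) \<le> ennreal ((w j)\<^sup>2)"
proof -
  let ?c = "(r j powr (-\<gamma>) * (1 / (r j)\<^sup>2) * K)\<^sup>2"
  have "(\<integral>\<^sup>+x. ennreal ((norm (g x))\<^sup>2) \<partial>lborel) \<le> (\<integral>\<^sup>+x. ennreal ?c * indicator (S j) x \<partial>lborel)"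
  proof (rule nn_integral_mono)
    fix x
    have "(norm (g x))\<^sup>2 \<le> (r j powr (-\<gamma>) * (1 / (r j)\<^sup>2) * (K * indicator (S j) x))\<^sup>2"
      by (intro power_mono assms) simp
    also have "\<dots> = ?c * indicator (S j) x" by (simp split: split_indicator)
    finally show "ennreal ((norm (g x))\<^sup>2) \<le> ennreal ?c * indicator (S j) x"
      by (simp split: split_indicator_asm split_indicator add: ennreal_leI)
  qed
  also have "\<dots> = ennreal ?c * emeasure lborel (S j)"
    by (rule nn_integral_cmult_indicator) simp
  also have "\<dots> \<le> ennreal ?c * ennreal (unit_ball_vol DIM('a) * ((real B ^ j) ^ DIM('a) * r j ^ DIM('a)))"
    by (intro mult_left_mono emeasure_S) simp
  also have "\<dots> = ennreal (?c * (unit_ball_vol DIM('a) * ((real B ^ j) ^ DIM('a) * r j ^ DIM('a))))"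
    by (rule ennreal_mult[symmetric]) (use r_pos[of j] in auto)
  also have "?c * (unit_ball_vol DIM('a) * ((real B ^ j) ^ DIM('a) * r j ^ DIM('a))) = (w j)\<^sup>2"
  proof -
    have eq: "?c * r j ^ DIM('a) = K\<^sup>2 * r j powr \<beta>"
    proof -
      have "r j powr \<beta> = r j powr real DIM('a) * r j powr (-4) * r j powr (- 2 * \<gamma>)"
        by (simp add: beta(1) flip: powr_add)
      also have "\<dots> = r j ^ DIM('a) * (1 / (r j)\<^sup>2)\<^sup>2 * (r j powr (-\<gamma>))\<^sup>2"
      proof -
        have "r j powr (-4) = (1 / (r j)\<^sup>2)\<^sup>2"
          using r_pos[of j] powr_realpow[of "r j" 4] by (simp add: powr_minus divide_inverse power_inverse flip: power_mult)
        moreover have "r j powr (- 2 * \<gamma>) = (r j powr (-\<gamma>))\<^sup>2"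
          by (simp add: power2_eq_square flip: powr_add)
        ultimately show ?thesis using r_pos[of j] by (simp add: powr_realpow)
      qed
      finally show ?thesis by (simp only: power_mult_distrib mult_ac)
    qed
    have "?c * (unit_ball_vol DIM('a) * ((real B ^ j) ^ DIM('a) * r j ^ DIM('a)))
        = unit_ball_vol DIM('a) * (real B ^ j) ^ DIM('a) * (?c * r j ^ DIM('a))"
      by (simp only: mult_ac)
    also have "\<dots> = K\<^sup>2 * unit_ball_vol DIM('a) * ((real B ^ j) ^ DIM('a) * r j powr \<beta>)"
      unfolding eq by (simp only: mult_ac)
    also have "\<dots> = (w j)\<^sup>2"
    proof -
      have "(sqrt \<kappa> ^ j)\<^sup>2 = \<kappa> ^ j"
        using \<kappa> by (simp add: power2_eq_square flip: power_mult_distrib)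
      then show ?thesis unfolding ratio_pow w_def by (simp add: power_mult_distrib)
    qed
    finally show ?thesis .
  qed
  finally show ?thesis .
qed

lemma \<psi>_support: "x \<notin> cball 0 (3/8) \<Longrightarrow> \<psi> x = 0"
  using \<psi>(3) by auto

text \<open>The margin between 3/8 and 1/2 makes \<psi> a test function on the open ball of radius
  1/2, and this property is inherited by its derivatives.\<close>

lemma partial_\<psi>_support:
  assumes "norm x \<ge> 1/2"
  shows "b \<in> Basis \<Longrightarrow> partial b \<psi> x = 0" "b \<in> Basis \<Longrightarrow> partial b (partial b \<psi>) x = 0"
proof -
  have t: "\<psi> \<in> test_functions (ball 0 (1/2))"
    by (rule test_functionsI[OF \<psi>(1), of "cball 0 (3/8)"]) (auto intro: \<psi>_support)
  have "x \<notin> ball 0 (1/2)" using assms by simp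
  then show "b \<in> Basis \<Longrightarrow> partial b \<psi> x = 0" "b \<in> Basis \<Longrightarrow> partial b (partial b \<psi>) x = 0"
    using test_functionsD(2)[OF test_functions_partial[OF t]]
      test_functionsD(2)[OF test_functions_partial[OF test_functions_partial[OF t]]] by auto
qed

lemma smooth_\<phi>: "smooth (\<phi> j)"
  unfolding \<phi>_def[abs_def] by (intro smooth_mult smooth_const smooth_sum smooth_affine \<psi>)

lemma partial_scaled_sum:
  assumes "smooth f"
  shows "partial b (\<lambda>x. m * (\<Sum>i\<in>I j. f (\<xi> j i x)))
    = (\<lambda>x. (m * (1 / r j)) * (\<Sum>i\<in>I j. partial b f (\<xi> j i x)))"
proof -
  have pa: "partial b (\<lambda>x. f (\<xi> j i x)) x = (1 / r j) * partial b f (\<xi> j i x)" for i x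
    by (rule partial_affine[OF smooth_differentiable[OF assms]])
  have sm: "smooth (\<lambda>x. f (\<xi> j i x))" for i
    by (rule smooth_affine[OF assms])
  show ?thesis
    unfolding partial_cmult[OF smooth_sum[OF sm]] partial_sum[OF sm] pa
    by (simp only: mult.assoc sum_distrib_left)
qed

lemma grad_\<phi>: "grad (\<phi> j) x = (r j powr (-\<gamma>) * (1 / r j)) *\<^sub>R (\<Sum>i\<in>I j. grad \<psi> (\<xi> j i x))"
proof -
  have "grad (\<phi> j) x = (\<Sum>b\<in>Basis. \<Sum>i\<in>I j. ((r j powr (-\<gamma>) * (1 / r j)) * partial b \<psi> (\<xi> j i x)) *\<^sub>R b)"
    unfolding grad_def \<phi>_def[abs_def] partial_scaled_sum[OF \<psi>(1)]
    by (simp add: sum_distrib_left scaleR_sum_left)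
  also have "\<dots> = (\<Sum>i\<in>I j. \<Sum>b\<in>Basis. ((r j powr (-\<gamma>) * (1 / r j)) * partial b \<psi> (\<xi> j i x)) *\<^sub>R b)"
    by (rule sum.swap)
  finally show ?thesis by (simp add: grad_def scaleR_sum_right)
qed

lemma laplacian_\<phi>: "laplacian (\<phi> j) x = (r j powr (-\<gamma>) * (1 / r j) * (1 / r j)) * (\<Sum>i\<in>I j. laplacian \<psi> (\<xi> j i x))"
proof -
  have "laplacian (\<phi> j) x = (\<Sum>b\<in>Basis. (r j powr (-\<gamma>) * (1 / r j) * (1 / r j)) *
      (\<Sum>i\<in>I j. partial b (partial b \<psi>) (\<xi> j i x)))"
    unfolding laplacian_def \<phi>_def[abs_def] partial_scaled_sum[OF \<psi>(1)]
    by (intro sum.cong refl) (simp only: partial_scaled_sum[OF smooth_partial[OF \<psi>(1)]])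
  also have "\<dots> = (r j powr (-\<gamma>) * (1 / r j) * (1 / r j)) *
      (\<Sum>b\<in>Basis. \<Sum>i\<in>I j. partial b (partial b \<psi>) (\<xi> j i x))"
    by (simp only: sum_distrib_left)
  also have "(\<Sum>b\<in>Basis. \<Sum>i\<in>I j. partial b (partial b \<psi>) (\<xi> j i x))
      = (\<Sum>i\<in>I j. \<Sum>b\<in>Basis. partial b (partial b \<psi>) (\<xi> j i x))"
    by (rule sum.swap)
  finally show ?thesis by (simp add: laplacian_def)
qed

lemma \<phi>_bound: "\<bar>\<phi> j x\<bar> \<le> r j powr (-\<gamma>) * (K * indicator (S j) x)"
proof -
  have "norm (\<Sum>i\<in>I j. \<psi> (\<xi> j i x)) \<le> K * indicator (S j) x"
    by (rule norm_sum_bump_le) (use K \<psi> in auto)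
  then show ?thesis by (simp add: \<phi>_def abs_mult mult_left_mono)
qed

lemma r_le_inverse: "1 \<le> 1 / (r j)\<^sup>2" "1 / r j \<le> 1 / (r j)\<^sup>2"
proof -
  have "(r j)\<^sup>2 \<le> r j * 1" unfolding power2_eq_square using r_pos[of j] r_le1[of j] by (intro mult_left_mono) auto
  then show "1 \<le> 1 / (r j)\<^sup>2" "1 / r j \<le> 1 / (r j)\<^sup>2"
    using r_pos[of j] r_le1[of j] by (auto intro!: divide_left_mono simp: le_divide_eq)
qed

text \<open>Since \<open>r j \<le> 1\<close>, the scaling factors 1 of the values and
  \<open>1 / r j\<close> of the gradient are dominated by the factor
  \<open>1 / (r j)\<^sup>2\<close> of the Laplacian, so one \<open>w\<close> serves all
  three.\<close>

lemma square_bounds: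
  "(\<integral>\<^sup>+x. ennreal ((norm (\<phi> j x))\<^sup>2) \<partial>lborel) \<le> ennreal ((w j)\<^sup>2)"
  "(\<integral>\<^sup>+x. ennreal ((norm (grad (\<phi> j) x))\<^sup>2) \<partial>lborel) \<le> ennreal ((w j)\<^sup>2)"
  "(\<integral>\<^sup>+x. ennreal ((norm (laplacian (\<phi> j) x))\<^sup>2) \<partial>lborel) \<le> ennreal ((w j)\<^sup>2)"
proof -
  have nn: "0 \<le> K * indicator (S j) x" for x :: 'a using K(1) by simp
  show "(\<integral>\<^sup>+x. ennreal ((norm (\<phi> j x))\<^sup>2) \<partial>lborel) \<le> ennreal ((w j)\<^sup>2)"
  proof (rule square_bound)
    fix x
    have "norm (\<phi> j x) \<le> r j powr (-\<gamma>) * 1 * (K * indicator (S j) x)" using \<phi>_bound[of j x] by simp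
    also have "\<dots> \<le> r j powr (-\<gamma>) * (1 / (r j)\<^sup>2) * (K * indicator (S j) x)"
      by (intro mult_right_mono mult_left_mono r_le_inverse nn) simp
    finally show "norm (\<phi> j x) \<le> r j powr (-\<gamma>) * (1 / (r j)\<^sup>2) * (K * indicator (S j) x)" .
  qed
  show "(\<integral>\<^sup>+x. ennreal ((norm (grad (\<phi> j) x))\<^sup>2) \<partial>lborel) \<le> ennreal ((w j)\<^sup>2)"
  proof (rule square_bound)
    fix x
    have "norm (\<Sum>i\<in>I j. grad \<psi> (\<xi> j i x)) \<le> K * indicator (S j) x"
      by (rule norm_sum_bump_le) (simp_all only: K(3) real_norm_def, simp add: grad_def partial_\<psi>_support)
    then have "norm (grad (\<phi> j) x) \<le> r j powr (-\<gamma>) * (1 / r j) * (K * indicator (S j) x)"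
      unfolding grad_\<phi> using r_pos[of j] by (simp add: abs_mult divide_right_mono mult_left_mono)
    also have "\<dots> \<le> r j powr (-\<gamma>) * (1 / (r j)\<^sup>2) * (K * indicator (S j) x)"
      by (intro mult_right_mono mult_left_mono r_le_inverse nn) simp
    finally show "norm (grad (\<phi> j) x) \<le> r j powr (-\<gamma>) * (1 / (r j)\<^sup>2) * (K * indicator (S j) x)" .
  qed
  show "(\<integral>\<^sup>+x. ennreal ((norm (laplacian (\<phi> j) x))\<^sup>2) \<partial>lborel) \<le> ennreal ((w j)\<^sup>2)"
  proof (rule square_bound)
    fix x
    have "norm (\<Sum>i\<in>I j. laplacian \<psi> (\<xi> j i x)) \<le> K * indicator (S j) x"
      by (rule norm_sum_bump_le) (simp_all only: K(4) real_norm_def, simp add: laplacian_def partial_\<psi>_support)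
    then have "norm (laplacian (\<phi> j) x) \<le> r j powr (-\<gamma>) * (1 / r j) * (1 / r j) * (K * indicator (S j) x)"
      unfolding laplacian_\<phi> using r_pos[of j] by (simp add: abs_mult divide_right_mono mult_left_mono)
    then show "norm (laplacian (\<phi> j) x) \<le> r j powr (-\<gamma>) * (1 / (r j)\<^sup>2) * (K * indicator (S j) x)"
      by (simp add: power2_eq_square mult.assoc)
  qed
qed

lemma \<phi>_nonneg: "0 \<le> \<phi> j x"
  unfolding \<phi>_def by (intro mult_nonneg_nonneg sum_nonneg \<psi>) simp

lemma S_subset: "S j \<subseteq> ball p \<rho>"
proof
  fix x assume "x \<in> S j"
  then obtain i where i: "i \<in> I j" "dist (c j i) x < r j / 2" by (auto simp: S_def)
  have "dist p x \<le> dist p (c j i) + dist (c j i) x" by (rule dist_triangle)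
  also have "\<dots> < \<rho> / 8 + \<rho> / 2"
    using A_near_p[OF center_in[OF i(1)]] i(2) r_le[of j] by (simp add: dist_commute)
  finally show "x \<in> ball p \<rho>" using \<rho> by simp
qed

lemma \<phi>_support: "x \<notin> S j \<Longrightarrow> \<phi> j x = 0"
  using \<phi>_bound[of j x] by simp

lemma A_subset: "A \<subseteq> ball p \<rho>"
  using A_near_p \<rho> by (force simp: dist_commute)

text \<open>The point \<open>a\<close> is within \<open>r j / 8\<close> of a centre and
  \<open>x\<close> within \<open>r j / 8\<close> of \<open>a\<close>, so \<open>x\<close> lies where
  the bump at that centre is at least 1 before scaling its height.\<close>

lemma \<phi>_lower:
  assumes "a \<in> A" "dist x a \<le> r j / 8"
  shows "r j powr (-\<gamma>) \<le> \<phi> j x"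
proof -
  obtain i where i: "i \<in> I j" "dist a (c j i) \<le> r j / 8" using near_center[OF assms(1)] by blast
  have "norm (x - c j i) \<le> r j / 4"
    using dist_triangle[of x "c j i" a] assms(2) i(2) by (simp add: dist_norm)
  moreover have eq: "norm (\<xi> j i x) = norm (x - c j i) / r j" using r_pos[of j] by simp
  ultimately have "norm (\<xi> j i x) \<le> 1 / 4" unfolding eq using r_pos[of j] by (simp add: field_simps)
  then have "1 \<le> \<psi> (\<xi> j i x)" by (rule \<psi>)
  also have "\<dots> \<le> (\<Sum>i\<in>I j. \<psi> (\<xi> j i x))"
    by (rule member_le_sum[OF i(1)]) (auto intro: \<psi> finite_cantor_index)
  finally have "r j powr (-\<gamma>) * 1 \<le> \<phi> j x" unfolding \<phi>_def by (intro mult_left_mono) auto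
  then show ?thesis by simp
qed

text \<open>A single generation suffices: for the \<open>j\<close> with
  \<open>r (Suc j) / 8 < dist x a \<le> r j / 8\<close>, the radius \<open>r j\<close> is comparable
  to the distance up to the factor \<open>8 / \<mu>\<close>, and the bump height is
  \<open>r j powr (-\<gamma>)\<close>.\<close>

lemma \<phi>_power_lower:
  assumes "a \<in> A" "dist x a < \<rho> / 8" "x \<noteq> a"
  shows "\<exists>j. (8 / \<mu>) powr (-\<gamma>) * norm (x - a) powr (-\<gamma>) \<le> \<phi> j x"
proof -
  have pos: "norm (x - a) > 0" using assms by simp
  have "\<exists>n. \<mu> ^ n < 8 * norm (x - a) / \<rho>"
    using pos \<rho> \<mu>1 by (intro real_arch_pow_inv) auto
  then have "\<exists>n. r n / 8 < dist x a"
    using \<rho> by (auto simp: r_def dist_norm field_simps)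
  define n where "n = (LEAST n. r n / 8 < dist x a)"
  have n: "r n / 8 < dist x a" unfolding n_def by (rule LeastI_ex) fact
  \<comment> \<open>Since \<open>r 0 = \<rho>\<close>, the assumption on \<open>x\<close> excludes
    generation 0.\<close>
  have "n \<noteq> 0" using n assms(2) by (intro notI) (simp add: r_def)
  then obtain j where j: "n = Suc j" by (cases n) auto
  have le: "dist x a \<le> r j / 8"
    using not_less_Least[of j "\<lambda>n. r n / 8 < dist x a"] j unfolding n_def by (simp add: not_less)
  have "r j \<le> (8 / \<mu>) * norm (x - a)"
    using n j \<mu> by (simp add: r_def dist_norm field_simps)
  then have "((8 / \<mu>) * norm (x - a)) powr (-\<gamma>) \<le> r j powr (-\<gamma>)"
    using r_pos[of j] \<gamma> by (intro powr_mono2') auto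
  also have "\<dots> \<le> \<phi> j x" by (rule \<phi>_lower[OF assms(1) le])
  finally show ?thesis using \<mu> by (subst (asm) powr_mult) auto
qed

text \<open>\<open>E j\<close> consists of \<open>B ^ (j * DIM('a))\<close> balls, and
  \<open>r j\<close> to the power \<open>DIM('a) - 4\<close> is at most
  \<open>r j powr \<beta>\<close>. The covering sum is therefore of order
  \<open>\<kappa> ^ j\<close>.\<close>

lemma E_premeasure:
  assumes "\<epsilon> > 0"
  shows "\<exists>j. hausdorff_premeasure (real DIM('a) - 4) \<epsilon> (E j) \<le> ennreal \<epsilon>"
proof -
  let ?s = "real DIM('a) - 4"
  have lim: "(\<lambda>j. 2 powr ?s * (\<rho> powr \<beta> * \<kappa> ^ j)) \<longlonglongrightarrow> 2 powr ?s * (\<rho> powr \<beta> * 0)"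
    using \<kappa> by (intro tendsto_mult tendsto_const LIMSEQ_power_zero) auto
  have lim2: "(\<lambda>j. 2 * (\<rho> * \<mu> ^ j)) \<longlonglongrightarrow> 2 * (\<rho> * 0)"
    using \<mu> \<mu>1 by (intro tendsto_mult tendsto_const LIMSEQ_power_zero) auto
  have "\<forall>\<^sub>F j in sequentially. 2 powr ?s * (\<rho> powr \<beta> * \<kappa> ^ j) < \<epsilon> \<and> 2 * (\<rho> * \<mu> ^ j) < \<epsilon>"
    using order_tendstoD(2)[OF lim, of \<epsilon>] order_tendstoD(2)[OF lim2, of \<epsilon>] assms
    by (intro eventually_conj) auto
  then obtain j where j: "2 powr ?s * (\<rho> powr \<beta> * \<kappa> ^ j) < \<epsilon>" "2 * r j < \<epsilon>"
    by (auto simp: r_def eventually_sequentially)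
  have "hausdorff_premeasure ?s \<epsilon> (E j) \<le> ennreal (card (I j) * (2 * r j) powr ?s)"
    unfolding E_def using r_pos[of j] j(2)
    by (intro hausdorff_premeasure_Union_cball finite_cantor_index) auto
  also have "\<dots> \<le> ennreal \<epsilon>"
  proof (rule ennreal_leI)
    have "r j powr ?s \<le> r j powr \<beta>" using r_pos[of j] r_le1[of j] \<gamma> beta(1) by (intro powr_mono') auto
    then have "card (I j) * (2 * r j) powr ?s \<le> card (I j) * (2 powr ?s * r j powr \<beta>)"
      using r_pos[of j] by (simp add: powr_mult mult_left_mono)
    also have "\<dots> = 2 powr ?s * (\<rho> powr \<beta> * \<kappa> ^ j)"
      unfolding ratio_pow[symmetric] by (simp add: card_cantor_index)
    finally show "card (I j) * (2 * r j) powr ?s \<le> \<epsilon>" using j(1) by simp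
  qed
  finally show ?thesis by blast
qed

section \<open>Averages away from the Cantor set\<close>

text \<open>Bumps of generation \<open>j\<close> or later stay within
  \<open>(1/8 + 1/2) * r j\<close> of centres of generation \<open>j\<close>, whereas
  \<open>a\<close> is farther than \<open>r j\<close> from all of those.\<close>

lemma S_far_from_complement:
  assumes "a \<notin> E j" "j \<le> i" "x \<in> S i"
  shows "r j / 4 < dist a x"
proof -
  obtain k where k: "k \<in> I i" "dist (c i k) x < r i / 2" using assms(3) by (auto simp: S_def)
  obtain l where l: "l \<in> I j" "dist (c i k) (c j l) \<le> r j / 8"
    using near_center[OF center_in[OF k(1)]] by blast
  have "r j < dist (c j l) a" using assms(1) l(1) by (auto simp: E_def not_le)
  also have "\<dots> \<le> dist (c j l) x + dist x a" by (rule dist_triangle)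
  also have "dist (c j l) x \<le> dist (c j l) (c i k) + dist (c i k) x" by (rule dist_triangle)
  finally show ?thesis using k(2) l(2) r_mono[OF assms(2)] r_pos[of j] by (simp add: dist_commute)
qed

lemma \<phi>_measurable [measurable]: "\<phi> j \<in> borel_measurable borel"
  by (intro borel_measurable_continuous_onI smooth_continuous smooth_\<phi>)

text \<open>The integral of generation \<open>j\<close> is of order \<open>B ^ (j * DIM('a))\<close>
  times \<open>r j powr (DIM('a) - \<gamma>)\<close>. The exponent exceeds \<beta>, so the same
  ratio \<kappa> gives convergence.\<close>

lemma integral_sum_finite: "(\<integral>\<^sup>+x. (\<Sum>j. ennreal (\<phi> j x)) \<partial>lborel) < \<infinity>"
proof -
  let ?V = "unit_ball_vol (real DIM('a))"
  have le: "(\<integral>\<^sup>+x. ennreal (\<phi> j x) \<partial>lborel) \<le> ennreal (K * ?V * \<rho> powr \<beta> * \<kappa> ^ j)" for j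
  proof -
    have "(\<integral>\<^sup>+x. ennreal (\<phi> j x) \<partial>lborel) \<le> (\<integral>\<^sup>+x. ennreal (r j powr (-\<gamma>) * K) * indicator (S j) x \<partial>lborel)"
    proof (rule nn_integral_mono)
      show "ennreal (\<phi> j x) \<le> ennreal (r j powr (-\<gamma>) * K) * indicator (S j) x" for x
        using \<phi>_bound[of j x] \<phi>_support[of x j] by (cases "x \<in> S j") (auto intro!: ennreal_leI)
    qed
    also have "\<dots> = ennreal (r j powr (-\<gamma>) * K) * emeasure lborel (S j)"
      by (rule nn_integral_cmult_indicator) simp
    also have "\<dots> \<le> ennreal (r j powr (-\<gamma>) * K) * ennreal (?V * ((real B ^ j) ^ DIM('a) * r j ^ DIM('a)))"
      by (intro mult_left_mono emeasure_S) simp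
    also have "\<dots> = ennreal ((r j powr (-\<gamma>) * K) * (?V * ((real B ^ j) ^ DIM('a) * r j ^ DIM('a))))"
      by (rule ennreal_mult[symmetric]) (use r_pos[of j] K(1) in auto)
    also have "\<dots> \<le> ennreal (K * ?V * \<rho> powr \<beta> * \<kappa> ^ j)"
    proof (rule ennreal_leI)
      have "r j powr (-\<gamma>) * r j ^ DIM('a) = r j powr (real DIM('a) - \<gamma>)"
        using r_pos[of j] by (simp add: powr_realpow[symmetric] flip: powr_add)
      also have "\<dots> \<le> r j powr \<beta>" using r_pos[of j] r_le1[of j] \<gamma> beta(1) by (intro powr_mono') auto
      finally have "K * ?V * (real B ^ j) ^ DIM('a) * (r j powr (-\<gamma>) * r j ^ DIM('a))
          \<le> K * ?V * (real B ^ j) ^ DIM('a) * r j powr \<beta>"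
        using K(1) by (intro mult_left_mono) auto
      also have "\<dots> = K * ?V * \<rho> powr \<beta> * \<kappa> ^ j"
        by (simp only: mult.assoc ratio_pow)
      finally show "(r j powr (-\<gamma>) * K) * (?V * ((real B ^ j) ^ DIM('a) * r j ^ DIM('a)))
          \<le> K * ?V * \<rho> powr \<beta> * \<kappa> ^ j" by (simp add: mult_ac)
    qed
    finally show ?thesis .
  qed
  have sm: "summable (\<lambda>j. K * ?V * \<rho> powr \<beta> * \<kappa> ^ j)"
    using \<kappa> by (intro summable_mult summable_geometric) simp
  have "(\<integral>\<^sup>+x. (\<Sum>j. ennreal (\<phi> j x)) \<partial>lborel) = (\<Sum>j. \<integral>\<^sup>+x. ennreal (\<phi> j x) \<partial>lborel)"
    by (rule nn_integral_suminf) simp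
  also have "\<dots> \<le> (\<Sum>j. ennreal (K * ?V * \<rho> powr \<beta> * \<kappa> ^ j))"
    by (intro suminf_le le) auto
  also have "\<dots> = ennreal (\<Sum>j. K * ?V * \<rho> powr \<beta> * \<kappa> ^ j)"
    using K(1) \<kappa> by (intro suminf_ennreal2 sm) auto
  finally show ?thesis by (rule order.strict_trans1) simp
qed

text \<open>A ball of radius at most \<open>r j / 4\<close> about a point outside \<open>E j\<close>
  meets only the generations before \<open>j\<close>, which are bounded by \<open>M1\<close>. A
  larger ball has volume at least \<open>v\<close>, so its average is at most the total integral
  divided by \<open>v\<close>.\<close>

lemma average_bound:
  "\<exists>M\<ge>0. \<forall>a R. a \<notin> E j \<longrightarrow> R > 0 \<longrightarrow>
     ball_integral (\<lambda>x. \<Sum>i. ennreal (\<phi> i x)) a R \<le> ennreal M * emeasure lborel (ball a R)"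
proof -
  define T where "T = enn2real (\<integral>\<^sup>+x. (\<Sum>j. ennreal (\<phi> j x)) \<partial>lborel)"
  have T: "(\<integral>\<^sup>+x. (\<Sum>j. ennreal (\<phi> j x)) \<partial>lborel) = ennreal T"
    unfolding T_def using integral_sum_finite by simp
  define v where "v = unit_ball_vol (real DIM('a)) * (r j / 4) ^ DIM('a)"
  have v: "v > 0" using r_pos[of j] by (simp add: v_def)
  define M1 where "M1 = (\<Sum>i<j. r i powr (-\<gamma>) * K)"
  have M1: "M1 \<ge> 0" using K(1) by (auto simp: M1_def intro!: sum_nonneg)
  have T0: "T \<ge> 0" by (simp add: T_def)
  have "ball_integral (\<lambda>x. \<Sum>i. ennreal (\<phi> i x)) a R \<le> ennreal (M1 + T / v) * emeasure lborel (ball a R)"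
    if a: "a \<notin> E j" and R: "R > 0" for a R
  proof (cases "R \<le> r j / 4")
    case True
    have "ball_integral (\<lambda>x. \<Sum>i. ennreal (\<phi> i x)) a R
        \<le> (\<integral>\<^sup>+x. ennreal (M1 + T / v) * indicator (ball a R) x \<partial>lborel)"
    proof (rule nn_integral_mono)
      fix x
      show "(\<Sum>i. ennreal (\<phi> i x)) * indicator (ball a R) x \<le> ennreal (M1 + T / v) * indicator (ball a R) x"
      proof (cases "x \<in> ball a R")
        case xin: True
        have "\<phi> i x = 0" if "i \<notin> {..<j}" for i
          using S_far_from_complement[OF a, of i x] that xin True
          by (intro \<phi>_support notI) auto
        then have "(\<Sum>i. ennreal (\<phi> i x)) = (\<Sum>i<j. ennreal (\<phi> i x))"
          by (intro suminf_finite) auto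
        also have "\<dots> = ennreal (\<Sum>i<j. \<phi> i x)" by (intro sum_ennreal \<phi>_nonneg)
        also have "\<dots> \<le> ennreal (M1 + T / v)"
        proof (rule ennreal_leI)
          have "\<phi> i x \<le> r i powr (-\<gamma>) * K" for i
          proof -
            have "\<phi> i x \<le> r i powr (-\<gamma>) * (K * indicator (S i) x)" using \<phi>_bound[of i x] by simp
            also have "\<dots> \<le> r i powr (-\<gamma>) * K"
              using K(1) by (intro mult_left_mono) (auto split: split_indicator)
            finally show ?thesis .
          qed
          then have "(\<Sum>i<j. \<phi> i x) \<le> M1" unfolding M1_def by (intro sum_mono)
          also have "\<dots> \<le> M1 + T / v" using T0 v by simp
          finally show "(\<Sum>i<j. \<phi> i x) \<le> M1 + T / v" .
        qed
        finally show ?thesis using xin by simp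
      qed simp
    qed
    also have "\<dots> = ennreal (M1 + T / v) * emeasure lborel (ball a R)"
      by (rule nn_integral_cmult_indicator) simp
    finally show ?thesis .
  next
    case False
    have "ball_integral (\<lambda>x. \<Sum>i. ennreal (\<phi> i x)) a R \<le> (\<integral>\<^sup>+x. (\<Sum>i. ennreal (\<phi> i x)) \<partial>lborel)"
      by (intro nn_integral_mono) (auto split: split_indicator)
    also have "\<dots> = ennreal (T / v * v)" using v by (simp add: T)
    also have "\<dots> = ennreal (T / v) * ennreal v"
      using T0 v by (intro ennreal_mult) auto
    also have "\<dots> \<le> ennreal (M1 + T / v) * emeasure lborel (ball a R)"
    proof (intro mult_mono ennreal_leI)
      show "ennreal v \<le> emeasure lborel (ball a R)"
        unfolding v_def using False r_pos[of j] R
        by (subst emeasure_ball) (auto intro!: ennreal_leI mult_left_mono power_mono)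
    qed (use M1 in auto)
    finally show ?thesis .
  qed
  then show ?thesis using M1 T0 v by (intro exI[of _ "M1 + T / v"]) auto
qed

end

section \<open>Choice of the parameters\<close>

lemma exists_bounded_bump:
  "\<exists>(\<psi> :: 'a::euclidean_space \<Rightarrow> real) K. smooth \<psi> \<and> (\<forall>x. \<psi> x \<ge> 0) \<and>
     (\<forall>x. norm x \<ge> 3/8 \<longrightarrow> \<psi> x = 0) \<and> (\<forall>x. norm x \<le> 1/4 \<longrightarrow> \<psi> x \<ge> 1) \<and>
     K > 0 \<and> (\<forall>x. \<bar>\<psi> x\<bar> \<le> K) \<and> (\<forall>x. norm (grad \<psi> x) \<le> K) \<and> (\<forall>x. \<bar>laplacian \<psi> x\<bar> \<le> K)"
proof -
  obtain \<psi> :: "'a \<Rightarrow> real" where \<psi>: "smooth \<psi>" "\<And>x. \<psi> x \<ge> 0"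
    "\<And>x. norm x \<ge> 3/8 \<Longrightarrow> \<psi> x = 0" "\<And>x. norm x \<le> 1/4 \<Longrightarrow> \<psi> x \<ge> 1"
    using exists_bump by blast
  have t: "\<psi> \<in> test_functions (ball 0 1)"
    by (rule test_functionsI[OF \<psi>(1), of "cball 0 (3/8)"]) (auto intro: \<psi>)
  have c: "continuous_on UNIV (partial b \<psi>)" "continuous_on UNIV (partial b (partial b \<psi>))"
    if "b \<in> Basis" for b
    using that by (intro smooth_continuous smooth_partial \<psi>; simp)+
  have 1: "continuous_on UNIV (\<lambda>x. norm (grad \<psi> x))"
    unfolding grad_def by (intro continuous_on_norm continuous_on_sum continuous_on_scaleR c continuous_on_const)
  have 2: "continuous_on UNIV (laplacian \<psi>)"
    unfolding laplacian_def[abs_def] by (intro continuous_on_sum c)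
  have z: "\<psi> x = 0" "norm (grad \<psi> x) = 0" "laplacian \<psi> x = 0" if "norm x > 1" for x
  proof -
    have x: "x \<notin> ball 0 1" using that by simp
    show "\<psi> x = 0" "norm (grad \<psi> x) = 0"
      using test_functionsD(2)[OF t x] grad_zero_outside[OF t x] by simp_all
    show "laplacian \<psi> x = 0"
      unfolding laplacian_def
      by (intro sum.neutral ballI test_functionsD(2)[OF _ x] test_functions_partial t)
  qed
  obtain K0 where K0: "K0 > 0" "\<And>x. \<bar>\<psi> x\<bar> \<le> K0"
    using bounded_support_bound[OF smooth_continuous[OF \<psi>(1)] z(1)] by blast
  obtain K1 where K1: "K1 > 0" "\<And>x. \<bar>norm (grad \<psi> x)\<bar> \<le> K1"
    using bounded_support_bound[OF 1 z(2)] by blast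
  obtain K2 where K2: "K2 > 0" "\<And>x. \<bar>laplacian \<psi> x\<bar> \<le> K2"
    using bounded_support_bound[OF 2 z(3)] by blast
  define K where "K = K0 + K1 + K2"
  have "K > 0" "\<bar>\<psi> x\<bar> \<le> K" "norm (grad \<psi> x) \<le> K" "\<bar>laplacian \<psi> x\<bar> \<le> K" for x
    using K0(1) K1(1) K2(1) K0(2)[of x] K1(2)[of x] K2(2)[of x] by (auto simp: K_def)
  with \<psi> show ?thesis by (intro exI[of _ \<psi>] exI[of _ K]) simp
qed

text \<open>Dimension \<open>d\<close> dictates \<open>\<mu> = B powr (-\<tau>)\<close> with
  \<open>\<tau> = N / d > 1\<close>. Then \<open>B * \<mu> = B powr (1 - \<tau>)\<close> becomes as
  small as desired for large \<open>B\<close>, and the ratio is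
  \<open>B powr (N - \<tau> * \<beta>)\<close>, which is below 1 exactly when
  \<open>\<beta> > d\<close>.\<close>

lemma exists_singular_block:
  fixes p :: "'a::euclidean_space" and d :: real
  assumes N: "DIM('a) \<ge> 5" and \<rho>: "0 < \<rho>" "\<rho> \<le> 1" and d: "0 < d" "d < real DIM('a) - 4"
  shows "\<exists>B \<mu> \<gamma> \<beta> K (\<psi> :: 'a \<Rightarrow> real) (\<theta> :: real). singular_block B \<mu> \<rho> \<gamma> \<beta> K \<psi> \<and>
     \<theta> > 0 \<and> \<mu> powr \<theta> = 1 / real B \<and> DIM('a) * \<theta> = d"
proof -
  define N where "N = real DIM('a)"
  define \<tau> where "\<tau> = N / d"
  have N0: "N > 0" "d < N - 4" using N d by (simp_all add: N_def)
  have \<tau>: "\<tau> > 1" using d N0 by (simp add: \<tau>_def)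
  \<comment> \<open>This size of \<open>B\<close> makes \<open>B * \<mu>\<close> at most
    \<open>1 / (16 * N)\<close>; together with \<open>1 - B * \<mu> \<ge> 1/2\<close> it gives the
    bound 1/8 required by \<open>small\<close>.\<close>
  obtain n where n: "(16 * N) powr (1 / (\<tau> - 1)) \<le> real n" using real_arch_simple by blast
  define B where "B = max n 2"
  have B: "B \<ge> 2" "(16 * N) powr (1 / (\<tau> - 1)) \<le> real B" using n by (auto simp: B_def)
  define \<mu> where "\<mu> = real B powr (-\<tau>)"
  have \<mu>: "\<mu> > 0" using B by (simp add: \<mu>_def)
  have q_eq: "B * \<mu> = real B powr (1 - \<tau>)"
    using B by (simp add: \<mu>_def powr_diff powr_minus divide_inverse)
  have "16 * N = ((16 * N) powr (1 / (\<tau> - 1))) powr (\<tau> - 1)"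
    using \<tau> N0 by (simp add: powr_powr)
  also have "\<dots> \<le> real B powr (\<tau> - 1)"
    using \<tau> B by (intro powr_mono2) auto
  finally have "16 * N \<le> real B powr (\<tau> - 1)" .
  then have "inverse (real B powr (\<tau> - 1)) \<le> inverse (16 * N)"
    by (rule le_imp_inverse_le) (use N0 in simp)
  moreover have "real B powr (1 - \<tau>) = inverse (real B powr (\<tau> - 1))"
    by (simp flip: powr_minus)
  ultimately have "real B powr (1 - \<tau>) \<le> inverse (16 * N)"
    by simp
  then have q: "B * \<mu> * (16 * N) \<le> 1" unfolding q_eq using N0 by (simp add: field_simps)
  have N5: "N \<ge> 5" using N by (simp add: N_def)
  have q0: "B * \<mu> > 0" using B \<mu> by simp
  \<comment> \<open>From \<open>N \<ge> 5\<close>; it keeps \<open>B * \<mu>\<close> below 1/2, so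
    the denominator \<open>1 - B * \<mu>\<close> is harmless.\<close>
  have q80: "B * \<mu> * 80 \<le> 1"
  proof -
    have "B * \<mu> * 80 \<le> B * \<mu> * (16 * N)" using q0 N5 by (intro mult_left_mono) auto
    then show ?thesis using q by linarith
  qed
  \<comment> \<open>A quarter of the gap places \<beta> halfway between \<open>d\<close> and
    \<open>N - 4\<close>.\<close>
  define \<gamma> where "\<gamma> = (N - 4 - d) / 4"
  define \<beta> where "\<beta> = N - 4 - 2 * \<gamma>"
  have \<beta>: "\<beta> > d" using N0 by (simp add: \<beta>_def \<gamma>_def field_simps)
  obtain \<psi> :: "'a \<Rightarrow> real" and K where \<psi>: "smooth \<psi>" "\<And>x. \<psi> x \<ge> 0"
    "\<And>x. norm x \<ge> 3/8 \<Longrightarrow> \<psi> x = 0" "\<And>x. norm x \<le> 1/4 \<Longrightarrow> \<psi> x \<ge> 1"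
    and K: "K > 0" "\<And>x. \<bar>\<psi> x\<bar> \<le> K" "\<And>x. norm (grad \<psi> x) \<le> K" "\<And>x. \<bar>laplacian \<psi> x\<bar> \<le> K"
    using exists_bounded_bump by metis
  have "singular_block B \<mu> \<rho> \<gamma> \<beta> K \<psi>"
  proof unfold_locales
    show "real B * \<mu> < 1" using q80 q0 by linarith
    have "N * (B * \<mu> / (1 - B * \<mu>)) \<le> N * (B * \<mu> / (1 / 2))"
      using q80 q0 N0 by (intro mult_left_mono divide_left_mono) auto
    also have "\<dots> = B * \<mu> * (16 * N) / 8" by simp
    also have "\<dots> \<le> 1 / 8" using q by (rule divide_right_mono) simp
    finally show "real DIM('a) * (real B * \<mu> / (1 - real B * \<mu>)) \<le> 1 / 8" by (simp add: N_def)
    show "\<beta> = real DIM('a) - 4 - 2 * \<gamma>" by (simp add: \<beta>_def N_def)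
    have "real B ^ DIM('a) * \<mu> powr \<beta> = real B powr (N - \<tau> * \<beta>)"
    proof -
      have "\<mu> powr \<beta> = real B powr (- \<tau> * \<beta>)" unfolding \<mu>_def by (rule powr_powr)
      moreover have "real B ^ DIM('a) = real B powr N" using B by (simp add: N_def powr_realpow)
      ultimately show ?thesis by (simp flip: powr_add)
    qed
    also have "\<dots> < 1"
    proof -
      have "\<tau> * d < \<tau> * \<beta>" using \<beta> \<tau> by (intro mult_strict_left_mono) auto
      then have "N - \<tau> * \<beta> < 0" using d by (simp add: \<tau>_def)
      then show ?thesis using B powr_less_mono[of "N - \<tau> * \<beta>" 0 "real B"] by simp
    qed
    finally show "real B ^ DIM('a) * \<mu> powr \<beta> < 1" .
  qed (use B \<mu> \<rho> \<beta> d N0 \<psi> K in \<open>auto simp: \<gamma>_def\<close>)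
  \<comment> \<open>The inverse Hoelder exponent \<theta> is \<open>d / N\<close>, so the covering
    bound by volumes has exponent \<open>N * \<theta> = d\<close>.\<close>
  moreover have "\<mu> powr (d / N) = 1 / real B"
  proof -
    have "\<mu> powr (d / N) = real B powr (- \<tau> * (d / N))" unfolding \<mu>_def by (rule powr_powr)
    also have "- \<tau> * (d / N) = -1" using d N0 by (simp add: \<tau>_def)
    finally show ?thesis using B by (simp add: powr_minus divide_inverse)
  qed
  moreover have "d / N > 0" "DIM('a) * (d / N) = d" using d N0 by (auto simp: N_def)
  ultimately show ?thesis
    by - (rule exI[of _ B], rule exI[of _ \<mu>], rule exI[of _ \<gamma>], rule exI[of _ \<beta>], rule exI[of _ K],
        rule exI[of _ \<psi>], rule exI[of _ "d / N"], intro conjI)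
qed

text \<open>The interface to a block. It hides \<open>B\<close>, \<mu>, \<rho> and the bump, which
  vary from family to family, so that countably many families can be superposed.\<close>

locale singular_family =
  fixes d :: real and \<Omega> A :: "'a::euclidean_space set" and E :: "nat \<Rightarrow> 'a set"
    and \<phi> :: "nat \<Rightarrow> 'a \<Rightarrow> real" and w :: "nat \<Rightarrow> real"
  assumes subset: "A \<subseteq> \<Omega>"
    and test: "\<phi> j \<in> test_functions \<Omega>"
    and nonneg: "0 \<le> \<phi> j x"
    and w_pos: "w j > 0"
    and w_summable: "summable w"
    and value_bound: "(\<integral>\<^sup>+x. ennreal ((norm (\<phi> j x))\<^sup>2) \<partial>lborel) \<le> ennreal ((w j)\<^sup>2)"
    and grad_bound: "(\<integral>\<^sup>+x. ennreal ((norm (grad (\<phi> j) x))\<^sup>2) \<partial>lborel) \<le> ennreal ((w j)\<^sup>2)"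
    and laplacian_bound: "(\<integral>\<^sup>+x. ennreal ((norm (laplacian (\<phi> j) x))\<^sup>2) \<partial>lborel) \<le> ennreal ((w j)\<^sup>2)"
    and blow_up: "\<exists>C>0. \<exists>\<gamma>>0. \<exists>r>0. \<forall>a\<in>A. \<forall>x\<in>ball a r. x \<noteq> a \<longrightarrow>
      (\<exists>j. C * norm (x - a) powr (-\<gamma>) \<le> \<phi> j x)"
    and cover_bound: "\<exists>K>0. \<forall>U::nat \<Rightarrow> 'a set. A \<subseteq> (\<Union>i. U i) \<longrightarrow> (\<forall>i. bounded (U i)) \<longrightarrow>
      1 \<le> (\<Sum>i. ennreal (K * diameter (U i) powr d))"
    and small_stage: "\<epsilon> > 0 \<Longrightarrow> \<exists>j. hausdorff_premeasure (real DIM('a) - 4) \<epsilon> (E j) \<le> ennreal \<epsilon>"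
    and average: "\<exists>M\<ge>0. \<forall>a R. a \<notin> E j \<longrightarrow> R > 0 \<longrightarrow>
      ball_integral (\<lambda>x. \<Sum>i. ennreal (\<phi> i x)) a R \<le> ennreal M * emeasure lborel (ball a R)"

lemma exists_singular_family:
  fixes p :: "'a::euclidean_space" and d :: real
  assumes N: "DIM('a) \<ge> 5" and \<Omega>: "open \<Omega>" "p \<in> \<Omega>" and d: "0 < d" "d < real DIM('a) - 4"
  shows "\<exists>A E \<phi> w. p \<in> A \<and> singular_family d \<Omega> A E \<phi> w"
proof -
  obtain \<rho>0 where \<rho>0: "\<rho>0 > 0" "cball p \<rho>0 \<subseteq> \<Omega>" using \<Omega> open_contains_cball by blast
  define \<rho> where "\<rho> = min \<rho>0 1"
  have rad: "0 < \<rho>" "\<rho> \<le> 1" "cball p \<rho> \<subseteq> \<Omega>"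
    using \<rho>0 subset_cball[of \<rho> \<rho>0 p] by (auto simp: \<rho>_def)
  obtain B \<mu> \<gamma> \<beta> K and \<psi> :: "'a \<Rightarrow> real" and \<theta> :: real where
    blk: "singular_block B \<mu> \<rho> \<gamma> \<beta> K \<psi>" and \<theta>: "\<theta> > 0" "\<mu> powr \<theta> = 1 / real B" "DIM('a) * \<theta> = d"
    using exists_singular_block[OF N rad(1,2) d] by blast
  interpret singular_block B \<mu> p \<rho> \<gamma> \<beta> K \<psi> by (rule blk)
  have sub: "ball p \<rho> \<subseteq> \<Omega>" using rad(3) ball_subset_cball by blast
  have "singular_family d \<Omega> A E \<phi> w"
  proof
    show "A \<subseteq> \<Omega>" using A_subset sub by (rule order_trans)
    show "\<phi> j \<in> test_functions \<Omega>" for j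
    proof (rule test_functionsI[OF smooth_\<phi>])
      show "\<phi> j x = 0" if "x \<notin> cball p \<rho>" for x
      proof (rule \<phi>_support)
        show "x \<notin> S j" using that S_subset[of j] ball_subset_cball[of p \<rho>] by (meson subsetD)
      qed
    qed (use rad(3) in auto)
    show "\<exists>C>0. \<exists>\<gamma>>0. \<exists>r>0. \<forall>a\<in>A. \<forall>x\<in>ball a r. x \<noteq> a \<longrightarrow> (\<exists>j. C * norm (x - a) powr (-\<gamma>) \<le> \<phi> j x)"
    proof -
      have "\<forall>a\<in>A. \<forall>x\<in>ball a (\<rho> / 8). x \<noteq> a \<longrightarrow>
          (\<exists>j. (8 / \<mu>) powr (-\<gamma>) * norm (x - a) powr (-\<gamma>) \<le> \<phi> j x)"
        by (intro ballI impI \<phi>_power_lower) (auto simp: dist_commute)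
      moreover have "(8 / \<mu>) powr (-\<gamma>) > 0" "\<rho> / 8 > 0" using \<mu> rad by auto
      ultimately show ?thesis using \<gamma> by meson
    qed
    show "\<exists>K>0. \<forall>U::nat \<Rightarrow> 'a set. A \<subseteq> (\<Union>i. U i) \<longrightarrow> (\<forall>i. bounded (U i)) \<longrightarrow>
        1 \<le> (\<Sum>i. ennreal (K * diameter (U i) powr d))"
    proof -
      define k where "k = (2 * B / \<rho> powr \<theta>) ^ DIM('a)"
      have "k > 0" using B rad by (simp add: k_def)
      moreover have "1 \<le> (\<Sum>i. ennreal (k * diameter (U i) powr d))"
        if U: "A \<subseteq> (\<Union>i. U i)" "\<forall>i. bounded (U i)" for U :: "nat \<Rightarrow> 'a set"
      proof -
        have "cantor_map p \<rho> ` unit_cube \<subseteq> (\<Union>i. U i)" using U(1) by (simp only: A_def)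
        from cantor_cover_lower_bound[OF \<theta>(1,2) rad(1) this] U(2) show ?thesis
          unfolding k_def \<theta>(3) by blast
      qed
      ultimately show ?thesis by blast
    qed
  qed (use \<phi>_nonneg w square_bounds E_premeasure average_bound in auto)
  with p_in_A show ?thesis by blast
qed

section \<open>Criterion for regular points and Hausdorff estimates\<close>

lemma AE_lebesgue_on_iff:
  "S \<in> sets lebesgue \<Longrightarrow> (AE x in lebesgue_on S. P x) \<longleftrightarrow> (AE x in lebesgue. x \<in> S \<longrightarrow> P x)"
  by (rule AE_restrict_space_iff) simp

text \<open>At a singular point \<open>u\<close> is at least \<open>C * R powr (-\<gamma>)\<close>
  almost everywhere in the ball of radius \<open>R\<close>, so its averages tend to infinity with
  \<open>R\<close> tending to 0. The majorant \<open>U\<close> has values in \<open>ennreal\<close>,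
  hence its averages are defined whether or not it is integrable.\<close>

lemma not_Sing_of_average_bound:
  assumes U [measurable]: "U \<in> borel_measurable borel" and uU: "\<And>x. ennreal (u x) \<le> U x"
    and R0: "R0 > 0" and M: "M \<ge> 0"
    and avg: "\<And>R. 0 < R \<Longrightarrow> R \<le> R0 \<Longrightarrow>
      ball_integral U a R \<le> ennreal M * emeasure lborel (ball a R)"
  shows "a \<notin> Sing \<Omega> (\<lambda>x. ereal (u x))"
proof
  assume "a \<in> Sing \<Omega> (\<lambda>x. ereal (u x))"
  then obtain C \<gamma> r where C: "C > 0" "\<gamma> > 0" "r > 0"
    and ae: "AE x in lebesgue_on (ball a r). C * norm (x - a) powr (-\<gamma>) \<le> u x"
    by (auto simp: Sing_def)
  \<comment> \<open>The last term solves \<open>C * R powr (-\<gamma>) = M + 1\<close>.\<close>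
  define R where "R = min (min r R0) (((M + 1) / C) powr (-1/\<gamma>))"
  have R: "0 < R" "R \<le> r" "R \<le> R0" "R \<le> ((M + 1) / C) powr (-1/\<gamma>)"
    using C R0 M by (auto simp: R_def)
  have "(((M + 1) / C) powr (-1/\<gamma>)) powr (-\<gamma>) \<le> R powr (-\<gamma>)"
    using R C by (intro powr_mono2') auto
  then have "(M + 1) / C \<le> R powr (-\<gamma>)"
    using C M by (simp add: powr_powr)
  then have big: "M + 1 \<le> C * R powr (-\<gamma>)" using C by (simp add: field_simps)
  define v where "v = unit_ball_vol (real DIM('a)) * R ^ DIM('a)"
  have v: "v > 0" "emeasure lborel (ball a R) = ennreal v"
    using R by (simp_all add: v_def emeasure_ball)
  have ae1: "AE x in lebesgue. x \<in> ball a r \<longrightarrow> C * norm (x - a) powr (-\<gamma>) \<le> u x"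
    using ae by (subst (asm) AE_lebesgue_on_iff) auto
  have ae2: "AE x in lebesgue. x \<noteq> a"
    by (rule AE_completion) (rule AE_lborel_singleton)
  have "ennreal (M + 1) * ennreal v = (\<integral>\<^sup>+x. ennreal (M + 1) * indicator (ball a R) x \<partial>lebesgue)"
    by (simp add: v(2) nn_integral_cmult_indicator)
  also have "\<dots> \<le> (\<integral>\<^sup>+x. U x * indicator (ball a R) x \<partial>lebesgue)"
  proof (rule nn_integral_mono_AE)
    show "AE x in lebesgue. ennreal (M + 1) * indicator (ball a R) x \<le> U x * indicator (ball a R) x"
      using ae1 ae2
    proof eventually_elim
      case (elim x)
      show ?case
      proof (cases "x \<in> ball a R")
        case True
        then have n: "norm (x - a) \<le> R" "0 < norm (x - a)"
          using elim by (auto simp: dist_norm norm_minus_commute)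
        have "M + 1 \<le> C * R powr (-\<gamma>)" by (rule big)
        also have "\<dots> \<le> C * norm (x - a) powr (-\<gamma>)"
          using n C by (intro mult_left_mono powr_mono2') auto
        also have "\<dots> \<le> u x" using elim True R(2) by auto
        finally have "ennreal (M + 1) \<le> ennreal (u x)" by (rule ennreal_leI)
        also have "\<dots> \<le> U x" by (rule uU)
        finally show ?thesis using True by simp
      qed simp
    qed
  qed
  also have "\<dots> = ball_integral U a R"
    by (rule nn_integral_completion)
  also have "\<dots> \<le> ennreal M * ennreal v" unfolding v(2)[symmetric] by (rule avg[OF R(1,3)])
  finally have "ennreal ((M + 1) * v) \<le> ennreal (M * v)"
    using M v(1) by (simp add: ennreal_mult)
  then have "(M + 1) * v \<le> M * v" using M v(1) by (subst (asm) ennreal_le_iff) auto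
  then show False using v(1) by (simp add: algebra_simps)
qed

lemma nn_integral_lebesgue_on_le:
  fixes f :: "'a::euclidean_space \<Rightarrow> ennreal"
  assumes "open \<Omega>"
  shows "(\<integral>\<^sup>+x. f x \<partial>lebesgue_on \<Omega>) \<le> (\<integral>\<^sup>+x. f x \<partial>lborel)"
proof -
  have "(\<integral>\<^sup>+x. f x \<partial>lebesgue_on \<Omega>) = (\<integral>\<^sup>+x. f x * indicator \<Omega> x \<partial>lebesgue)"
    using assms by (intro nn_integral_restrict_space) auto
  also have "\<dots> \<le> (\<integral>\<^sup>+x. f x \<partial>lebesgue)"
    by (intro nn_integral_mono) (auto split: split_indicator)
  finally show ?thesis by (simp add: nn_integral_completion)
qed

lemma hausdorff_premeasure_antimono_scale:
  "\<delta> \<le> \<epsilon> \<Longrightarrow> hausdorff_premeasure s \<epsilon> S \<le> hausdorff_premeasure s \<delta> S"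
  unfolding hausdorff_premeasure_def by (rule INF_superset_mono) (auto intro: order_trans)

lemma zero_C2_Holder_loc: "(\<lambda>x. 0) \<in> C2_Holder_loc \<alpha> S"
  by (auto simp: C2_Holder_loc_def numeral_2_eq_2 intro: exI[of _ 0])

lemma test_functions_scale:
  assumes "\<phi> \<in> test_functions \<Omega>'" "\<Omega>' \<subseteq> \<Omega>"
  shows "(\<lambda>x. m * \<phi> x) \<in> test_functions \<Omega>"
proof (rule test_functionsI[of _ "closure {x. \<phi> x \<noteq> 0}"])
  show "smooth (\<lambda>x. m * \<phi> x)" by (intro smooth_mult smooth_const test_functionsD(1)[OF assms(1)])
  show "m * \<phi> x = 0" if "x \<notin> closure {x. \<phi> x \<noteq> 0}" for x
    using zero_outside_support[OF that] by simp
qed (use assms in \<open>auto simp: test_functions_def\<close>)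

lemma grad_scale: "smooth f \<Longrightarrow> grad (\<lambda>x. m * f x) x = m *\<^sub>R grad f x"
  by (simp add: grad_def partial_cmult scaleR_sum_right)

lemma laplacian_scale: "smooth f \<Longrightarrow> laplacian (\<lambda>x. m * f x) x = m * laplacian f x"
  by (simp add: laplacian_def partial_cmult smooth_partial sum_distrib_left)

lemma nn_integral_norm_square_scale:
  fixes f :: "'a::euclidean_space \<Rightarrow> 'b::real_normed_vector"
  assumes "open \<Omega>" and f: "f \<in> borel_measurable borel" and "0 \<le> w"
    and le: "(\<integral>\<^sup>+x. ennreal ((norm (f x))\<^sup>2) \<partial>lborel) \<le> ennreal (w\<^sup>2)"
  shows "(\<integral>\<^sup>+x. ennreal ((norm (m *\<^sub>R f x))\<^sup>2) \<partial>lebesgue_on \<Omega>) \<le> ennreal ((m * w)\<^sup>2)"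
proof -
  have "(\<integral>\<^sup>+x. ennreal ((norm (m *\<^sub>R f x))\<^sup>2) \<partial>lebesgue_on \<Omega>)
      \<le> (\<integral>\<^sup>+x. ennreal ((norm (m *\<^sub>R f x))\<^sup>2) \<partial>lborel)"
    by (rule nn_integral_lebesgue_on_le[OF assms(1)])
  also have "\<dots> = (\<integral>\<^sup>+x. ennreal (m\<^sup>2) * ennreal ((norm (f x))\<^sup>2) \<partial>lborel)"
    by (simp add: power_mult_distrib ennreal_mult)
  also have "\<dots> = ennreal (m\<^sup>2) * (\<integral>\<^sup>+x. ennreal ((norm (f x))\<^sup>2) \<partial>lborel)"
    using f by (intro nn_integral_cmult) simp
  also have "\<dots> \<le> ennreal (m\<^sup>2) * ennreal (w\<^sup>2)" by (intro mult_left_mono le) simp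
  finally show ?thesis by (simp add: power_mult_distrib ennreal_mult)
qed

text \<open>A null set would have covers with arbitrarily small sums of exponent \<open>s\<close>.
  At scale 1 all diameters are at most 1, so the sums with the larger exponent \<open>d\<close> are
  no larger, which contradicts the bound from below.\<close>

lemma hausdorff_measure_pos_of_cover_bound:
  fixes A :: "'a::euclidean_space set"
  assumes K: "K > 0" "\<And>U::nat \<Rightarrow> 'a set. A \<subseteq> (\<Union>i. U i) \<Longrightarrow> (\<And>i. bounded (U i)) \<Longrightarrow>
        1 \<le> (\<Sum>i. ennreal (K * diameter (U i) powr d))"
    and s: "s \<le> d" and AS: "A \<subseteq> S"
  shows "hausdorff_measure s S \<noteq> 0"
proof
  assume "hausdorff_measure s S = 0"
  moreover have "hausdorff_premeasure s 1 S \<le> hausdorff_measure s S"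
    unfolding hausdorff_measure_def by (rule SUP_upper) simp
  ultimately have "hausdorff_premeasure s 1 A = 0"
    using hausdorff_premeasure_mono[OF AS, of s 1] by simp
  then have "hausdorff_premeasure s 1 A < ennreal (1 / K)" using K(1) by simp
  then obtain U :: "nat \<Rightarrow> 'a set" where U: "A \<subseteq> (\<Union>i. U i)" "\<And>i. bounded (U i)" "\<And>i. diameter (U i) \<le> 1"
    and less: "(\<Sum>i. ennreal (diameter (U i) powr s)) < ennreal (1 / K)"
    unfolding hausdorff_premeasure_def by (auto simp: INF_less_iff)
  have "1 \<le> (\<Sum>i. ennreal (K * diameter (U i) powr d))" by (rule K(2)[OF U(1,2)])
  also have "\<dots> \<le> (\<Sum>i. ennreal K * ennreal (diameter (U i) powr s))"
  proof (rule suminf_le)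
    fix i
    have "diameter (U i) powr d \<le> diameter (U i) powr s"
      using U(2,3)[of i] s diameter_ge_0[OF U(2), of i] by (cases "diameter (U i) = 0") (auto intro: powr_mono')
    then have "ennreal (K * diameter (U i) powr d) \<le> ennreal (K * diameter (U i) powr s)"
      using K(1) by (intro ennreal_leI mult_left_mono) auto
    also have "\<dots> = ennreal K * ennreal (diameter (U i) powr s)"
      using K(1) by (intro ennreal_mult) auto
    finally show "ennreal (K * diameter (U i) powr d) \<le> ennreal K * ennreal (diameter (U i) powr s)" .
  qed auto
  also have "\<dots> = ennreal K * (\<Sum>i. ennreal (diameter (U i) powr s))" by (rule ennreal_suminf_cmult)
  also have "\<dots> < ennreal K * ennreal (1 / K)"
    using less K(1) by (intro ennreal_mult_strict_left_mono) auto
  also have "\<dots> = 1" using K(1) by (simp flip: ennreal_mult)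
  finally show False by simp
qed

text \<open>A Borel-Cantelli argument: for every \<open>n\<close> only the tail of the sets
  \<open>G k\<close> contributes, because the \<open>C k\<close> replacing the first
  \<open>n\<close> of them are null at every scale.\<close>

lemma hausdorff_measure_zero_of_limsup:
  fixes S :: "'a::metric_space set"
  assumes null: "\<And>k \<epsilon>. \<epsilon> > 0 \<Longrightarrow> hausdorff_premeasure s \<epsilon> (C k) = 0"
    and G: "\<And>k. hausdorff_premeasure s ((1/4) ^ k) (G k) \<le> ennreal ((1/4) ^ k)"
    and cover: "\<And>n. S \<subseteq> (\<Union>k. if k < n then C k else G k)"
  shows "hausdorff_measure s S = 0"
proof -
  have bound: "hausdorff_premeasure s \<delta> S \<le> 0 + ennreal e" if \<delta>: "\<delta> > 0" and e: "e > 0" for \<delta> e :: real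
  proof -
    \<comment> \<open>\<open>n1\<close> controls the sum of the tail, \<open>n2\<close> the scale:
      the covers of \<open>G k\<close> have diameters at most \<open>(1/4) ^ k\<close>, which must
      not exceed \<delta>.\<close>
    obtain n1 where n1: "(1/2) ^ n1 < e / 2" using real_arch_pow_inv[of "e/2" "1/2"] e by auto
    obtain n2 where n2: "(1/4) ^ n2 < \<delta>" using real_arch_pow_inv[of \<delta> "1/4"] \<delta> by auto
    define n where "n = max n1 n2"
    have "(1/2::real) ^ n \<le> (1/2) ^ n1" by (rule power_decreasing) (auto simp: n_def)
    then have ne: "(1/2::real) ^ n * 2 \<le> e" using n1 by linarith
    have "hausdorff_premeasure s \<delta> S \<le> (\<Sum>k. hausdorff_premeasure s \<delta> (if k < n then C k else G k))"
      by (rule order_trans[OF hausdorff_premeasure_mono[OF cover] hausdorff_premeasure_subadditive])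
    also have "\<dots> \<le> (\<Sum>k. ennreal ((1/2) ^ n * 2) * ennreal ((1/2) ^ Suc k))"
    proof (rule suminf_le)
      fix k
      show "hausdorff_premeasure s \<delta> (if k < n then C k else G k) \<le> ennreal ((1/2) ^ n * 2) * ennreal ((1/2) ^ Suc k)"
      proof (cases "k < n")
        case False
        have "(1/4::real) ^ k \<le> (1/4) ^ n2"
          using False by (intro power_decreasing) (auto simp: n_def)
        then have "hausdorff_premeasure s \<delta> (G k) \<le> hausdorff_premeasure s ((1/4) ^ k) (G k)"
          using n2 by (intro hausdorff_premeasure_antimono_scale) linarith
        also have "\<dots> \<le> ennreal ((1/4) ^ k)" by (rule G)
        also have "\<dots> \<le> ennreal ((1/2) ^ n * 2 * (1/2) ^ Suc k)"
        proof (rule ennreal_leI)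
          \<comment> \<open>One factor \<open>(1/2) ^ k\<close> makes the tail small, the other
            makes it summable.\<close>
          have "(1/4::real) ^ k = (1/2) ^ k * (1/2) ^ k" by (simp flip: power_mult_distrib)
          also have "\<dots> \<le> (1/2) ^ n * (1/2) ^ k"
            using False by (intro mult_right_mono power_decreasing) auto
          finally show "(1/4::real) ^ k \<le> (1/2) ^ n * 2 * (1/2) ^ Suc k" by simp
        qed
        also have "\<dots> = ennreal ((1/2) ^ n * 2) * ennreal ((1/2) ^ Suc k)" by (rule ennreal_mult) auto
        finally show ?thesis using False by simp
      qed (simp add: null \<delta>)
    qed auto
    also have "\<dots> = ennreal ((1/2) ^ n * 2)"
      unfolding ennreal_suminf_cmult
      by (subst suminf_ennreal_eq[OF zero_le_power power_half_series]) auto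
    also have "\<dots> \<le> ennreal e" by (rule ennreal_leI[OF ne])
    finally show ?thesis by simp
  qed
  have "hausdorff_premeasure s \<delta> S \<le> 0" if "\<delta> > 0" for \<delta>
    by (rule ennreal_le_epsilon) (rule bound[OF that])
  then have "hausdorff_measure s S \<le> 0" unfolding hausdorff_measure_def by (intro SUP_least) simp
  then show ?thesis by simp
qed

section \<open>Superposition of the families\<close>

lemma singular_solution:
  fixes \<Omega> \<Omega>s :: "'a::euclidean_space set"
  assumes N: "DIM('a) \<ge> 5" and \<Omega>: "open \<Omega>" "bounded \<Omega>" and \<Omega>s: "open \<Omega>s" "\<Omega>s \<subseteq> \<Omega>" "\<Omega>s \<noteq> {}"
  shows "\<exists>F \<in> L2 \<Omega>. \<exists>u. weak_solution \<Omega> F u \<and> (\<forall>x. x \<notin> \<Omega>s \<longrightarrow> u x = 0) \<and>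
     closure (Sing \<Omega> (\<lambda>x. ereal (u x))) = closure \<Omega>s \<and>
     hausdorff_dim (Sing \<Omega> (\<lambda>x. ereal (u x))) = ennreal (real DIM('a) - 4)"
proof -
  define s where "s = real DIM('a) - 4"
  have s: "s > 0" using N by (simp add: s_def)
  obtain T where T: "countable T" "T \<subseteq> \<Omega>s" "\<Omega>s \<subseteq> closure T" using separable by blast
  have "T \<noteq> {}" using T(3) \<Omega>s(3) by auto
  define p where "p = from_nat_into T"
  have p: "range p = T" unfolding p_def by (rule range_from_nat_into[OF \<open>T \<noteq> {}\<close> T(1)])
  \<comment> \<open>The dimensions increase to \<open>s\<close> without attaining it, as each family
    needs a strict inequality.\<close>
  define d where "d = (\<lambda>k::nat. s * (1 - 1 / (real k + 2)))"
  have d: "0 < d k" "d k < s" for k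
  proof -
    have "0 < 1 - 1 / (real k + 2)" "1 - 1 / (real k + 2) < 1" by (auto simp: field_simps)
    then show "0 < d k" "d k < s" using s unfolding d_def by (auto simp: mult_less_cancel_left2)
  qed
  have "\<exists>A E \<phi> w. p k \<in> A \<and> singular_family (d k) \<Omega>s A E \<phi> w" for k
    using p T(2) d[of k] by (intro exists_singular_family[OF N \<Omega>s(1)]) (auto simp: s_def)
  then obtain A E \<phi> w where pA: "\<And>k. p k \<in> A k" and fam: "\<And>k. singular_family (d k) \<Omega>s (A k) (E k) (\<phi> k) (w k)"
    by metis
  note famD = fam[THEN singular_family.subset] fam[THEN singular_family.test] fam[THEN singular_family.nonneg]
    fam[THEN singular_family.w_pos] fam[THEN singular_family.w_summable]
    fam[THEN singular_family.value_bound] fam[THEN singular_family.grad_bound]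
    fam[THEN singular_family.laplacian_bound] fam[THEN singular_family.blow_up] fam[THEN singular_family.cover_bound]
    fam[THEN singular_family.small_stage] fam[THEN singular_family.average]
  have "\<exists>j. hausdorff_premeasure s ((1/4) ^ k) (E k j) \<le> ennreal ((1/4) ^ k)" for k
    unfolding s_def by (rule famD(11)) simp
  \<comment> \<open>The neighbourhood \<open>E k (J k)\<close> is fixed now, because the weight of
    the family must beat the bound \<open>M k (J k)\<close> belonging to it.\<close>
  then obtain J where J: "\<And>k. hausdorff_premeasure s ((1/4) ^ k) (E k (J k)) \<le> ennreal ((1/4) ^ k)" by metis
  have "\<forall>k j. \<exists>M\<ge>0. \<forall>a R. a \<notin> E k j \<longrightarrow> R > 0 \<longrightarrow>
        ball_integral (\<lambda>x. \<Sum>i. ennreal (\<phi> k i x)) a R \<le> ennreal M * emeasure lborel (ball a R)"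
    using famD(12) by blast
  then obtain M where M0: "\<And>k j. M k j \<ge> 0" and M: "\<And>k j a R. a \<notin> E k j \<Longrightarrow> R > 0 \<Longrightarrow>
        ball_integral (\<lambda>x. \<Sum>i. ennreal (\<phi> k i x)) a R \<le> ennreal (M k j) * emeasure lborel (ball a R)"
    by metis
  define W where "W = (\<lambda>k. \<Sum>j. w k j)"
  have W: "W k \<ge> 0" for k
    unfolding W_def by (rule suminf_nonneg) (auto intro: less_imp_le famD)
  \<comment> \<open>One weight makes both the norm bounds \<open>W k\<close> and the average bounds
    summable over the families; the summand 1 keeps the denominator positive.\<close>
  define m where "m = (\<lambda>k. (1/2::real) ^ k / (1 + W k + M k (J k)))"
  have m: "m k > 0" "m k * W k \<le> (1/2) ^ k" "m k * M k (J k) \<le> (1/2) ^ k" for k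
  proof -
    have den: "1 + W k + M k (J k) > 0" using W[of k] M0[of k "J k"] by linarith
    then show "m k > 0" by (simp add: m_def)
    have "(1/2::real) ^ k * y \<le> (1/2) ^ k * (1 + W k + M k (J k))" if "y \<le> 1 + W k + M k (J k)" for y
      using that by (intro mult_left_mono) auto
    then show "m k * W k \<le> (1/2) ^ k" "m k * M k (J k) \<le> (1/2) ^ k"
      unfolding m_def using den W[of k] M0[of k "J k"] by (auto simp: divide_le_eq)
  qed
  \<comment> \<open>The double family is enumerated by pairing, so that one series of test functions
    represents the whole superposition.\<close>
  define \<Phi> where "\<Phi> = (\<lambda>n. case prod_decode n of (k, j) \<Rightarrow> (\<lambda>x. m k * \<phi> k j x))"
  have \<Phi>_enc: "\<Phi> (prod_encode (k, j)) = (\<lambda>x. m k * \<phi> k j x)" for k j by (simp add: \<Phi>_def)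
  define \<omega> where "\<omega> = (\<lambda>n. case prod_decode n of (k, j) \<Rightarrow> m k * w k j)"
  have \<Phi>: "\<Phi> n \<in> test_functions \<Omega>" "0 \<le> \<Phi> n x" "x \<notin> \<Omega>s \<Longrightarrow> \<Phi> n x = 0" for n x
    using test_functions_scale[OF famD(2) \<Omega>s(2)] famD(3) m(1) test_functionsD(2)[OF famD(2)]
    by (auto simp: \<Phi>_def less_imp_le split: prod.split)
  have \<omega>: "\<omega> n > 0" for n
    using m(1) famD(4) by (auto simp: \<omega>_def split: prod.split)
  have "summable \<omega>"
  proof (rule summable_suminf_not_top)
    show "0 \<le> \<omega> n" for n using \<omega>[of n] by simp
    have "(\<Sum>n. ennreal (\<omega> n)) = (\<Sum>n. (\<lambda>(k, j). ennreal (m k * w k j)) (prod_decode n))"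
      by (intro suminf_cong) (simp add: \<omega>_def split: prod.split)
    also have "\<dots> = (\<Sum>k. \<Sum>j. ennreal (m k * w k j))" by (rule suminf_ennreal_2dimen) simp
    also have "\<dots> \<le> (\<Sum>k. ennreal ((1/2) ^ k))"
    proof (rule suminf_le)
      fix k
      have "(\<Sum>j. ennreal (m k * w k j)) = ennreal (\<Sum>j. m k * w k j)"
        using m(1) famD(4) by (intro suminf_ennreal2 summable_mult famD(5)) (simp add: less_imp_le)
      also have "(\<Sum>j. m k * w k j) = m k * W k" unfolding W_def by (rule suminf_mult[OF famD(5)])
      also have "ennreal (m k * W k) \<le> ennreal ((1/2) ^ k)" by (rule ennreal_leI[OF m(2)])
      finally show "(\<Sum>j. ennreal (m k * w k j)) \<le> ennreal ((1/2) ^ k)" .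
    qed auto
    also have "\<dots> = ennreal (\<Sum>k. (1/2) ^ k)" by (intro suminf_ennreal2 summable_geometric) auto
    finally show "(\<Sum>n. ennreal (\<omega> n)) \<noteq> top" by (auto simp: top_unique)
  qed
  have b0: "(\<integral>\<^sup>+x. ennreal ((norm (\<Phi> n x))\<^sup>2) \<partial>lebesgue_on \<Omega>) \<le> ennreal ((\<omega> n)\<^sup>2)" for n
  proof -
    obtain k j where n: "prod_decode n = (k, j)" by (cases "prod_decode n")
    show ?thesis
      using nn_integral_norm_square_scale[OF \<Omega>(1) test_functions_borel[OF famD(2)] less_imp_le[OF famD(4)] famD(6), of "m k" k j]
      by (simp add: \<Phi>_def \<omega>_def n)
  qed
  have b1: "(\<integral>\<^sup>+x. ennreal ((norm (grad (\<Phi> n) x))\<^sup>2) \<partial>lebesgue_on \<Omega>) \<le> ennreal ((\<omega> n)\<^sup>2)" for n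
  proof -
    obtain k j where n: "prod_decode n = (k, j)" by (cases "prod_decode n")
    show ?thesis
      using nn_integral_norm_square_scale[OF \<Omega>(1) grad_borel[OF famD(2)] less_imp_le[OF famD(4)] famD(7), of "m k" k j]
      by (simp add: \<Phi>_def \<omega>_def n grad_scale[OF test_functionsD(1)[OF famD(2)]])
  qed
  have b2: "(\<integral>\<^sup>+x. ennreal ((norm (laplacian (\<Phi> n) x))\<^sup>2) \<partial>lebesgue_on \<Omega>) \<le> ennreal ((\<omega> n)\<^sup>2)" for n
  proof -
    obtain k j where n: "prod_decode n = (k, j)" by (cases "prod_decode n")
    show ?thesis
      using nn_integral_norm_square_scale[OF \<Omega>(1) laplacian_borel[OF famD(2)] less_imp_le[OF famD(4)] famD(8), of "m k" k j]
      by (simp add: \<Phi>_def \<omega>_def n laplacian_scale[OF test_functionsD(1)[OF famD(2)]])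
  qed
  note series = weak_solution_series[OF \<Omega>(1) \<Phi>(1) \<omega> \<open>summable \<omega>\<close> b0 b1 b2]
  define u where "u = (\<lambda>x. \<Sum>n. \<Phi> n x)"
  obtain F where F: "F \<in> L2 \<Omega>" "weak_solution \<Omega> F u" using series(2) unfolding u_def by blast
  have u0: "u x = 0" if "x \<notin> \<Omega>s" for x
    using that by (simp add: u_def \<Phi>(3))
  \<comment> \<open>In \<open>ennreal\<close> the series converges everywhere and may be regrouped
    by families. Where the real series diverges, \<open>u x\<close> is only a default value, but
    there \<open>U x\<close> is infinite and still dominates it.\<close>
  define U where "U = (\<lambda>x. \<Sum>n. ennreal (\<Phi> n x))"
  have U_double: "U x = (\<Sum>k. ennreal (m k) * (\<Sum>j. ennreal (\<phi> k j x)))" for x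
  proof -
    have eq: "(\<Sum>j. ennreal (m k * \<phi> k j x)) = ennreal (m k) * (\<Sum>j. ennreal (\<phi> k j x))" for k
      unfolding ennreal_suminf_cmult[symmetric]
      using m(1)[of k] famD(3) by (intro suminf_cong ennreal_mult) (auto simp: less_imp_le)
    have "U x = (\<Sum>n. (\<lambda>(k, j). ennreal (m k * \<phi> k j x)) (prod_decode n))"
      unfolding U_def by (intro suminf_cong) (simp add: \<Phi>_def split: prod.split)
    also have "\<dots> = (\<Sum>k. \<Sum>j. ennreal (m k * \<phi> k j x))" by (rule suminf_ennreal_2dimen) simp
    finally show ?thesis by (simp only: eq)
  qed
  have \<phi>_meas [measurable]: "\<phi> k j \<in> borel_measurable borel" for k j by (rule test_functions_borel[OF famD(2)])
  have U_meas [measurable]: "U \<in> borel_measurable borel" unfolding U_double[abs_def] by measurable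
  have uU: "ennreal (u x) \<le> U x" for x
  proof (cases "U x = top")
    case False
    then have "summable (\<lambda>n. \<Phi> n x)" unfolding U_def by (intro summable_suminf_not_top \<Phi>(2))
    then show ?thesis unfolding U_def u_def by (simp add: suminf_ennreal2 \<Phi>(2))
  qed simp
  define S where "S = Sing \<Omega> (\<lambda>x. ereal (u x))"
  \<comment> \<open>All terms are nonnegative, so wherever the series converges a single one of them
    already gives the lower bound.\<close>
  have AS: "A k \<subseteq> S" for k
  proof
    fix a assume a: "a \<in> A k"
    then have a\<Omega>: "a \<in> \<Omega>" using famD(1) \<Omega>s(2) by blast
    obtain C \<gamma> r where C: "C > 0" "\<gamma> > 0" "r > 0" and
      low: "\<forall>a\<in>A k. \<forall>x\<in>ball a r. x \<noteq> a \<longrightarrow> (\<exists>j. C * norm (x - a) powr (-\<gamma>) \<le> \<phi> k j x)"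
      using famD(9) by blast
    obtain r0 where r0: "r0 > 0" "ball a r0 \<subseteq> \<Omega>" using \<Omega>(1) a\<Omega> open_contains_ball by blast
    define r' where "r' = min r r0"
    have r': "r' > 0" "ball a r' \<subseteq> \<Omega>" "ball a r' \<subseteq> ball a r"
      using C r0 subset_ball[of r' r0 a] subset_ball[of r' r a] by (auto simp: r'_def)
    have "AE x in lebesgue. x \<in> \<Omega> \<longrightarrow> summable (\<lambda>n. norm (\<Phi> n x))"
      using series(1) \<Omega>(1) by (subst (asm) AE_lebesgue_on_iff) auto
    then have "AE x in lebesgue. x \<in> ball a r' \<longrightarrow> ereal (m k * C * norm (x - a) powr (-\<gamma>)) \<le> ereal (u x)"
    proof eventually_elim
      case (elim x)
      show ?case
      proof
        assume x: "x \<in> ball a r'"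
        then have sm: "summable (\<lambda>n. \<Phi> n x)"
          using elim r'(2) by (auto intro: summable_norm_cancel)
        have "m k * C * norm (x - a) powr (-\<gamma>) \<le> u x"
        proof (cases "x = a")
          case True
          \<comment> \<open>At the centre the left-hand side is 0, since
            \<open>0 powr (-\<gamma>) = 0\<close>.\<close>
          then show ?thesis unfolding u_def using suminf_nonneg[OF sm] \<Phi>(2) by simp
        next
          case False
          then obtain j where "C * norm (x - a) powr (-\<gamma>) \<le> \<phi> k j x" using low a x r'(3) by blast
          then have "m k * C * norm (x - a) powr (-\<gamma>) \<le> \<Phi> (prod_encode (k, j)) x"
            using m(1)[of k] by (simp add: \<Phi>_enc mult.assoc mult_left_mono)
          also have "\<dots> \<le> u x"
            unfolding u_def using sum_le_suminf[OF sm, of "{prod_encode (k, j)}"] \<Phi>(2) by simp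
          finally show ?thesis .
        qed
        then show "ereal (m k * C * norm (x - a) powr (-\<gamma>)) \<le> ereal (u x)" by simp
      qed
    qed
    then have "AE x in lebesgue_on (ball a r'). ereal (m k * C * norm (x - a) powr (-\<gamma>)) \<le> ereal (u x)"
      by (subst AE_lebesgue_on_iff) auto
    moreover have "m k * C > 0" using m(1) C(1) by simp
    ultimately show "a \<in> S"
      unfolding S_def Sing_def using a\<Omega> C(2) r'(1,2) by blast
  qed
  have S_sub: "S \<subseteq> closure \<Omega>s"
  proof
    fix a assume a: "a \<in> S"
    show "a \<in> closure \<Omega>s"
    proof (rule ccontr)
      assume "a \<notin> closure \<Omega>s"
      then obtain R0 where R0: "R0 > 0" "ball a R0 \<subseteq> - closure \<Omega>s"
        using open_contains_ball[of "- closure \<Omega>s"] by auto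
      have "ball_integral U a R \<le> ennreal 0 * emeasure lborel (ball a R)" if "R \<le> R0" for R
      proof -
        have z: "U x * indicator (ball a R) x = 0" for x
        proof (cases "x \<in> ball a R")
          case True
          then have "x \<notin> closure \<Omega>s" using R0(2) subset_ball[OF that, of a] by blast
          then have "x \<notin> \<Omega>s" using closure_subset by blast
          then show ?thesis by (simp add: U_def \<Phi>(3))
        qed simp
        show ?thesis unfolding z by simp
      qed
      then have "a \<notin> Sing \<Omega> (\<lambda>x. ereal (u x))"
        by (intro not_Sing_of_average_bound[OF U_meas uU R0(1), of 0]) auto
      with a show False by (simp add: S_def)
    qed
  qed
  \<comment> \<open>The intersection of all stages takes the place of the \<open>k\<close>-th Cantor
    set: its points are those for which no average bound of the \<open>k\<close>-th family is
    available.\<close>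
  have cover: "S \<subseteq> (\<Union>k. if k < n then (\<Inter>j. E k j) else E k (J k))" for n
  proof
    fix a assume a: "a \<in> S"
    show "a \<in> (\<Union>k. if k < n then (\<Inter>j. E k j) else E k (J k))"
    proof (rule ccontr)
      assume "a \<notin> (\<Union>k. if k < n then (\<Inter>j. E k j) else E k (J k))"
      then have out: "a \<notin> (if k < n then (\<Inter>j. E k j) else E k (J k))" for k by blast
      \<comment> \<open>For the finitely many \<open>k < n\<close> any stage that misses
        \<open>a\<close> will do, however large its bound; from \<open>n\<close> on the stage is
        \<open>J k\<close>, for which the weights were tuned, so the weighted bounds are
        summable.\<close>
      have "\<exists>j. a \<notin> E k j \<and> (k \<ge> n \<longrightarrow> j = J k)" for k
        using out[of k] by (cases "k < n") auto
      then obtain l where l: "\<And>k. a \<notin> E k (l k)" "\<And>k. k \<ge> n \<Longrightarrow> l k = J k" by metis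
      have sm: "summable (\<lambda>k. m k * M k (l k))"
      proof (rule summable_comparison_test)
        show "summable (\<lambda>k. (1/2::real) ^ k)" by (rule summable_geometric) simp
        show "\<exists>n. \<forall>k\<ge>n. norm (m k * M k (l k)) \<le> (1/2) ^ k"
          using l(2) m M0 by (intro exI[of _ n]) (auto simp: abs_mult less_imp_le)
      qed
      define Mt where "Mt = (\<Sum>k. m k * M k (l k))"
      have Mt: "Mt \<ge> 0"
        unfolding Mt_def using m(1) M0 by (intro suminf_nonneg sm) (simp add: less_imp_le)
      have "ball_integral U a R \<le> ennreal Mt * emeasure lborel (ball a R)" if R: "0 < R" for R
      proof -
        have [measurable]: "ball a R \<in> sets borel" by simp
        have "ball_integral U a R
            = (\<integral>\<^sup>+x. (\<Sum>k. ennreal (m k) * ((\<Sum>j. ennreal (\<phi> k j x)) * indicator (ball a R) x)) \<partial>lborel)"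
          unfolding U_double by (simp add: mult.assoc flip: ennreal_suminf_multc)
        also have "\<dots> = (\<Sum>k. \<integral>\<^sup>+x. ennreal (m k) * ((\<Sum>j. ennreal (\<phi> k j x)) * indicator (ball a R) x) \<partial>lborel)"
          by (rule nn_integral_suminf) measurable
        also have "\<dots> \<le> (\<Sum>k. ennreal (m k * M k (l k)) * emeasure lborel (ball a R))"
        proof (rule suminf_le)
          fix k
          have "(\<integral>\<^sup>+x. ennreal (m k) * ((\<Sum>j. ennreal (\<phi> k j x)) * indicator (ball a R) x) \<partial>lborel)
              = ennreal (m k) * ball_integral (\<lambda>x. \<Sum>j. ennreal (\<phi> k j x)) a R"
            by (rule nn_integral_cmult) measurable
          also have "\<dots> \<le> ennreal (m k) * (ennreal (M k (l k)) * emeasure lborel (ball a R))"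
            by (intro mult_left_mono M l R) simp
          also have "\<dots> = ennreal (m k * M k (l k)) * emeasure lborel (ball a R)"
            using m(1)[of k] M0 by (simp add: ennreal_mult mult.assoc less_imp_le)
          finally show "(\<integral>\<^sup>+x. ennreal (m k) * ((\<Sum>j. ennreal (\<phi> k j x)) * indicator (ball a R) x) \<partial>lborel)
              \<le> ennreal (m k * M k (l k)) * emeasure lborel (ball a R)" .
        qed auto
        also have "\<dots> = (\<Sum>k. ennreal (m k * M k (l k))) * emeasure lborel (ball a R)"
          by (rule ennreal_suminf_multc)
        also have "(\<Sum>k. ennreal (m k * M k (l k))) = ennreal Mt"
          unfolding Mt_def using m(1) M0 by (intro suminf_ennreal2 sm) (simp add: less_imp_le)
        finally show ?thesis .
      qed
      then have "a \<notin> Sing \<Omega> (\<lambda>x. ereal (u x))"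
        by (intro not_Sing_of_average_bound[OF U_meas uU zero_less_one Mt]) auto
      with a show False by (simp add: S_def)
    qed
  qed
  \<comment> \<open>The intersection lies in stages whose premeasure is arbitrarily small at
    arbitrarily fine scales; refining the scale only increases a premeasure.\<close>
  have null: "hausdorff_premeasure s \<epsilon> (\<Inter>j. E k j) = 0" if "\<epsilon> > 0" for k \<epsilon>
  proof -
    have bound: "hausdorff_premeasure s \<epsilon> (\<Inter>j. E k j) \<le> 0 + ennreal e" if e: "e > 0" for e
    proof -
      have "min e \<epsilon> > 0" using e \<open>\<epsilon> > 0\<close> by simp
      then obtain j where j: "hausdorff_premeasure s (min e \<epsilon>) (E k j) \<le> ennreal (min e \<epsilon>)"
        using famD(11)[of "min e \<epsilon>" k] unfolding s_def by blast
      have "hausdorff_premeasure s \<epsilon> (\<Inter>j. E k j) \<le> hausdorff_premeasure s \<epsilon> (E k j)"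
        by (rule hausdorff_premeasure_mono) auto
      also have "\<dots> \<le> hausdorff_premeasure s (min e \<epsilon>) (E k j)"
        by (rule hausdorff_premeasure_antimono_scale) simp
      also have "\<dots> \<le> ennreal (min e \<epsilon>)" by (rule j)
      also have "\<dots> \<le> ennreal e" by (rule ennreal_leI) simp
      finally show ?thesis by simp
    qed
    have "hausdorff_premeasure s \<epsilon> (\<Inter>j. E k j) \<le> 0"
      by (rule ennreal_le_epsilon) (rule bound)
    then show ?thesis by simp
  qed
  have "hausdorff_measure s S = 0"
    by (rule hausdorff_measure_zero_of_limsup[OF null J cover])
  then have upper: "hausdorff_dim S \<le> ennreal s"
    unfolding hausdorff_dim_def using s by (intro INF_lower) auto
  have "ennreal s \<le> hausdorff_dim S"
    unfolding hausdorff_dim_def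
  proof (rule INF_greatest)
    fix t assume t: "t \<in> {t. 0 < t \<and> hausdorff_measure t S = 0}"
    \<comment> \<open>Otherwise some \<open>d k\<close> is at least \<open>t\<close>, and the cover
      bound for \<open>A k\<close>, a subset of \<open>S\<close>, excludes measure zero in dimension
      \<open>t\<close>.\<close>
    have "s \<le> t"
    proof (rule ccontr)
      assume "\<not> s \<le> t"
      then have "0 < 1 - t / s" using s by (simp add: field_simps)
      then obtain k :: nat where k: "inverse (real (Suc k)) < 1 - t / s" using reals_Archimedean by blast
      have "1 / (real k + 2) \<le> inverse (real (Suc k))" by (simp add: field_simps)
      then have "t / s \<le> 1 - 1 / (real k + 2)" using k by linarith
      then have td: "t \<le> d k" using s by (simp add: d_def field_simps)
      obtain K where K: "K > 0" "\<forall>U::nat \<Rightarrow> 'a set. A k \<subseteq> (\<Union>i. U i) \<longrightarrow> (\<forall>i. bounded (U i)) \<longrightarrow>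
          1 \<le> (\<Sum>i. ennreal (K * diameter (U i) powr d k))"
        using famD(10) by blast
      have "hausdorff_measure t S \<noteq> 0"
        by (rule hausdorff_measure_pos_of_cover_bound[OF K(1) _ td AS]) (use K(2) in blast)
      with t show False by simp
    qed
    then show "ennreal s \<le> ennreal t" by (rule ennreal_leI)
  qed
  with upper have dim: "hausdorff_dim S = ennreal s" by (rule antisym)
  have "T \<subseteq> S" using p pA AS by blast
  then have "\<Omega>s \<subseteq> closure S" using T(3) closure_mono by blast
  then have "closure S = closure \<Omega>s"
    using S_sub by (intro antisym) (simp_all add: closure_minimal)
  with F u0 dim show ?thesis by (auto simp: S_def s_def)
qed

theorem theorem3:
  fixes \<Omega> \<Omega>\<^sub>s :: "(real ^ 'n) set"
  assumes "CARD('n) \<ge> 5"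
    and "open \<Omega>" "bounded \<Omega>" "\<Omega> \<noteq> {}"
    and "open \<Omega>\<^sub>s" "\<Omega>\<^sub>s \<subseteq> \<Omega>" "\<Omega>\<^sub>s \<noteq> {}"
  shows "\<exists>F \<in> L2 \<Omega>. \<exists>u.
           weak_solution \<Omega> F u \<and>
           (\<forall>w. weak_solution \<Omega> F w \<longrightarrow> (AE x in lebesgue_on \<Omega>. w x = u x)) \<and>
           closure (Sing \<Omega> (\<lambda>x. ereal (u x))) = closure \<Omega>\<^sub>s \<and>
           (\<forall>\<alpha>\<in>{0<..<1}. \<exists>v \<in> C2_Holder_loc \<alpha> (\<Omega> - closure \<Omega>\<^sub>s).
              AE x in lebesgue_on (\<Omega> - closure \<Omega>\<^sub>s). u x = v x) \<and>
           hausdorff_dim (Sing \<Omega> (\<lambda>x. ereal (u x))) = ennreal (real CARD('n) - 4)"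
proof -
  obtain F u where F: "F \<in> L2 \<Omega>" "weak_solution \<Omega> F u" and u0: "\<And>x. x \<notin> \<Omega>\<^sub>s \<Longrightarrow> u x = 0"
    and Sing: "closure (Sing \<Omega> (\<lambda>x. ereal (u x))) = closure \<Omega>\<^sub>s"
      "hausdorff_dim (Sing \<Omega> (\<lambda>x. ereal (u x))) = ennreal (real CARD('n) - 4)"
    using singular_solution[of \<Omega> \<Omega>\<^sub>s] assms by auto
  have "u x = 0" if "x \<in> space (lebesgue_on (\<Omega> - closure \<Omega>\<^sub>s))" for x
    using that closure_subset by (intro u0) (auto simp: space_restrict_space)
  then have "AE x in lebesgue_on (\<Omega> - closure \<Omega>\<^sub>s). u x = 0"
    by (rule AE_I2)
  \<comment> \<open>The zero function is the regular representative for every exponent.\<close>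
  then have "\<forall>\<alpha>\<in>{0<..<1}. \<exists>v \<in> C2_Holder_loc \<alpha> (\<Omega> - closure \<Omega>\<^sub>s).
      AE x in lebesgue_on (\<Omega> - closure \<Omega>\<^sub>s). u x = v x"
    using zero_C2_Holder_loc by (intro ballI bexI[of _ "\<lambda>x. 0"])
  \<comment> \<open>This justifies calling \<open>u\<close> the solution associated with
    \<open>F\<close>, up to null sets.\<close>
  moreover have "\<forall>w. weak_solution \<Omega> F w \<longrightarrow> (AE x in lebesgue_on \<Omega>. w x = u x)"
    using weak_solution_unique[OF assms(2,3) F(2)] by blast
  ultimately show ?thesis
    using F Sing by (intro bexI[of _ F] exI[of _ u] conjI)
qed

end
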